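(* Let $H$ be a real Hilbert space and let $A$ be a nonnegative self-adjoint linear operator on $H$ that is an unbounded positive multiplication operator. Let $T_0>0$ and $\mu_2>\mu_1>0$ be real numbers, and let $\omega:(0,T_0]\to(0,+\infty)$ and $\psi:(0,T_0]\to(0,+\infty)$ be two nonincreasing functions such that $$\lim_{t\to 0^+}\omega(t)=+\infty\qquad\text{and}\qquad\lim_{t\to 0^+}\frac{\omega(t)\psi(t)}{|\log t|}=+\infty.$$ Let $\mathcal{PS}^{(2)}(T_0,\mu_1,\mu_2,\omega,\psi)$ be the set of propagation speeds defined in the context, with the structure of complete metric space induced by the distance $d_{\mathcal{PS}^{(2)}}$ defined there. Then the set of propagation speeds $c\in\mathcal{PS}^{(2)}(T_0,\mu_1,\mu_2,\omega,\psi)$ for which the problem $$u''(t)+c(t)Au(t)=0,\qquad u(0)=u_0,\quad u'(0)=u_1,$$ on $[0,T_0]$ exhibits an infinite derivative loss is residual in $\mathcal{PS}^{(2)}(T_0,\mu_1,\mu_2,\omega,\psi)$.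
   Context: Unbounded positive multiplication operator. $A$ is an unbounded positive multiplication operator if there exist a sequence $\{e_n\}\subseteq H$ of orthonormal vectors (not necessarily a Hilbert basis) and an unbounded sequence $\{\lambda_n\}$ of positive real numbers such that $Ae_n=\lambda_ne_n$ for every $n\geq 1$. Propagation speeds. $\mathcal{PS}^{(2)}(T_0,\mu_1,\mu_2,\omega,\psi)$ is the set of functions $c\in C^0([0,T_0])\cap C^2((0,T_0])$ such that $\mu_1\leq c(t)\leq\mu_2$ for every $t\in(0,T_0)$, and $|c'(t)|\leq\omega(t)/t$ and $|c''(t)|\leq\frac{\omega(t)^2}{t^2}\exp(\psi(t))$ for every $t\in(0,T_0]$. It is a complete metric space with the distance $$d_{\mathcal{PS}^{(2)}}(c_1,c_2):=\sup_{t\in(0,T_0)}|c_1(t)-c_2(t)|+\sup_{t\in(0,T_0)}\left\{\frac{t^2}{\omega(t)}|c_1'(t)-c_2'(t)|\right\}+\sup_{t\in(0,T_0)}\left\{\frac{t^3\exp(-\psi(t))}{\omega(t)^2}|c_1''(t)-c_2''(t)|\right\}.$$ A subset of a metric space is residual if its complement is contained in a countable union of closed sets with empty interior. Scale of spaces. By the spectral theorem, $A$ is unitarily equivalent to multiplication by a nonnegative measurable function $a(\xi)$ on some space $L^2(X,\mu)$. For every real $\beta$ (also negative), $D(A^\beta)$ denotes the space of (classes of) measurable functions $v$ on $X$ with $(1+a)^\beta v\in L^2(X,\mu)$. Solutions. A (possibly very weak) solution is defined componentwise: for a.e. $\xi\in X$, $t\mapsto u(t,\xi)$ solves $u''(t,\xi)+c(t)a(\xi)u(t,\xi)=0$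 on $[0,T_0]$, with initial data $u(0,\xi)=u_0(\xi)$, $u'(0,\xi)=u_1(\xi)$, where $u_0,u_1$ are measurable functions on $X$. Infinite derivative loss. The problem exhibits an infinite derivative loss if there exists a solution $u(t)$ such that $(u(0),u'(0))\in D(A^{\beta+1/2})\times D(A^\beta)$ for every $\beta>0$, but $(u(t),u'(t))\notin D(A^{-\beta+1/2})\times D(A^{-\beta})$ for every $\beta>0$ and every $t\in(0,T_0]$. *)

theory Defs
  imports "HOL-Analysis.Analysis"
begin

subsection \<open>Self-adjoint operators\<close>

text \<open>An unbounded operator is a pair of a domain \<open>D\<close> and a function \<open>A\<close> of which only the
  restriction to \<open>D\<close> is relevant.\<close>

definition adjoint_graph :: "'h::real_inner set \<Rightarrow> ('h \<Rightarrow> 'h) \<Rightarrow> ('h \<times> 'h) set" where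
  "adjoint_graph D A = {(y, z). \<forall>x\<in>D. inner (A x) y = inner x z}"

definition self_adjoint_op :: "'h::real_inner set \<Rightarrow> ('h \<Rightarrow> 'h) \<Rightarrow> bool" where
  "self_adjoint_op D A \<longleftrightarrow>
     subspace D \<and> closure D = UNIV \<and>
     (\<forall>x\<in>D. \<forall>y\<in>D. A (x + y) = A x + A y) \<and>
     (\<forall>r. \<forall>x\<in>D. A (r *\<^sub>R x) = r *\<^sub>R A x) \<and>
     adjoint_graph D A = (\<lambda>x. (x, A x)) ` D"

definition nonneg_op :: "'h::real_inner set \<Rightarrow> ('h \<Rightarrow> 'h) \<Rightarrow> bool" where
  "nonneg_op D A \<longleftrightarrow> (\<forall>x\<in>D. inner (A x) x \<ge> 0)"

definition unbounded_pos_mult_op :: "'h::real_inner set \<Rightarrow> ('h \<Rightarrow> 'h) \<Rightarrow> bool" where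
  "unbounded_pos_mult_op D A \<longleftrightarrow>
     (\<exists>(e :: nat \<Rightarrow> 'h) (l :: nat \<Rightarrow> real).
        (\<forall>m n. inner (e m) (e n) = (if m = n then 1 else 0)) \<and>
        (\<forall>n. l n > 0) \<and> \<not> bdd_above (range l) \<and>
        (\<forall>n. e n \<in> D \<and> A (e n) = l n *\<^sub>R e n))"

subsection \<open>Spectral representation and the scale of spaces\<close>

definition L2 :: "'x measure \<Rightarrow> ('x \<Rightarrow> real) set" where
  "L2 M = {f \<in> borel_measurable M. integrable M (\<lambda>x. (f x)\<^sup>2)}"

text \<open>Elements of \<open>L\<^sup>2(X,\<mu>)\<close> are represented by functions, so linearity, surjectivity and the
  intertwining relation hold up to almost everywhere equality.\<close>

definition unitary_L2 :: "'x measure \<Rightarrow> ('h::real_inner \<Rightarrow> 'x \<Rightarrow> real) \<Rightarrow> bool" where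
  "unitary_L2 M U \<longleftrightarrow>
     (\<forall>v. U v \<in> L2 M) \<and>
     (\<forall>v w. AE x in M. U (v + w) x = U v x + U w x) \<and>
     (\<forall>r v. AE x in M. U (r *\<^sub>R v) x = r * U v x) \<and>
     (\<forall>v w. inner v w = (LINT x|M. U v x * U w x)) \<and>
     (\<forall>f\<in>L2 M. \<exists>v. AE x in M. U v x = f x)"

definition spectral_representation ::
    "'h::real_inner set \<Rightarrow> ('h \<Rightarrow> 'h) \<Rightarrow> 'x measure \<Rightarrow> ('x \<Rightarrow> real) \<Rightarrow> ('h \<Rightarrow> 'x \<Rightarrow> real) \<Rightarrow> bool" where
  "spectral_representation D A M a U \<longleftrightarrow>
     a \<in> borel_measurable M \<and> (\<forall>x\<in>space M. a x \<ge> 0) \<and>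
     unitary_L2 M U \<and>
     D = {v. (\<lambda>x. a x * U v x) \<in> L2 M} \<and>
     (\<forall>v\<in>D. AE x in M. U (A v) x = a x * U v x)"

text \<open>\<open>D(A\<^sup>\<beta>)\<close> is a space of almost everywhere classes: a function belongs to it if its class
  contains a measurable \<open>w\<close> with \<open>(1+a)\<^sup>\<beta> w \<in> L\<^sup>2\<close>. Requiring measurability of \<open>v\<close> itself would
  make non-membership depend on the values on null sets (the measure need not be complete).\<close>

definition power_dom :: "'x measure \<Rightarrow> ('x \<Rightarrow> real) \<Rightarrow> real \<Rightarrow> ('x \<Rightarrow> real) set" where
  "power_dom M a \<beta> =
     {v. \<exists>w\<in>borel_measurable M. (AE x in M. v x = w x) \<and> (\<lambda>x. (1 + a x) powr \<beta> * w x) \<in> L2 M}"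

subsection \<open>Solutions and infinite derivative loss\<close>

text \<open>A solution is given together with its time derivative: \<open>u t x\<close> and \<open>u' t x\<close>. Derivatives at
  the end points of \<open>[0,T0]\<close> are one-sided. The exceptional null set does not depend on \<open>t\<close>.\<close>

definition is_solution ::
    "real \<Rightarrow> 'x measure \<Rightarrow> ('x \<Rightarrow> real) \<Rightarrow> (real \<Rightarrow> real) \<Rightarrow> ('x \<Rightarrow> real) \<Rightarrow> ('x \<Rightarrow> real) \<Rightarrow>
     (real \<Rightarrow> 'x \<Rightarrow> real) \<Rightarrow> (real \<Rightarrow> 'x \<Rightarrow> real) \<Rightarrow> bool" where
  "is_solution T0 M a c u0 u1 u u' \<longleftrightarrow>
     u0 \<in> borel_measurable M \<and> u1 \<in> borel_measurable M \<and>
     (AE x in M.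
        u 0 x = u0 x \<and> u' 0 x = u1 x \<and>
        (\<forall>t\<in>{0..T0}.
           ((\<lambda>s. u s x) has_real_derivative u' t x) (at t within {0..T0}) \<and>
           ((\<lambda>s. u' s x) has_real_derivative - (c t * a x * u t x)) (at t within {0..T0})))"

definition infinite_derivative_loss ::
    "real \<Rightarrow> 'x measure \<Rightarrow> ('x \<Rightarrow> real) \<Rightarrow> (real \<Rightarrow> real) \<Rightarrow> bool" where
  "infinite_derivative_loss T0 M a c \<longleftrightarrow>
     (\<exists>u0 u1 u u'. is_solution T0 M a c u0 u1 u u' \<and>
        (\<forall>\<beta>>0. (u 0, u' 0) \<in> power_dom M a (\<beta> + 1/2) \<times> power_dom M a \<beta>) \<and>
        (\<forall>\<beta>>0. \<forall>t\<in>{0<..T0}.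
           (u t, u' t) \<notin> power_dom M a (- \<beta> + 1/2) \<times> power_dom M a (- \<beta>)))"

subsection \<open>Propagation speeds\<close>

text \<open>First and second derivative on \<open>(0,T0]\<close>, one-sided at \<open>T0\<close>.\<close>

definition D1 :: "real \<Rightarrow> (real \<Rightarrow> real) \<Rightarrow> real \<Rightarrow> real" where
  "D1 T0 c t = vector_derivative c (at t within {0<..T0})"

definition D2 :: "real \<Rightarrow> (real \<Rightarrow> real) \<Rightarrow> real \<Rightarrow> real" where
  "D2 T0 c = D1 T0 (D1 T0 c)"

definition C2_Ioc :: "real \<Rightarrow> (real \<Rightarrow> real) \<Rightarrow> bool" where
  "C2_Ioc T0 c \<longleftrightarrow>
     c differentiable_on {0<..T0} \<and> D1 T0 c differentiable_on {0<..T0} \<and>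
     continuous_on {0<..T0} (D2 T0 c)"

text \<open>Functions on \<open>[0,T0]\<close> are total functions that are \<open>undefined\<close> outside \<open>[0,T0]\<close>, so that
  the distance below separates points.\<close>

definition PS2 ::
    "real \<Rightarrow> real \<Rightarrow> real \<Rightarrow> (real \<Rightarrow> real) \<Rightarrow> (real \<Rightarrow> real) \<Rightarrow> (real \<Rightarrow> real) set" where
  "PS2 T0 \<mu>1 \<mu>2 \<omega> \<psi> =
     {c \<in> extensional {0..T0}.
        continuous_on {0..T0} c \<and> C2_Ioc T0 c \<and>
        (\<forall>t\<in>{0<..<T0}. \<mu>1 \<le> c t \<and> c t \<le> \<mu>2) \<and>
        (\<forall>t\<in>{0<..T0}. \<bar>D1 T0 c t\<bar> \<le> \<omega> t / t) \<and>
        (\<forall>t\<in>{0<..T0}. \<bar>D2 T0 c t\<bar> \<le> (\<omega> t)\<^sup>2 / t\<^sup>2 * exp (\<psi> t))}"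

text \<open>On \<open>PS2\<close> all three suprema are over bounded sets. The value \<open>0\<close> outside \<open>PS2\<close> is
  irrelevant; it is there because \<open>Metric_space\<close> wants a nonnegative function on the whole type.\<close>

definition dist_PS2 ::
    "real \<Rightarrow> real \<Rightarrow> real \<Rightarrow> (real \<Rightarrow> real) \<Rightarrow> (real \<Rightarrow> real) \<Rightarrow>
     (real \<Rightarrow> real) \<Rightarrow> (real \<Rightarrow> real) \<Rightarrow> real" where
  "dist_PS2 T0 \<mu>1 \<mu>2 \<omega> \<psi> c1 c2 =
     (if c1 \<in> PS2 T0 \<mu>1 \<mu>2 \<omega> \<psi> \<and> c2 \<in> PS2 T0 \<mu>1 \<mu>2 \<omega> \<psi> then
        (SUP t\<in>{0<..<T0}. \<bar>c1 t - c2 t\<bar>) +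
        (SUP t\<in>{0<..<T0}. t\<^sup>2 / \<omega> t * \<bar>D1 T0 c1 t - D1 T0 c2 t\<bar>) +
        (SUP t\<in>{0<..<T0}. t ^ 3 * exp (- \<psi> t) / (\<omega> t)\<^sup>2 * \<bar>D2 T0 c1 t - D2 T0 c2 t\<bar>)
      else 0)"

definition residual_in :: "'a topology \<Rightarrow> 'a set \<Rightarrow> bool" where
  "residual_in X S \<longleftrightarrow>
     S \<subseteq> topspace X \<and>
     (\<exists>\<F>. countable \<F> \<and> (\<forall>F\<in>\<F>. closedin X F \<and> X interior_of F = {}) \<and>
        topspace X - S \<subseteq> \<Union>\<F>)"

lemma PS2_bounds:
  assumes T: "T0 > 0" and om: "\<And>t. t \<in> {0<..T0} \<Longrightarrow> \<omega> t > 0"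
    and c1: "c1 \<in> PS2 T0 \<mu>1 \<mu>2 \<omega> \<psi>" and c2: "c2 \<in> PS2 T0 \<mu>1 \<mu>2 \<omega> \<psi>" and t: "t \<in> {0<..<T0}"
  shows "\<bar>c1 t - c2 t\<bar> \<le> \<mu>2 - \<mu>1"
    and "t\<^sup>2 / \<omega> t * \<bar>D1 T0 c1 t - D1 T0 c2 t\<bar> \<le> 2 * T0"
    and "t ^ 3 * exp (- \<psi> t) / (\<omega> t)\<^sup>2 * \<bar>D2 T0 c1 t - D2 T0 c2 t\<bar> \<le> 2 * T0"
proof -
  have t': "t \<in> {0<..T0}" "t > 0" "t \<le> T0" using t by auto
  have o: "\<omega> t > 0" using om t' by simp
  have b: "\<mu>1 \<le> c1 t" "c1 t \<le> \<mu>2" "\<mu>1 \<le> c2 t" "c2 t \<le> \<mu>2"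
    using c1 c2 t by (auto simp: PS2_def)
  show "\<bar>c1 t - c2 t\<bar> \<le> \<mu>2 - \<mu>1" using b by linarith
  have d: "\<bar>D1 T0 c1 t\<bar> \<le> \<omega> t / t" "\<bar>D1 T0 c2 t\<bar> \<le> \<omega> t / t"
    using c1 c2 t' by (auto simp: PS2_def)
  have "\<bar>D1 T0 c1 t - D1 T0 c2 t\<bar> \<le> 2 * (\<omega> t / t)" using d by linarith
  then have "t\<^sup>2 / \<omega> t * \<bar>D1 T0 c1 t - D1 T0 c2 t\<bar> \<le> t\<^sup>2 / \<omega> t * (2 * (\<omega> t / t))"
    using o by (intro mult_left_mono) auto
  also have "\<dots> = 2 * t" using o t' by (simp add: field_simps power2_eq_square)
  finally show "t\<^sup>2 / \<omega> t * \<bar>D1 T0 c1 t - D1 T0 c2 t\<bar> \<le> 2 * T0" using t' by linarith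
  have d: "\<bar>D2 T0 c1 t\<bar> \<le> (\<omega> t)\<^sup>2 / t\<^sup>2 * exp (\<psi> t)" "\<bar>D2 T0 c2 t\<bar> \<le> (\<omega> t)\<^sup>2 / t\<^sup>2 * exp (\<psi> t)"
    using c1 c2 t' by (auto simp: PS2_def)
  have "\<bar>D2 T0 c1 t - D2 T0 c2 t\<bar> \<le> 2 * ((\<omega> t)\<^sup>2 / t\<^sup>2 * exp (\<psi> t))" using d by linarith
  then have "t ^ 3 * exp (- \<psi> t) / (\<omega> t)\<^sup>2 * \<bar>D2 T0 c1 t - D2 T0 c2 t\<bar>
      \<le> t ^ 3 * exp (- \<psi> t) / (\<omega> t)\<^sup>2 * (2 * ((\<omega> t)\<^sup>2 / t\<^sup>2 * exp (\<psi> t)))"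
    using t' by (intro mult_left_mono) auto
  also have "\<dots> = 2 * t"
    using o t' by (simp add: field_simps power2_eq_square power3_eq_cube exp_minus)
  finally show "t ^ 3 * exp (- \<psi> t) / (\<omega> t)\<^sup>2 * \<bar>D2 T0 c1 t - D2 T0 c2 t\<bar> \<le> 2 * T0"
    using t' by linarith
qed

lemma Metric_space_PS2:
  assumes T: "T0 > 0" and om: "\<And>t. t \<in> {0<..T0} \<Longrightarrow> \<omega> t > 0"
  shows "Metric_space (PS2 T0 \<mu>1 \<mu>2 \<omega> \<psi>) (dist_PS2 T0 \<mu>1 \<mu>2 \<omega> \<psi>)"
proof -
  define I where "I = {0<..<T0}"
  define P where "P = PS2 T0 \<mu>1 \<mu>2 \<omega> \<psi>"
  define d where "d = dist_PS2 T0 \<mu>1 \<mu>2 \<omega> \<psi>"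
  define f where "f = (\<lambda>(c1::real \<Rightarrow> real) c2 t. \<bar>c1 t - c2 t\<bar>)"
  define g where "g = (\<lambda>c1 c2 t. t\<^sup>2 / \<omega> t * \<bar>D1 T0 c1 t - D1 T0 c2 t\<bar>)"
  define h where "h = (\<lambda>c1 c2 t. t ^ 3 * exp (- \<psi> t) / (\<omega> t)\<^sup>2 * \<bar>D2 T0 c1 t - D2 T0 c2 t\<bar>)"
  have ne: "I \<noteq> {}" using T by (simp add: I_def)
  have d: "d x y = (SUP t\<in>I. f x y t) + (SUP t\<in>I. g x y t) + (SUP t\<in>I. h x y t)"
    if "x \<in> P" "y \<in> P" for x y
    using that by (simp add: d_def dist_PS2_def P_def f_def g_def h_def I_def)
  have d0: "d x y = 0" if "\<not> (x \<in> P \<and> y \<in> P)" for x y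
    using that by (auto simp: d_def dist_PS2_def P_def)
  have bdd: "bdd_above (f x y ` I)" "bdd_above (g x y ` I)" "bdd_above (h x y ` I)"
    if "x \<in> P" "y \<in> P" for x y
    subgoal
      unfolding f_def I_def
      by (rule bdd_aboveI2, rule PS2_bounds(1)[OF T om]) (use that in \<open>auto simp: P_def\<close>)
    subgoal
      unfolding g_def I_def
      by (rule bdd_aboveI2, rule PS2_bounds(2)[OF T om]) (use that in \<open>auto simp: P_def\<close>)
    subgoal
      unfolding h_def I_def
      by (rule bdd_aboveI2, rule PS2_bounds(3)[OF T om]) (use that in \<open>auto simp: P_def\<close>)
    done
  have pos: "f x y t \<ge> 0" "g x y t \<ge> 0" "h x y t \<ge> 0" if "t \<in> I" for x y t
    using that om[of t] by (auto simp: f_def g_def h_def I_def)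
  have Spos: "(SUP t\<in>I. f x y t) \<ge> 0" "(SUP t\<in>I. g x y t) \<ge> 0" "(SUP t\<in>I. h x y t) \<ge> 0"
    if "x \<in> P" "y \<in> P" for x y
    using ne bdd[OF that] pos by (auto intro: cSUP_upper2)
  have tri: "f x z t \<le> f x y t + f y z t" "g x z t \<le> g x y t + g y z t"
    "h x z t \<le> h x y t + h y z t" if "t \<in> I" for x y z t
  proof -
    have o: "\<omega> t > 0" "t > 0" using that om[of t] by (auto simp: I_def)
    show "f x z t \<le> f x y t + f y z t" by (simp add: f_def)
    show "g x z t \<le> g x y t + g y z t"
      unfolding g_def distrib_left[symmetric] using o by (intro mult_left_mono) auto
    show "h x z t \<le> h x y t + h y z t"
      unfolding h_def distrib_left[symmetric] using o by (intro mult_left_mono) auto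
  qed
  have Stri: "(SUP t\<in>I. k x z t) \<le> (SUP t\<in>I. k x y t) + (SUP t\<in>I. k y z t)"
    if "bdd_above (k x y ` I)" "bdd_above (k y z ` I)" "\<And>t. t \<in> I \<Longrightarrow> k x z t \<le> k x y t + k y z t"
    for k :: "(real \<Rightarrow> real) \<Rightarrow> (real \<Rightarrow> real) \<Rightarrow> real \<Rightarrow> real" and x y z
    by (rule cSUP_least[OF ne], rule order_trans[OF that(3)], assumption)
      (intro add_mono cSUP_upper that(1,2))
  have eqD: "x = y" if x: "x \<in> P" and y: "y \<in> P" and dz: "d x y = 0" for x y
  proof -
    have "(SUP t\<in>I. f x y t) = 0" using dz d[OF x y] Spos[OF x y] by linarith
    then have "f x y t \<le> 0" if "t \<in> I" for t
      using cSUP_upper[OF that bdd(1)[OF x y]] by simp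
    then have eqI: "x t - y t = 0" if "t \<in> I" for t using that by (fastforce simp: f_def)
    have cl: "closure I = {0..T0}" using T by (simp add: I_def)
    have "continuous_on (closure I) (\<lambda>t. x t - y t)"
      unfolding cl using x y by (auto simp: P_def PS2_def intro!: continuous_intros)
    then have "x t - y t = 0" if "t \<in> {0..T0}" for t
      by (rule continuous_constant_on_closure) (use eqI that cl in auto)
    then show "x = y"
      using x y by (intro extensionalityI[of x "{0..T0}" y]) (auto simp: P_def PS2_def)
  qed
  have "Metric_space P d"
  proof
    show "0 \<le> d x y" for x y using d[of x y] d0[of x y] Spos[of x y] by fastforce
    show "d x y = d y x" for x y
      using d[of x y] d[of y x] d0[of x y] d0[of y x]
      by (cases "x \<in> P \<and> y \<in> P") (auto simp: f_def g_def h_def abs_minus_commute)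
    show "d x y = 0 \<longleftrightarrow> x = y" if "x \<in> P" "y \<in> P" for x y
      using that ne eqD[of x y] d[of x x] by (auto simp: f_def g_def h_def)
    show "d x z \<le> d x y + d y z" if "x \<in> P" "y \<in> P" "z \<in> P" for x y z
    proof -
      have "(SUP t\<in>I. f x z t) \<le> (SUP t\<in>I. f x y t) + (SUP t\<in>I. f y z t)"
        "(SUP t\<in>I. g x z t) \<le> (SUP t\<in>I. g x y t) + (SUP t\<in>I. g y z t)"
        "(SUP t\<in>I. h x z t) \<le> (SUP t\<in>I. h x y t) + (SUP t\<in>I. h y z t)"
        by (rule Stri[of f, OF bdd(1)[OF that(1,2)] bdd(1)[OF that(2,3)] tri(1)],
            assumption,
            rule Stri[of g, OF bdd(2)[OF that(1,2)] bdd(2)[OF that(2,3)] tri(2)], assumption,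
            rule Stri[of h, OF bdd(3)[OF that(1,2)] bdd(3)[OF that(2,3)] tri(3)], assumption)
      then show ?thesis using that by (simp add: d)
    qed
  qed
  then show ?thesis by (simp add: P_def d_def)
qed

end

theory Submission
  imports Defs
begin

text \<open>
  Written on the eigenvectors of \<open>A\<close>, the problem splits into oscillators
  \<open>w'' + \<lambda> c w = 0\<close>, one for each eigenvalue \<open>\<lambda>\<close>. Fix an index \<open>k\<close> and consider the speeds
  \<open>c\<close> for which some eigenvalue \<open>\<lambda> > k + 1\<close> has a solution that starts at \<open>(0, 1)\<close> and is of size more
  than \<open>(1 + \<lambda>)\<^bsup>2k\<^esup>\<close> at all times \<open>t \<ge> 1/(k+1)\<close>. If \<open>c\<close> belongs to all these sets, then superposing
  such solutions with weights \<open>(1 + \<lambda>)\<^bsup>-k\<^esup>\<close> gives initial data in every \<open>D(A\<^sup>\<beta>)\<close>, whereas at each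
  positive time the \<open>k\<close>-th component is eventually larger than \<open>(1 + \<lambda>)\<^bsup>k\<^esup>\<close>, so that no \<open>D(A\<^bsup>-\<beta>\<^esup>)\<close>
  contains the solution (\<open>infinite_derivative_loss_if_amplifies\<close>). It remains to see that each of
  these sets is open and dense. They are open by continuous dependence of the oscillator on its
  coefficient (\<open>amplifies_open\<close>).

  Density rests on two observations. First, the weights in the distance vanish at \<open>t = 0\<close> so fast
  that near the origin only the uniform distance counts. A speed can thus be made constant, equal
  to some \<open>c\<^sub>0\<close>, on a short interval \<open>[0,\<tau>]\<close>, and a contraction towards the midpoint of
  \<open>[\<mu>\<^sub>1,\<mu>\<^sub>2]\<close> leaves room in all inequalities (\<open>flatten_near_origin\<close>). Secondly, on
  that interval the speed can be modulated in resonance with the oscillator of frequency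
  \<open>\<nu> = sqrt (\<lambda> c\<^sub>0)\<close>. The modulation is explicit: for \<open>r(x) = K/(x + KB)\<close> and \<open>R' = r sin\<^sup>2\<close> the
  function \<open>sin x exp (R x)\<close> solves \<open>W'' + (1 - Q) W = 0\<close> with \<open>Q = O(r)\<close>, and it grows like
  \<open>x\<^bsup>K/2\<^esup>\<close> (\<open>parametric_resonance\<close>). In the variable \<open>t = x/\<nu>\<close> the derivatives of \<open>Q\<close> are of order
  \<open>K/t\<close> and \<open>K\<nu>/t\<close>. They are admissible up to a time \<open>s\<close> if \<open>K\<close> is a small multiple of
  \<open>\<omega>(s)\<close> and \<open>\<nu> \<le> \<omega>(s) exp (\<psi>(s))/s\<close>; the energy is then multiplied by about
  \<open>(\<nu>s/K)\<^sup>K\<close>. If \<open>s\<close> is essentially the last admissible time, then \<open>ln (\<nu>s/K)\<close> is at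
  least the value of \<open>\<psi>\<close> at a comparable time, and the hypothesis \<open>\<omega>\<psi>/\<bar>ln t\<bar> \<rightarrow> \<infinity>\<close> makes this factor
  beat every power of \<open>\<nu>\<close> (\<open>resonance_window\<close>). After time \<open>s\<close> the energy estimate shows that only a factor
  \<open>exp (O(K))\<close>, and then a factor independent of \<open>\<lambda>\<close>, can be lost (\<open>resonant_growth\<close>).
\<close>

section \<open>The scalar oscillator\<close>

text \<open>The equation \<open>w'' + q w = 0\<close> as a first order system with velocity \<open>v\<close>. It will be used
  with \<open>q = \<lambda> c\<close> for an eigenvalue \<open>\<lambda>\<close>.\<close>

definition oscillator :: "real \<Rightarrow> (real \<Rightarrow> real) \<Rightarrow> (real \<Rightarrow> real) \<Rightarrow> (real \<Rightarrow> real) \<Rightarrow> bool" where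
  "oscillator T q w v \<longleftrightarrow>
     (\<forall>t\<in>{0..T}. (w has_real_derivative v t) (at t within {0..T}) \<and>
                 (v has_real_derivative - (q t * w t)) (at t within {0..T}))"

lemma oscillator_continuous_on:
  assumes "oscillator T q w v"
  shows "continuous_on {0..T} w" and "continuous_on {0..T} v"
  using assms unfolding oscillator_def
  by (auto intro!: DERIV_continuous_on)

lemma oscillator_interior_deriv:
  assumes "oscillator T q w v" "t \<in> {0<..<T}"
  shows "(w has_real_derivative v t) (at t)" and "(v has_real_derivative - (q t * w t)) (at t)"
proof -
  have "at t within {0..T} = at t"
    using assms(2) by (intro at_within_interior) auto
  moreover have "t \<in> {0..T}" using assms(2) by auto
  ultimately show "(w has_real_derivative v t) (at t)" "(v has_real_derivative - (q t * w t)) (at t)"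
    using assms(1) unfolding oscillator_def by metis+
qed

lemma oscillator_subinterval:
  assumes "oscillator T q w v" "S \<le> T"
  shows "oscillator S q w v"
  using assms unfolding oscillator_def
  by (auto intro!: DERIV_subset[where s = "{0..T}" and t = "{0..S}"])

lemma oscillator_cong:
  assumes "oscillator T q w v" "\<And>t. t \<in> {0..T} \<Longrightarrow> q t = q' t"
  shows "oscillator T q' w v"
  using assms by (simp add: oscillator_def)

lemma oscillator_scale:
  assumes "oscillator T q w v"
  shows "oscillator T q (\<lambda>t. k * w t) (\<lambda>t. k * v t)"
  using assms unfolding oscillator_def
  by (auto intro!: derivative_eq_intros)

text \<open>Existence for continuous coefficients: the Picard iterates of the first order system are
  partial sums of the two series built here, in which the \<open>n\<close>-th term is an \<open>n\<close>-fold iterated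
  integral and hence at most a constant times \<open>Q\<^sup>n t\<^sup>n / n!\<close>.\<close>

lemma oscillator_exists:
  fixes q :: "real \<Rightarrow> real"
  assumes T: "T \<ge> 0" and q: "continuous_on {0..T} q"
  shows "\<exists>w v. oscillator T q w v \<and> w 0 = \<alpha> \<and> v 0 = \<beta>"
proof -
  define step where "step = (\<lambda>p :: (real \<Rightarrow> real) \<times> (real \<Rightarrow> real).
      (\<lambda>t. integral {0..t} (snd p), \<lambda>t. integral {0..t} (\<lambda>s. - (q s * fst p s))))"
  define F where "F n = fst ((step ^^ n) (\<lambda>t. \<alpha>, \<lambda>t. \<beta>))" for n
  define G where "G n = snd ((step ^^ n) (\<lambda>t. \<alpha>, \<lambda>t. \<beta>))" for n
  have F0: "F 0 = (\<lambda>t. \<alpha>)" and G0: "G 0 = (\<lambda>t. \<beta>)" by (simp_all add: F_def G_def)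
  have FS: "F (Suc n) = (\<lambda>t. integral {0..t} (G n))"
    and GS: "G (Suc n) = (\<lambda>t. integral {0..t} (\<lambda>s. - (q s * F n s)))" for n
    by (simp_all add: F_def G_def step_def)
  have cont: "continuous_on {0..T} (F n) \<and> continuous_on {0..T} (G n)" for n
  proof (induction n)
    case (Suc n)
    have "continuous_on {0..T} (\<lambda>s. - (q s * F n s))"
      using Suc q by (intro continuous_intros) auto
    then have "continuous_on {0..T} (F (Suc n))" "continuous_on {0..T} (G (Suc n))"
      unfolding FS GS using Suc
      by (blast intro: indefinite_integral_continuous_1 integrable_continuous_real)+
    then show ?case ..
  qed (simp add: F0 G0)
  define F' where "F' n = (case n of 0 \<Rightarrow> (\<lambda>t. 0) | Suc m \<Rightarrow> G m)" for n
  define G' where "G' n = (case n of 0 \<Rightarrow> (\<lambda>t. 0) | Suc m \<Rightarrow> (\<lambda>t. - (q t * F m t)))" for n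
  have dF: "(F n has_real_derivative F' n t) (at t within {0..T})" if "t \<in> {0..T}" for n t
    using that cont by (cases n) (auto simp: F'_def F0 FS intro!: integral_has_real_derivative)
  have dG: "(G n has_real_derivative G' n t) (at t within {0..T})" if "t \<in> {0..T}" for n t
  proof (cases n)
    case (Suc m)
    have "continuous_on {0..T} (\<lambda>s. - (q s * F m s))"
      using cont q by (intro continuous_intros) auto
    then have "((\<lambda>t. integral {0..t} (\<lambda>s. - (q s * F m s))) has_real_derivative - (q t * F m t))
        (at t within {0..T})"
      using that by (rule integral_has_real_derivative)
    then show ?thesis unfolding Suc GS G'_def by simp
  qed (simp add: G'_def G0)
  obtain Q0 where Q0: "\<And>t. t \<in> {0..T} \<Longrightarrow> \<bar>q t\<bar> \<le> Q0"
    using compact_continuous_image[OF q] compact_imp_bounded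
    by (metis bounded_iff compact_Icc image_eqI real_norm_def)
  define Q where "Q = max Q0 1"
  have Q: "Q \<ge> 1" "\<And>t. t \<in> {0..T} \<Longrightarrow> \<bar>q t\<bar> \<le> Q" using Q0 by (force simp: Q_def)+
  define N where "N = max \<bar>\<alpha>\<bar> \<bar>\<beta>\<bar>"
  have N: "N \<ge> 0" by (simp add: N_def)
  \<comment> \<open>a derivative bound \<open>N Q\<^bsup>n+1\<^esup> t\<^sup>n / n!\<close> integrates to the bound for the next term\<close>
  have grow: "\<bar>f t\<bar> \<le> N * Q ^ Suc n * t ^ Suc n / fact (Suc n)"
    if f: "\<And>s. s \<in> {0..T} \<Longrightarrow> (f has_real_derivative f' s) (at s within {0..T})"
      and f0: "f 0 = 0" and b: "\<And>s. s \<in> {0..T} \<Longrightarrow> \<bar>f' s\<bar> \<le> N * Q ^ Suc n * s ^ n / fact n"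
      and t: "t \<in> {0..T}" for f f' :: "real \<Rightarrow> real" and n t
  proof -
    define h where "h s = N * Q ^ Suc n * s ^ Suc n / fact (Suc n)" for s
    have dh: "(h has_real_derivative N * Q ^ Suc n * s ^ n / fact n) (at s within {0..t})" for s
    proof -
      have "((\<lambda>s. N * Q ^ Suc n * (s ^ Suc n / fact (Suc n))) has_real_derivative
          N * Q ^ Suc n * (real (Suc n) * s ^ n / fact (Suc n))) (at s within {0..t})"
        by (rule derivative_eq_intros | rule refl | simp)+
      moreover have "real (Suc n) * s ^ n / fact (Suc n) = s ^ n / fact n"
        unfolding fact_Suc by (simp del: of_nat_Suc)
      ultimately show ?thesis unfolding h_def by (simp add: mult.assoc)
    qed
    have df: "(f has_real_derivative f' s) (at s within {0..t})" if "s \<in> {0..t}" for s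
      using f[of s] that t by (auto intro: DERIV_subset)
    have at: "at s within {0..t} = at s" if "0 < s" "s < t" for s
      using that by (intro at_within_interior) auto
    have "h 0 - f 0 \<le> h t - f t"
    proof (rule DERIV_nonneg_imp_increasing_open[where f = "\<lambda>s. h s - f s"])
      show "0 \<le> t" using t by simp
      show "continuous_on {0..t} (\<lambda>s. h s - f s)"
        by (intro continuous_on_diff DERIV_continuous_on[OF dh] DERIV_continuous_on[OF df])
      fix s assume s: "0 < s" "s < t"
      show "\<exists>y. ((\<lambda>s. h s - f s) has_real_derivative y) (at s) \<and> 0 \<le> y"
        using DERIV_diff[OF dh[of s] df[of s]] b[of s] s t at[OF s]
        by (intro exI[of _ "N * Q ^ Suc n * s ^ n / fact n - f' s"]) auto
    qed
    moreover have "h 0 + f 0 \<le> h t + f t"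
    proof (rule DERIV_nonneg_imp_increasing_open[where f = "\<lambda>s. h s + f s"])
      show "0 \<le> t" using t by simp
      show "continuous_on {0..t} (\<lambda>s. h s + f s)"
        by (intro continuous_on_add DERIV_continuous_on[OF dh] DERIV_continuous_on[OF df])
      fix s assume s: "0 < s" "s < t"
      show "\<exists>y. ((\<lambda>s. h s + f s) has_real_derivative y) (at s) \<and> 0 \<le> y"
        using DERIV_add[OF dh[of s] df[of s]] b[of s] s t at[OF s]
        by (intro exI[of _ "N * Q ^ Suc n * s ^ n / fact n + f' s"]) auto
    qed
    ultimately show ?thesis using f0 by (simp add: h_def del: fact_Suc power_Suc)
  qed
  have bound: "\<forall>t\<in>{0..T}. \<bar>F n t\<bar> \<le> N * Q ^ n * t ^ n / fact n \<and> \<bar>G n t\<bar> \<le> N * Q ^ n * t ^ n / fact n" for n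
  proof (induction n)
    case 0 then show ?case by (auto simp: F0 G0 N_def)
  next
    case (Suc n)
    have pos: "0 \<le> N * Q ^ n * t ^ n / fact n" if "t \<in> {0..T}" for t
      using that N Q(1) by auto
    have 1: "\<bar>F' (Suc n) t\<bar> \<le> N * Q ^ Suc n * t ^ n / fact n" if t: "t \<in> {0..T}" for t
    proof -
      have "\<bar>F' (Suc n) t\<bar> \<le> 1 * (N * Q ^ n * t ^ n / fact n)" using Suc t by (simp add: F'_def)
      also have "\<dots> \<le> Q * (N * Q ^ n * t ^ n / fact n)"
        using pos[OF t] Q(1) by (intro mult_right_mono) auto
      finally show ?thesis by (simp add: mult_ac)
    qed
    have 2: "\<bar>G' (Suc n) t\<bar> \<le> N * Q ^ Suc n * t ^ n / fact n" if t: "t \<in> {0..T}" for t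
    proof -
      have "\<bar>G' (Suc n) t\<bar> = \<bar>q t\<bar> * \<bar>F n t\<bar>" by (simp add: G'_def abs_mult)
      also have "\<dots> \<le> Q * (N * Q ^ n * t ^ n / fact n)"
        using Suc t Q by (intro mult_mono) auto
      finally show ?thesis by (simp add: mult_ac)
    qed
    show ?case
      using grow[OF dF[of _ "Suc n"] _ 1] grow[OF dG[of _ "Suc n"] _ 2] by (simp add: FS GS)
  qed
  define M where "M n = N * (Q * T) ^ n / fact n" for n
  have sumM: "summable M"
  proof -
    have "M = (\<lambda>n. N * (inverse (fact n) * (Q * T) ^ n))" by (auto simp: M_def divide_inverse)
    then show ?thesis using summable_mult[OF summable_exp[of "Q * T"], of N] by simp
  qed
  have boundM: "\<bar>F n t\<bar> \<le> M n" "\<bar>G n t\<bar> \<le> M n" if t: "t \<in> {0..T}" for n t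
  proof -
    have "N * Q ^ n * t ^ n / fact n \<le> N * Q ^ n * T ^ n / fact n"
      using t N Q(1) by (intro divide_right_mono mult_left_mono power_mono) auto
    also have "\<dots> = M n" by (simp add: M_def power_mult_distrib)
    finally show "\<bar>F n t\<bar> \<le> M n" "\<bar>G n t\<bar> \<le> M n" using bound[of n] t by force+
  qed
  define w where "w t = (\<Sum>n. F n t)" for t
  define v where "v t = (\<Sum>n. G n t)" for t
  have uw: "uniform_limit {0..T} (\<lambda>n t. \<Sum>i<n. F i t) w sequentially"
    unfolding w_def by (rule Weierstrass_m_test[OF _ sumM]) (use boundM in auto)
  have uv: "uniform_limit {0..T} (\<lambda>n t. \<Sum>i<n. G i t) v sequentially"
    unfolding v_def by (rule Weierstrass_m_test[OF _ sumM]) (use boundM in auto)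
  have shift: "uniform_limit {0..T} (\<lambda>n t. \<Sum>i<n. f' i t) g sequentially"
    if u: "uniform_limit {0..T} (\<lambda>n t. \<Sum>i<n. f i t) g sequentially"
      and f': "\<And>t. f' 0 t = 0" "\<And>n t. f' (Suc n) t = f n t"
    for f f' :: "nat \<Rightarrow> real \<Rightarrow> real" and g
  proof -
    have "(\<Sum>i<Suc n. f' i t) = (\<Sum>i<n. f i t)" for n t
      by (simp only: sum.lessThan_Suc_shift f' add_0)
    then have "uniform_limit {0..T} (\<lambda>n t. \<Sum>i<Suc n. f' i t) g sequentially"
      using u by simp
    then show ?thesis by (rule filterlim_sequentially_Suc[THEN iffD1])
  qed
  have uF': "uniform_limit {0..T} (\<lambda>n t. \<Sum>i<n. F' i t) v sequentially"
    by (rule shift[OF uv]) (simp_all add: F'_def)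
  have "uniform_limit {0..T} (\<lambda>n t. - q t * (\<Sum>i<n. F i t)) (\<lambda>t. - q t * w t) sequentially"
  proof (rule uniform_lim_mult[OF uniform_limit_const uw])
    show "bounded ((\<lambda>t. - q t) ` {0..T})"
      using Q by (auto simp: bounded_iff intro!: exI[of _ Q])
    have "continuous_on {0..T} w"
      by (rule uniform_limit_theorem[OF _ uw])
        (auto intro!: always_eventually continuous_on_sum cont[THEN conjunct1])
    then show "bounded (w ` {0..T})"
      by (intro compact_imp_bounded compact_continuous_image) auto
  qed
  then have "uniform_limit {0..T} (\<lambda>n t. \<Sum>i<n. - (q t * F i t)) (\<lambda>t. - (q t * w t)) sequentially"
    by (simp add: sum_distrib_left)
  then have uG': "uniform_limit {0..T} (\<lambda>n t. \<Sum>i<n. G' i t) (\<lambda>t. - (q t * w t)) sequentially"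
    by (rule shift) (simp_all add: G'_def)
  have z: "F n 0 = (if n = 0 then \<alpha> else 0)" "G n 0 = (if n = 0 then \<beta> else 0)" for n
    by (cases n; simp add: F0 G0 FS GS)+
  have sz: "summable (\<lambda>n. F n 0)" "summable (\<lambda>n. G n 0)"
    by (auto simp: z intro!: summable_finite[of "{0}"])
  have "\<forall>t\<in>{0..T}. (w has_real_derivative v t) (at t within {0..T})"
  proof -
    obtain g where g: "\<forall>t\<in>{0..T}. (\<lambda>n. F n t) sums g t \<and> (g has_real_derivative v t) (at t within {0..T})"
      using has_field_derivative_series[OF _ dF uF' _ sz(1)] T by auto
    have "g t = w t" if "t \<in> {0..T}" for t using g that by (auto simp: w_def sums_iff)
    then show ?thesis using g by (metis has_field_derivative_transform_within zero_less_one)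
  qed
  moreover have "\<forall>t\<in>{0..T}. (v has_real_derivative - (q t * w t)) (at t within {0..T})"
  proof -
    obtain g where g: "\<forall>t\<in>{0..T}. (\<lambda>n. G n t) sums g t \<and> (g has_real_derivative - (q t * w t)) (at t within {0..T})"
      using has_field_derivative_series[OF _ dG uG' _ sz(2)] T by auto
    have "g t = v t" if "t \<in> {0..T}" for t using g that by (auto simp: v_def sums_iff)
    then show ?thesis using g by (metis has_field_derivative_transform_within zero_less_one)
  qed
  moreover have "w 0 = \<alpha>" "v 0 = \<beta>"
    using suminf_finite[of "{0}" "\<lambda>n. F n 0"] suminf_finite[of "{0}" "\<lambda>n. G n 0"]
    by (auto simp: w_def v_def z)
  ultimately show ?thesis unfolding oscillator_def by blast
qed

text \<open>Gronwall's argument for the squared distance \<open>E\<close> of the two phase space trajectories: it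
  satisfies \<open>E' \<le> (2 + Q) E + (\<delta> W)\<^sup>2\<close>, so \<open>(E + (\<delta> W)\<^sup>2) exp (- C t)\<close> with \<open>C = 2 + Q\<close> decreases.\<close>

lemma oscillator_dependence:
  assumes o1: "oscillator T q w v" and o2: "oscillator T q' w' v'"
    and init: "w 0 = w' 0" "v 0 = v' 0"
    and q': "\<And>t. t \<in> {0<..<T} \<Longrightarrow> \<bar>q' t\<bar> \<le> Q"
    and close: "\<And>t. t \<in> {0<..<T} \<Longrightarrow> \<bar>q t - q' t\<bar> \<le> \<delta>"
    and W: "\<And>t. t \<in> {0<..<T} \<Longrightarrow> \<bar>w t\<bar> \<le> W"
    and t: "t \<in> {0..T}"
  shows "(w' t - w t)\<^sup>2 + (v' t - v t)\<^sup>2 \<le> (\<delta> * W)\<^sup>2 * exp ((2 + Q) * t)"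
proof (cases "t = 0")
  case True then show ?thesis using init by simp
next
  case False
  define C where "C = 2 + Q"
  define b where "b = (\<delta> * W)\<^sup>2"
  define E where "E s = (w' s - w s)\<^sup>2 + (v' s - v s)\<^sup>2" for s
  define f where "f s = - ((E s + b) * exp (- (C * s)))" for s
  have tp: "0 < t" "t \<le> T" using t False by auto
  have "t / 2 \<in> {0<..<T}" using tp by auto
  then have "Q \<ge> 0" using q'[of "t/2"] by linarith
  have "f 0 \<le> f t"
  proof (rule DERIV_nonneg_imp_increasing_open[where f = f])
    show "0 \<le> t" using t by simp
    have "continuous_on {0..T} f"
      unfolding f_def E_def
      by (intro continuous_intros oscillator_continuous_on[OF o1] oscillator_continuous_on[OF o2])
    then show "continuous_on {0..t} f" by (rule continuous_on_subset) (use tp in auto)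
    fix s assume "0 < s" "s < t"
    then have s: "s \<in> {0<..<T}" using tp by auto
    note [derivative_intros] = oscillator_interior_deriv[OF o1 s] oscillator_interior_deriv[OF o2 s]
    define x where "x = w' s - w s"
    define y where "y = v' s - v s"
    define g where "g = (q s - q' s) * w s"
    define E' where "E' = 2 * x * y + 2 * y * (- q' s * x + g)"
    have "(E has_real_derivative E') (at s)"
      unfolding E_def[abs_def]
      by (rule derivative_eq_intros | rule refl | simp)+
        (simp add: E'_def x_def y_def g_def algebra_simps)
    then have "(f has_real_derivative - (E' * exp (- (C * s)) - (E s + b) * (C * exp (- (C * s))))) (at s)"
      unfolding f_def[abs_def] by (auto intro!: derivative_eq_intros)
    moreover have "E' \<le> C * (E s + b)"
    proof -
      have "2 * x * y \<le> x\<^sup>2 + y\<^sup>2" by (rule sum_squares_bound)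
      moreover have "2 * y * (- q' s * x) \<le> Q * (x\<^sup>2 + y\<^sup>2)"
      proof -
        have "2 * y * (- q' s * x) \<le> \<bar>q' s\<bar> * (2 * \<bar>x\<bar> * \<bar>y\<bar>)"
          using abs_ge_self[of "2 * y * (- q' s * x)"] by (simp add: abs_mult mult_ac)
        also have "\<dots> \<le> Q * (x\<^sup>2 + y\<^sup>2)"
          using sum_squares_bound[of "\<bar>x\<bar>" "\<bar>y\<bar>"] q'[OF s] \<open>Q \<ge> 0\<close> by (intro mult_mono) auto
        finally show ?thesis .
      qed
      moreover have "2 * y * g \<le> y\<^sup>2 + g\<^sup>2" by (rule sum_squares_bound)
      moreover have "g\<^sup>2 \<le> b"
      proof -
        have "\<bar>g\<bar> \<le> \<delta> * W" unfolding g_def abs_mult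
          using close[OF s] W[OF s] by (intro mult_mono) auto
        then show ?thesis unfolding b_def by (metis abs_ge_zero power2_abs power_mono)
      qed
      moreover have "E s = x\<^sup>2 + y\<^sup>2" by (simp add: E_def x_def y_def)
      moreover have "b \<le> C * b" using \<open>Q \<ge> 0\<close> by (simp add: C_def b_def mult_le_cancel_right1)
      ultimately have "E' \<le> (2 + Q) * (x\<^sup>2 + y\<^sup>2) + C * b"
        unfolding E'_def distrib_left distrib_right
        using zero_le_power2[of x] zero_le_power2[of y] by linarith
      then show ?thesis using \<open>E s = x\<^sup>2 + y\<^sup>2\<close> by (simp add: C_def algebra_simps)
    qed
    then have "0 \<le> - (E' * exp (- (C * s)) - (E s + b) * (C * exp (- (C * s))))"
      using mult_right_mono[of E' "C * (E s + b)" "exp (- (C * s))"] by (simp add: mult_ac)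
    ultimately show "\<exists>y. (f has_real_derivative y) (at s) \<and> 0 \<le> y" by blast
  qed
  then have "(E t + b) * exp (- (C * t)) \<le> b" using init by (simp add: f_def E_def)
  then have "E t + b \<le> b * exp (C * t)"
    by (simp add: exp_minus field_simps)
  moreover have "b \<ge> 0" by (simp add: b_def)
  ultimately have "E t \<le> b * exp (C * t)" by linarith
  then show ?thesis by (simp add: E_def b_def C_def)
qed

lemma oscillator_unique:
  assumes o1: "oscillator T q w v" and o2: "oscillator T q w' v'"
    and init: "w 0 = w' 0" "v 0 = v' 0"
    and q: "\<And>t. t \<in> {0<..<T} \<Longrightarrow> \<bar>q t\<bar> \<le> Q"
    and t: "t \<in> {0..T}"
  shows "w' t = w t" and "v' t = v t"
proof -
  have "bounded (w ` {0..T})"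
    using compact_continuous_image[OF oscillator_continuous_on(1)[OF o1]] compact_imp_bounded by blast
  then obtain W where W: "\<And>t. t \<in> {0..T} \<Longrightarrow> \<bar>w t\<bar> \<le> W"
    unfolding bounded_iff by (metis image_eqI real_norm_def)
  have "(w' t - w t)\<^sup>2 + (v' t - v t)\<^sup>2 \<le> (0 * W)\<^sup>2 * exp ((2 + Q) * t)"
    by (rule oscillator_dependence[OF o1 o2 init q _ _ t]) (use W in auto)
  then have "(w' t - w t)\<^sup>2 + (v' t - v t)\<^sup>2 = 0"
    by (intro antisym) simp_all
  then show "w' t = w t" "v' t = v t" by (simp_all add: sum_power2_eq_zero_iff)
qed

text \<open>The energy \<open>v\<^sup>2 + l c w\<^sup>2\<close> has derivative \<open>l c' w\<^sup>2\<close>, which is at least \<open>- P/m\<close> times the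
  energy; so only the oscillation of \<open>c\<close>, and not the frequency, bounds its loss.\<close>

lemma oscillator_energy_lower_bound:
  assumes o: "oscillator T (\<lambda>t. l * c t) w v" and l: "l \<ge> 0" and m: "m > 0"
    and c: "\<And>t. t \<in> {a<..<b} \<Longrightarrow> (c has_real_derivative c' t) (at t)"
    and cc: "continuous_on {0..T} c"
    and P: "\<And>t. t \<in> {a<..<b} \<Longrightarrow> \<bar>c' t\<bar> \<le> P"
    and cm: "\<And>t. t \<in> {a<..<b} \<Longrightarrow> m \<le> c t"
    and ab: "0 \<le> a" "a \<le> b" "b \<le> T"
  shows "((v a)\<^sup>2 + l * c a * (w a)\<^sup>2) * exp (- (P * (b - a) / m)) \<le> (v b)\<^sup>2 + l * c b * (w b)\<^sup>2"
proof -
  define E where "E s = (v s)\<^sup>2 + l * c s * (w s)\<^sup>2" for s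
  define f where "f s = E s * exp (P / m * s)" for s
  have "f a \<le> f b"
  proof (rule DERIV_nonneg_imp_increasing_open[OF \<open>a \<le> b\<close>])
    have "continuous_on {0..T} f"
      unfolding f_def E_def by (intro continuous_intros oscillator_continuous_on[OF o] cc)
    then show "continuous_on {a..b} f" by (rule continuous_on_subset) (use ab in auto)
    fix s assume "a < s" "s < b"
    then have s: "s \<in> {a<..<b}" "s \<in> {0<..<T}" using ab by auto
    note [derivative_intros] = oscillator_interior_deriv[OF o s(2)] c[OF s(1)]
    have "(f has_real_derivative
        (l * c' s * (w s)\<^sup>2) * exp (P / m * s) + E s * (P / m * exp (P / m * s))) (at s)"
      unfolding f_def[abs_def] E_def
      by (rule derivative_eq_intros | rule refl | simp add: algebra_simps)+
    moreover have "0 \<le> l * c' s * (w s)\<^sup>2 + E s * (P / m)"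
    proof -
      have Pp: "0 \<le> P" using P[OF s(1)] by linarith
      have "- (l * c' s * (w s)\<^sup>2) \<le> l * P * (w s)\<^sup>2"
        using P[OF s(1)] l mult_left_mono[of "- c' s" P "l * (w s)\<^sup>2"] by (simp add: mult_ac)
      also have "\<dots> = l * m * (w s)\<^sup>2 * (P / m)" using m by simp
      also have "\<dots> \<le> E s * (P / m)"
      proof (rule mult_right_mono)
        have "l * m * (w s)\<^sup>2 \<le> l * c s * (w s)\<^sup>2"
          using cm[OF s(1)] l by (intro mult_right_mono mult_left_mono) auto
        then show "l * m * (w s)\<^sup>2 \<le> E s" unfolding E_def using zero_le_power2[of "v s"] by linarith
      qed (use Pp m in auto)
      finally show ?thesis by linarith
    qed
    then have "0 \<le> (l * c' s * (w s)\<^sup>2) * exp (P / m * s) + E s * (P / m * exp (P / m * s))"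
      using mult_nonneg_nonneg[of "l * c' s * (w s)\<^sup>2 + E s * (P / m)" "exp (P / m * s)"]
      unfolding distrib_right mult.assoc by simp
    ultimately show "\<exists>y. (f has_real_derivative y) (at s) \<and> 0 \<le> y" by blast
  qed
  then have "E a * (exp (P / m * a) * exp (- (P / m * b))) \<le> E b"
    by (simp add: f_def exp_minus field_simps)
  also have "exp (P / m * a) * exp (- (P / m * b)) = exp (- (P * (b - a) / m))"
    using m by (simp add: exp_add[symmetric] field_simps)
  finally show ?thesis by (simp add: E_def)
qed

section \<open>An explicitly solvable resonant oscillator\<close>

text \<open>The logarithmic growth rate that is to be realised. Of order \<open>K/x\<close> for large \<open>x\<close>, it is
  regularised by \<open>KB\<close> so that it never exceeds \<open>1/B\<close>. It satisfies \<open>r' = - r\<^sup>2/K\<close>, so that the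
  derivatives of the profile below are polynomials in \<open>r\<close> and trigonometric functions.\<close>

definition gain_rate :: "real \<Rightarrow> real \<Rightarrow> real \<Rightarrow> real" where
  "gain_rate K B x = K / (x + K * B)"

text \<open>Obtained by solving \<open>W'' + (1 - Q) W = 0\<close> for \<open>Q\<close> when \<open>W = sin x exp (R x)\<close> and
  \<open>R' = r sin\<^sup>2\<close>: since \<open>R'\<close> vanishes to second order at the zeros of \<open>sin\<close>, the quotient
  \<open>W''/W\<close> has no poles.\<close>

definition profile :: "real \<Rightarrow> real \<Rightarrow> real \<Rightarrow> real" where
  "profile K B x = 2 * gain_rate K B x * sin (2 * x) +
     (gain_rate K B x)\<^sup>2 * (sin x ^ 4 - inverse K * (sin x)\<^sup>2)"

text \<open>First and second derivative of the profile, with \<open>r' = - r\<^sup>2/K\<close> inserted.\<close>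

definition profile' :: "real \<Rightarrow> real \<Rightarrow> real \<Rightarrow> real" where
  "profile' K B x = (let r = gain_rate K B x; i = inverse K; p = sin x ^ 4 - i * (sin x)\<^sup>2;
      p' = 4 * sin x ^ 3 * cos x - 2 * i * sin x * cos x
    in 4 * r * cos (2 * x) - 2 * i * r\<^sup>2 * sin (2 * x) + r\<^sup>2 * p' - 2 * i * r ^ 3 * p)"

definition profile'' :: "real \<Rightarrow> real \<Rightarrow> real \<Rightarrow> real" where
  "profile'' K B x = (let r = gain_rate K B x; i = inverse K; p = sin x ^ 4 - i * (sin x)\<^sup>2;
      p' = 4 * sin x ^ 3 * cos x - 2 * i * sin x * cos x;
      p'' = 12 * (sin x)\<^sup>2 * (cos x)\<^sup>2 - 4 * sin x ^ 4 - 2 * i * ((cos x)\<^sup>2 - (sin x)\<^sup>2)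
    in - 8 * r * sin (2 * x) - 8 * i * r\<^sup>2 * cos (2 * x) + 4 * i\<^sup>2 * r ^ 3 * sin (2 * x)
       + r\<^sup>2 * p'' - 4 * i * r ^ 3 * p' + 6 * i\<^sup>2 * r ^ 4 * p)"

context
  fixes K B :: real
  assumes K: "K \<ge> 1" and B: "B \<ge> 2"
begin

lemma KB_ge: "K * B \<ge> 2"
  using mult_mono[of 1 K 2 B] K B by simp

lemma gain_rate_pos: "x \<ge> 0 \<Longrightarrow> gain_rate K B x > 0"
  using K KB_ge by (simp add: gain_rate_def)

lemma gain_rate_le:
  assumes "x \<ge> 0" shows "gain_rate K B x \<le> 1 / B"
proof -
  have "gain_rate K B x \<le> K / (K * B)"
    unfolding gain_rate_def using assms K KB_ge by (intro divide_left_mono) auto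
  then show ?thesis using K by simp
qed

lemma gain_rate_le_half:
  assumes "x \<ge> 0" shows "gain_rate K B x \<le> 1 / 2"
proof -
  have "1 / B \<le> 1 / 2" using B by (intro divide_left_mono) auto
  then show ?thesis using gain_rate_le[OF assms] by simp
qed

lemma gain_rate_le_divide: "x > 0 \<Longrightarrow> gain_rate K B x \<le> K / x"
  unfolding gain_rate_def using K KB_ge by (intro divide_left_mono) auto

lemma gain_rate_deriv:
  "x \<ge> 0 \<Longrightarrow> (gain_rate K B has_real_derivative - (inverse K * (gain_rate K B x)\<^sup>2)) (at x)"
  unfolding gain_rate_def[abs_def] using K KB_ge
  by (auto intro!: derivative_eq_intros simp: power2_eq_square field_simps)

lemma profile_deriv:
  assumes x: "x \<ge> 0"
  shows "(profile K B has_real_derivative profile' K B x) (at x)"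
proof -
  note [derivative_intros] = gain_rate_deriv[OF x]
  show ?thesis
    unfolding profile_def[abs_def] profile'_def Let_def
    by (rule derivative_eq_intros refl)+
      (simp add: algebra_simps power2_eq_square power3_eq_cube power4_eq_xxxx)
qed

lemma profile'_deriv:
  assumes x: "x \<ge> 0"
  shows "(profile' K B has_real_derivative profile'' K B x) (at x)"
proof -
  note [derivative_intros] = gain_rate_deriv[OF x]
  show ?thesis
    unfolding profile'_def[abs_def] profile''_def Let_def
    by (rule derivative_eq_intros refl)+
      (simp add: algebra_simps power2_eq_square power3_eq_cube power4_eq_xxxx)
qed

lemma profile''_continuous_on: "continuous_on {0..} (profile'' K B)"
proof -
  have "continuous_on {0..} (gain_rate K B)"
    by (intro DERIV_continuous_on[OF has_field_derivative_at_within[OF gain_rate_deriv]]) auto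
  then show ?thesis
    unfolding profile''_def[abs_def] Let_def
    by (intro continuous_intros) auto
qed

text \<open>All three bounds are linear in \<open>r\<close>, because \<open>r \<le> 1\<close> absorbs higher powers and \<open>K \<ge> 1\<close>
  absorbs the factors from \<open>r' = - r\<^sup>2/K\<close>. Thus differentiating the profile costs a constant only, and
  \<open>r \<le> K/x\<close> turns this into the decay that admissible speeds must have.\<close>

lemma profile_bounds:
  assumes x: "x \<ge> 0"
  shows "\<bar>profile K B x\<bar> \<le> 3 * gain_rate K B x"
    and "\<bar>profile' K B x\<bar> \<le> 14 * gain_rate K B x"
    and "\<bar>profile'' K B x\<bar> \<le> 68 * gain_rate K B x"
proof -
  define r where "r = gain_rate K B x"
  have r: "0 \<le> r" "r \<le> 1"
    using gain_rate_pos[OF x] gain_rate_le_half[OF x] by (auto simp: r_def)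
  have rn: "r ^ n \<le> r" if "n \<ge> 1" for n
    using power_decreasing[OF that r] by simp
  have s: "\<bar>sin x\<bar> ^ n \<le> 1" "\<bar>cos x\<bar> ^ n \<le> 1" for n by (auto intro: power_le_one)
  define i where "i = inverse K"
  have iK: "0 \<le> i" "i \<le> 1" using K by (auto simp: i_def inverse_le_1_iff)
  have iK2: "0 \<le> i\<^sup>2" "i\<^sup>2 \<le> 1" using iK by (auto intro: power_le_one)
  have small: "\<bar>a * b\<bar> \<le> 1" if "\<bar>a\<bar> \<le> 1" "\<bar>b\<bar> \<le> 1" for a b :: real
    using mult_mono[OF that] by (simp add: abs_mult)
  define p where "p = sin x ^ 4 - i * (sin x)\<^sup>2"
  define p' where "p' = 4 * sin x ^ 3 * cos x - 2 * i * sin x * cos x"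
  define p'' where "p'' = 12 * (sin x)\<^sup>2 * (cos x)\<^sup>2 - 4 * sin x ^ 4 - 2 * i * ((cos x)\<^sup>2 - (sin x)\<^sup>2)"
  have s4: "0 \<le> sin x ^ 4" "sin x ^ 4 \<le> 1" using s(1)[of 4] by (auto simp: power_abs[symmetric])
  have s2: "0 \<le> (sin x)\<^sup>2" "(sin x)\<^sup>2 \<le> 1" "0 \<le> (cos x)\<^sup>2" "(cos x)\<^sup>2 \<le> 1"
    by (auto simp: abs_square_le_1)
  have "0 \<le> i * (sin x)\<^sup>2" "i * (sin x)\<^sup>2 \<le> 1"
    using s2 iK mult_mono[of i 1 "(sin x)\<^sup>2" 1] by auto
  then have p: "\<bar>p\<bar> \<le> 1" using s4 unfolding p_def by linarith
  have "\<bar>sin x ^ 3 * cos x\<bar> \<le> 1" "\<bar>i * (sin x * cos x)\<bar> \<le> 1"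
    using s(1)[of 3] iK by (intro small; simp add: power_abs)+
  then have p': "\<bar>p'\<bar> \<le> 6" unfolding p'_def by (simp add: abs_le_iff mult.assoc)
  have "0 \<le> (sin x)\<^sup>2 * (cos x)\<^sup>2" "(sin x)\<^sup>2 * (cos x)\<^sup>2 \<le> 1"
    using s2 mult_mono[of "(sin x)\<^sup>2" 1 "(cos x)\<^sup>2" 1] by auto
  moreover have "\<bar>i * ((cos x)\<^sup>2 - (sin x)\<^sup>2)\<bar> \<le> 1"
    by (rule small) (use s2 iK in linarith)+
  ultimately have p'': "\<bar>p''\<bar> \<le> 18" unfolding p''_def using s4 unfolding mult.assoc abs_le_iff by linarith
  \<comment> \<open>each summand is a power of \<open>r\<close>, hence at most \<open>r\<close>, times a bounded factor\<close>
  have monomial: "\<bar>k * r ^ n * (i * y)\<bar> \<le> k * c * r"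
    if "n \<ge> 1" "0 \<le> k" "0 \<le> i" "i \<le> 1" "\<bar>y\<bar> \<le> c" for k c i y :: real and n
  proof -
    have "\<bar>k * r ^ n * (i * y)\<bar> = k * (r ^ n * (i * \<bar>y\<bar>))"
      using that r by (simp add: abs_mult)
    also have "\<dots> \<le> k * (r * (1 * c))"
      using that rn r by (intro mult_left_mono mult_mono) auto
    finally show ?thesis by (simp add: mult_ac)
  qed
  have "profile K B x = 2 * r ^ 1 * (1 * sin (2 * x)) + 1 * r ^ 2 * (1 * p)"
    by (simp add: profile_def r_def p_def i_def)
  moreover have "\<bar>2 * r ^ 1 * (1 * sin (2 * x))\<bar> \<le> 2 * 1 * r" "\<bar>1 * r ^ 2 * (1 * p)\<bar> \<le> 1 * 1 * r"
    by (rule monomial; simp add: p)+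
  ultimately show "\<bar>profile K B x\<bar> \<le> 3 * gain_rate K B x"
    unfolding r_def[symmetric] by linarith
  have "profile' K B x = 4 * r ^ 1 * (1 * cos (2 * x)) - 2 * r ^ 2 * (i * sin (2 * x))
      + 1 * r ^ 2 * (1 * p') - 2 * r ^ 3 * (i * p)"
    by (simp add: profile'_def Let_def r_def[symmetric] i_def[symmetric] p_def[symmetric] p'_def[symmetric])
  moreover have "\<bar>4 * r ^ 1 * (1 * cos (2 * x))\<bar> \<le> 4 * 1 * r"
    "\<bar>2 * r ^ 2 * (i * sin (2 * x))\<bar> \<le> 2 * 1 * r"
    "\<bar>1 * r ^ 2 * (1 * p')\<bar> \<le> 1 * 6 * r" "\<bar>2 * r ^ 3 * (i * p)\<bar> \<le> 2 * 1 * r"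
    by (rule monomial; simp add: p p' iK)+
  ultimately show "\<bar>profile' K B x\<bar> \<le> 14 * gain_rate K B x"
    unfolding r_def[symmetric] by linarith
  have "profile'' K B x = - (8 * r ^ 1 * (1 * sin (2 * x))) - 8 * r ^ 2 * (i * cos (2 * x))
      + 4 * r ^ 3 * (i\<^sup>2 * sin (2 * x)) + 1 * r ^ 2 * (1 * p'') - 4 * r ^ 3 * (i * p')
      + 6 * r ^ 4 * (i\<^sup>2 * p)"
    by (simp add: profile''_def Let_def r_def[symmetric] i_def[symmetric] p_def[symmetric]
        p'_def[symmetric] p''_def[symmetric])
  moreover have "\<bar>8 * r ^ 1 * (1 * sin (2 * x))\<bar> \<le> 8 * 1 * r"
    "\<bar>8 * r ^ 2 * (i * cos (2 * x))\<bar> \<le> 8 * 1 * r"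
    "\<bar>4 * r ^ 3 * (i\<^sup>2 * sin (2 * x))\<bar> \<le> 4 * 1 * r" "\<bar>1 * r ^ 2 * (1 * p'')\<bar> \<le> 1 * 18 * r"
    "\<bar>4 * r ^ 3 * (i * p')\<bar> \<le> 4 * 6 * r" "\<bar>6 * r ^ 4 * (i\<^sup>2 * p)\<bar> \<le> 6 * 1 * r"
    by (rule monomial; simp add: p p' p'' iK iK2)+
  ultimately show "\<bar>profile'' K B x\<bar> \<le> 68 * gain_rate K B x"
    unfolding r_def[symmetric] by linarith
qed

text \<open>As \<open>sin\<^sup>2\<close> has mean \<open>1/2\<close>, the exponent \<open>R\<close> is about \<open>(K/2) ln (1 + X/(KB))\<close>. The pair
  \<open>(sin x, cos x + r sin\<^sup>3 x)\<close> stays away from the origin, so the energy itself grows like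
  \<open>exp (2R)\<close>.\<close>

lemma parametric_resonance:
  assumes X: "X > 0"
  shows "\<exists>w v. oscillator X (\<lambda>x. 1 - profile K B x) w v \<and> w 0 = 0 \<and> v 0 = 1 \<and>
    (w X)\<^sup>2 + (v X)\<^sup>2 \<ge> (1 + X / (K * B)) powr K * exp (- 1 / 2) / 2"
proof -
  define r where "r = gain_rate K B"
  define R where "R x = integral {0..x} (\<lambda>y. r y * (sin y)\<^sup>2)" for x
  have dr: "(r has_real_derivative - (inverse K * (r x)\<^sup>2)) (at x within S)" if "x \<ge> 0" for x S
    unfolding r_def using gain_rate_deriv[OF that] by (rule has_field_derivative_at_within)
  have dR: "(R has_real_derivative r x * (sin x)\<^sup>2) (at x within {0..X})" if "x \<in> {0..X}" for x
    unfolding R_def[abs_def]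
    by (rule integral_has_real_derivative[OF _ that])
      (intro continuous_intros DERIV_continuous_on[OF dr]; simp)
  define w where "w x = sin x * exp (R x)" for x
  define v where "v x = (cos x + r x * sin x ^ 3) * exp (R x)" for x
  have "oscillator X (\<lambda>x. 1 - profile K B x) w v"
    unfolding oscillator_def
  proof (intro ballI conjI)
    fix x assume x: "x \<in> {0..X}"
    then have x0: "x \<ge> 0" by simp
    note [derivative_intros] = dR[OF x] dr[OF x0, of "{0..X}"]
    show "(w has_real_derivative v x) (at x within {0..X})"
      unfolding w_def[abs_def] v_def
      by (rule derivative_eq_intros | rule refl)+
        (simp add: algebra_simps power2_eq_square power3_eq_cube)
    show "(v has_real_derivative - ((1 - profile K B x) * w x)) (at x within {0..X})"
      unfolding w_def v_def[abs_def] profile_def r_def[symmetric] sin_double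
      by (rule derivative_eq_intros refl)+
        (simp add: algebra_simps power2_eq_square power3_eq_cube power4_eq_xxxx)
  qed
  moreover have "w 0 = 0" "v 0 = 1" by (simp_all add: w_def v_def R_def)
  moreover have "(w X)\<^sup>2 + (v X)\<^sup>2 \<ge> (1 + X / (K * B)) powr K * exp (- 1 / 2) / 2"
  proof -
    \<comment> \<open>averaging \<open>sin\<^sup>2\<close> by parts: \<open>R\<close> exceeds half the integral of \<open>r\<close> up to the boundary terms below\<close>
    define g where "g x = R x - (K / 2 * ln (x + K * B) - r x * sin (2 * x) / 4 + r x / 4)" for x
    have "g 0 \<le> g X"
    proof (rule DERIV_nonneg_imp_increasing_open[where f = g])
      have dg: "(g has_real_derivative inverse K * (r x)\<^sup>2 / 4 * (1 - sin (2 * x))) (at x within {0..X})"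
        if x: "x \<in> {0..X}" for x
      proof -
        have x0: "x \<ge> 0" "x + K * B > 0" using x KB_ge by auto
        have dl: "((\<lambda>x. ln (x + K * B)) has_real_derivative inverse K * r x) (at x within {0..X})"
          using x0 K by (auto intro!: derivative_eq_intros simp: r_def gain_rate_def)
        have "((\<lambda>x. sin (2 * x)) has_real_derivative 2 * cos (2 * x)) (at x within {0..X})"
          by (auto intro!: derivative_eq_intros)
        from DERIV_cdivide[OF DERIV_mult[OF dr[OF x0(1)] this], of 4]
        have ds: "((\<lambda>x. r x * sin (2 * x) / 4) has_real_derivative
            (2 * r x * cos (2 * x) - inverse K * (r x)\<^sup>2 * sin (2 * x)) / 4) (at x within {0..X})"
          by (simp add: mult_ac)
        have dr4: "((\<lambda>x. r x / 4) has_real_derivative - (inverse K * (r x)\<^sup>2) / 4) (at x within {0..X})"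
          by (intro DERIV_cdivide dr x0)
        have "(sin x)\<^sup>2 = 1 / 2 - cos (2 * x) / 2"
          unfolding cos_double_sin by (simp add: field_simps)
        then have s: "r x * (sin x)\<^sup>2 = r x * (1 / 2 - cos (2 * x) / 2)" by simp
        have k: "K / 2 * (inverse K * r x) = r x / 2" using K by simp
        show ?thesis
          unfolding g_def[abs_def]
          by (rule DERIV_cong[OF DERIV_diff[OF dR[OF x] DERIV_add[OF DERIV_diff[OF
              DERIV_cmult[OF dl, of "K / 2"] ds] dr4]]], unfold s k) (simp add: algebra_simps diff_divide_distrib)
      qed
      show "0 \<le> X" using X by simp
      show "continuous_on {0..X} g" by (rule DERIV_continuous_on[OF dg])
      fix x assume x: "0 < x" "x < X"
      then have "at x within {0..X} = at x" by (intro at_within_interior) auto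
      then show "\<exists>y. (g has_real_derivative y) (at x) \<and> 0 \<le> y"
        using dg[of x] x K by (intro exI[of _ "inverse K * (r x)\<^sup>2 / 4 * (1 - sin (2 * x))"]) auto
    qed
    moreover have "r X * sin (2 * X) \<le> r X"
      using gain_rate_pos[of X] X by (simp add: r_def mult_le_cancel_left1)
    moreover have "r 0 \<le> 1 / 2" unfolding r_def by (rule gain_rate_le_half) simp
    ultimately have "R X \<ge> K / 2 * ln (X + K * B) - K / 2 * ln (K * B) - 1 / 4"
      by (simp add: g_def R_def)
    moreover have pos: "1 + X / (K * B) > 0" using X KB_ge by (auto intro!: add_pos_pos divide_pos_pos)
    moreover have "ln (X + K * B) = ln (1 + X / (K * B)) + ln (K * B)"
    proof -
      have "K * B \<noteq> 0" using KB_ge by linarith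
      then have e: "(1 + X / (K * B)) * (K * B) = X + K * B" by (auto simp: distrib_right)
      have "K * B > 0" using KB_ge by linarith
      from ln_mult_pos[OF pos this] show ?thesis unfolding e .
    qed
    ultimately have "2 * R X \<ge> K * ln (1 + X / (K * B)) - 1 / 2" by (simp add: algebra_simps)
    then have "exp (2 * R X) \<ge> exp (K * ln (1 + X / (K * B)) + - 1 / 2)" by simp
    also have "exp (K * ln (1 + X / (K * B)) + - 1 / 2) = (1 + X / (K * B)) powr K * exp (- 1 / 2)"
      using pos unfolding exp_add powr_def by simp
    finally have growth: "(1 + X / (K * B)) powr K * exp (- 1 / 2) \<le> exp (2 * R X)" .
    have "1 / 2 \<le> (sin X)\<^sup>2 + (cos X + r X * sin X ^ 3)\<^sup>2"
    proof -
      define d where "d = r X * sin X ^ 3"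
      have "\<bar>d\<bar> \<le> 1 / 2 * \<bar>sin X\<bar>"
      proof -
        have "\<bar>d\<bar> = r X * (\<bar>sin X\<bar> ^ 2 * \<bar>sin X\<bar>)"
          using gain_rate_pos[of X] X by (simp add: d_def r_def abs_mult power_abs power3_eq_cube power2_eq_square)
        also have "\<dots> \<le> 1 / 2 * (1 * \<bar>sin X\<bar>)"
          using gain_rate_le_half[of X] X unfolding r_def
          by (intro mult_mono mult_right_mono) (auto simp: abs_square_le_1)
        finally show ?thesis by simp
      qed
      then have "d\<^sup>2 \<le> (1 / 2 * \<bar>sin X\<bar>)\<^sup>2" by (metis abs_ge_zero power2_abs power_mono)
      then have "d\<^sup>2 \<le> (sin X)\<^sup>2 / 4" by (simp add: power_mult_distrib power2_eq_square)
      moreover have "(cos X + d)\<^sup>2 \<ge> (cos X)\<^sup>2 / 2 - d\<^sup>2"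
        using zero_le_power2[of "cos X + 2 * d"] by (simp add: power2_sum algebra_simps power_mult_distrib)
      ultimately show ?thesis using sin_cos_squared_add[of X] zero_le_power2[of "sin X"]
        unfolding d_def[symmetric] by linarith
    qed
    then have "exp (2 * R X) * (1 / 2) \<le> exp (2 * R X) * ((sin X)\<^sup>2 + (cos X + r X * sin X ^ 3)\<^sup>2)"
      by (intro mult_left_mono) auto
    also have "\<dots> = (w X)\<^sup>2 + (v X)\<^sup>2"
      unfolding w_def v_def power_mult_distrib exp_double by (simp only: distrib_left mult.commute)
    finally show ?thesis using growth by simp
  qed
  ultimately show ?thesis by blast
qed

end

section \<open>Choosing the time scale and the strength of the resonance\<close>

text \<open>Given a frequency \<open>\<nu>\<close>, the resonance acts until time \<open>s\<close> with strength \<open>K\<close>. The conditions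
  \<open>K \<le> \<kappa> \<omega>\<close> and \<open>\<nu> \<le> \<omega> exp \<psi> / t\<close> make it compatible with the bounds on the first two derivatives
  of the speed, and the last inequality says that the gain \<open>(\<nu>s/K)\<^sup>K\<close> exceeds \<open>\<nu>\<^sup>N\<close> even after
  loss of constants.

  The time is a dyadic one, \<open>2s = z/2\<close>, where \<open>\<nu>\<close> is admissible at \<open>z/2\<close> and not at \<open>z\<close>. The
  latter gives \<open>ln (\<nu>s/K) - B \<ge> \<psi>(z)\<close>. If \<open>ln \<nu>\<close> is large compared with \<open>\<bar>ln z\<bar>\<close>, then
  \<open>ln (\<nu>s/K)\<close> is comparable with \<open>ln \<nu>\<close>, and \<open>K \<rightarrow> \<infinity>\<close> suffices. Otherwise \<open>ln \<nu>\<close> is at most a multiple of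
  \<open>\<bar>ln z\<bar>\<close>, and \<open>K \<psi>(z)\<close> exceeds any multiple of that by the hypothesis on \<open>\<omega>\<psi>\<close>. Truncating
  \<open>\<omega>\<close> at \<open>(ln z)\<^sup>2\<close> in the definition of \<open>K\<close> keeps \<open>ln K\<close> below \<open>2\<bar>ln z\<bar>\<close>; it does no
  harm because \<open>\<psi>\<close> is bounded below by \<open>\<psi>(T\<^sub>0) > 0\<close>.\<close>

lemma resonance_window:
  fixes \<omega> \<psi> :: "real \<Rightarrow> real"
  assumes T0: "T0 > 0"
    and pos: "\<forall>t\<in>{0<..T0}. \<omega> t > 0" "\<forall>t\<in>{0<..T0}. \<psi> t > 0"
    and mono: "antimono_on {0<..T0} \<omega>" "antimono_on {0<..T0} \<psi>"
    and lim: "filterlim \<omega> at_top (at_right 0)"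
      "filterlim (\<lambda>t. \<omega> t * \<psi> t / \<bar>ln t\<bar>) at_top (at_right 0)"
    and kap: "\<kappa> > 0" and del: "\<delta> > 0" and N: "N \<ge> 0" and C: "C \<ge> 0"
  shows "\<exists>\<nu>0. \<forall>\<nu>\<ge>\<nu>0. \<exists>s K. 0 < s \<and> 2 * s \<le> \<delta> \<and> 2 * s \<le> T0 \<and> 1 \<le> K \<and> K \<le> \<kappa> * \<omega> (2 * s) \<and>
    \<nu> \<le> \<omega> (2 * s) * exp (\<psi> (2 * s)) / (2 * s) \<and>
    N * ln \<nu> + C \<le> K * (ln (\<nu> * s / K) - B)"
proof -
  define k where "k = Min {\<kappa>, exp (- B) / 4, 1}"
  have k: "0 < k" "k \<le> \<kappa>" "k \<le> exp (- B) / 4" "k \<le> 1"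
    using kap by (auto simp: k_def)
  define p where "p = \<psi> T0"
  have p: "p > 0" "\<And>t. t \<in> {0<..T0} \<Longrightarrow> p \<le> \<psi> t"
    using T0 pos monotone_onD[OF mono(2)] by (auto simp: p_def)
  define Z where "Z = 8 * N + 2 * C + 2"
  have Z: "Z \<ge> 2" "Z \<ge> 8 * N + C" "Z \<ge> 2 * (N + C)" using N C by (auto simp: Z_def)
  define \<Lambda>0 where "\<Lambda>0 = Max {1, ln 4 + B, Z / (k * p), Z / k}"
  \<comment> \<open>all requirements on small times hold below one bound \<open>y0\<close>; the dyadic times start at half of it\<close>
  have ev: "\<forall>\<^sub>F t in at_right 0. t < T0 \<and> t < \<delta> \<and> t < exp (- \<Lambda>0) \<and> \<omega> t \<ge> Z / k \<and>
      \<omega> t * \<psi> t / \<bar>ln t\<bar> \<ge> Z / k"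
    using T0 del lim[unfolded filterlim_at_top] 
    by (intro eventually_conj)
      (auto simp: eventually_at_right_field intro: exI[of _ "exp (- \<Lambda>0)"])
  then obtain y0 where y0: "y0 > 0" and near: "\<And>t. 0 < t \<Longrightarrow> t < y0 \<Longrightarrow> t < T0 \<and> t < \<delta> \<and> t < exp (- \<Lambda>0) \<and>
      \<omega> t \<ge> Z / k \<and> \<omega> t * \<psi> t / \<bar>ln t\<bar> \<ge> Z / k"
    unfolding eventually_at_right_field by auto
  define g where "g t = \<omega> t * exp (\<psi> t) / t" for t
  define y where "y j = y0 / 2 / 2 ^ j" for j :: nat
  have y: "0 < y j" "y j < y0" "y (Suc j) = y j / 2" for j
  proof -
    have "y j \<le> y0 / 2 / 1" unfolding y_def using y0 by (intro divide_left_mono) auto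
    then show "0 < y j" "y j < y0" "y (Suc j) = y j / 2" using y0 by (auto simp: y_def)
  qed
  have gy: "2 ^ j * (Z / k) \<le> g (y j) * y0" for j
  proof -
    have "2 ^ j * (Z / k) * 1 \<le> 2 ^ Suc j * \<omega> (y j) * exp (\<psi> (y j))"
      using near[OF y(1,2)[of j]] Z k pos y(1)[of j]
      by (intro mult_mono) (auto intro!: less_imp_le)
    also have "\<dots> = g (y j) * y0" using y0 by (simp add: g_def y_def)
    finally show ?thesis by simp
  qed
  show ?thesis
  proof (rule exI[of _ "max 3 (g (y 0) + 1)"], intro allI impI)
    fix \<nu> assume "max 3 (g (y 0) + 1) \<le> \<nu>"
    then have nu: "\<nu> \<ge> 3" "\<nu> > g (y 0)" by auto
    obtain J :: nat where J: "\<nu> * y0 / (Z / k) < 2 ^ J" using real_arch_pow[of 2] by auto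
    have "\<nu> * y0 < 2 ^ J * (Z / k)" using J Z k pos_divide_less_eq[of "Z / k" "\<nu> * y0" "2 ^ J"] by simp
    also note gy[of J]
    finally have "\<nu> \<le> g (y J)" using y0 by simp
    then have ex: "\<exists>j. \<nu> \<le> g (y j)" by blast
    define j where "j = (LEAST j. \<nu> \<le> g (y j))"
    have j: "\<nu> \<le> g (y j)" unfolding j_def by (rule LeastI_ex[OF ex])
    have "j \<noteq> 0" using j nu by (metis not_le)
    then obtain i where i: "j = Suc i" by (cases j) auto
    have gi: "g (y i) < \<nu>" using not_less_Least[of i "\<lambda>j. \<nu> \<le> g (y j)"] i unfolding j_def by auto
    define z where "z = y i"
    have z: "0 < z" "z < T0" "z < \<delta>" "z < exp (- \<Lambda>0)" "Z / k \<le> \<omega> z" "Z / k \<le> \<omega> z * \<psi> z / \<bar>ln z\<bar>"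
      using near[OF y(1,2)[of i]] y(1)[of i] by (auto simp: z_def)
    define \<Lambda> where "\<Lambda> = - ln z"
    have "ln z < - \<Lambda>0" using z by (metis exp_gt_zero ln_exp ln_less_cancel_iff)
    then have La: "\<Lambda> \<ge> 1" "\<Lambda> \<ge> ln 4 + B" "\<Lambda> \<ge> Z / (k * p)" "\<Lambda> \<ge> Z / k"
      unfolding \<Lambda>_def \<Lambda>0_def by auto
    have absln: "\<bar>ln z\<bar> = \<Lambda>" using La by (simp add: \<Lambda>_def)
    have zm: "z \<in> {0<..T0}" "z / 2 \<in> {0<..T0}" using z by auto
    have oz: "\<omega> z > 0" "\<omega> z \<le> \<omega> (z / 2)" "p \<le> \<psi> z"
      using pos zm monotone_onD[OF mono(1), of "z / 2" z] p by auto
    define s where "s = z / 4"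
    define K where "K = k * min (\<omega> z) (\<Lambda>\<^sup>2)"
    have KZ: "Z \<le> K"
    proof -
      have "Z / k * 1 \<le> \<Lambda> * \<Lambda>" using La Z k by (intro mult_mono) auto
      then have "Z / k \<le> min (\<omega> z) (\<Lambda>\<^sup>2)" using z by (simp add: power2_eq_square)
      then show ?thesis using k by (simp add: K_def pos_divide_le_eq mult.commute min_def split: if_splits)
    qed
    have Kle: "K \<le> k * \<omega> z" "K \<le> \<Lambda>\<^sup>2"
    proof -
      show "K \<le> k * \<omega> z" using k by (simp add: K_def)
      have "K \<le> 1 * \<Lambda>\<^sup>2" unfolding K_def using k oz La by (intro mult_mono) auto
      then show "K \<le> \<Lambda>\<^sup>2" by simp
    qed
    have K0: "K > 0" "K \<ge> 1" using KZ Z by auto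
    have Kpsi: "Z * \<Lambda> \<le> K * \<psi> z"
    proof -
      have "Z * \<Lambda> \<le> k * (\<omega> z * \<psi> z)"
        using z(6) La k unfolding absln by (simp add: field_simps)
      moreover have "Z * \<Lambda> \<le> k * (\<Lambda>\<^sup>2 * \<psi> z)"
      proof -
        have "Z \<le> \<Lambda> * k * p" using La(3) k p by (simp add: pos_divide_le_eq mult.assoc)
        also have "\<dots> \<le> \<Lambda> * k * \<psi> z" using La k oz by (intro mult_left_mono) auto
        finally have "Z * \<Lambda> \<le> \<Lambda> * k * \<psi> z * \<Lambda>" using La by (intro mult_right_mono) auto
        then show ?thesis by (simp add: power2_eq_square mult_ac)
      qed
      ultimately show ?thesis by (auto simp: K_def min_def mult.assoc)
    qed
    \<comment> \<open>\<open>\<nu>\<close> exceeds the admissible frequency at \<open>z\<close>, which is \<open>4 s\<close>\<close>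
    have low: "\<psi> z + B \<le> ln (\<nu> * s / K)"
    proof -
      have "exp (\<psi> z + B) = exp (\<psi> z) / (4 * (exp (- B) / 4))"
        by (simp add: exp_add exp_minus field_simps)
      also have "\<dots> \<le> exp (\<psi> z) / (4 * k)"
        using k by (intro divide_left_mono) auto
      also have "\<dots> = g z * s / (k * \<omega> z)" using z oz by (simp add: g_def s_def)
      also have "\<dots> \<le> \<nu> * s / (k * \<omega> z)"
        using gi z oz k by (intro divide_right_mono mult_right_mono) (auto simp: s_def z_def)
      also have "\<dots> \<le> \<nu> * s / K"
        using Kle K0 nu z k oz by (intro divide_left_mono) (auto simp: s_def)
      finally show ?thesis using nu z K0 by (subst ln_ge_iff) (auto simp: s_def)
    qed
    have lnnu: "ln \<nu> = ln (\<nu> * s / K) + \<Lambda> + ln 4 + ln K"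
      using nu z K0 by (simp add: s_def \<Lambda>_def ln_mult ln_div)
    have "1 \<le> ln \<nu>"
    proof -
      have "exp 1 \<le> \<nu>" using nu exp_le by linarith
      then show ?thesis using nu by (subst ln_ge_iff) auto
    qed
    have "N * ln \<nu> + C \<le> K * (ln (\<nu> * s / K) - B)"
    proof (cases "ln \<nu> \<ge> 2 * (\<Lambda> + ln 4 + ln K + B)")
      case True
      have "N * ln \<nu> + C \<le> N * ln \<nu> + C * ln \<nu>" using \<open>1 \<le> ln \<nu>\<close> C by (simp add: mult_le_cancel_left1)
      also have "\<dots> = 2 * (N + C) * (ln \<nu> / 2)" by (simp add: algebra_simps)
      also have "\<dots> \<le> K * (ln \<nu> / 2)"
        using Z KZ \<open>1 \<le> ln \<nu>\<close> by (intro mult_right_mono) auto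
      also have "\<dots> \<le> K * (ln (\<nu> * s / K) - B)"
        using True lnnu K0 by (intro mult_left_mono) auto
      finally show ?thesis .
    next
      case False
      have "ln K \<le> ln (\<Lambda>\<^sup>2)" using Kle(2) K0 La by (subst ln_le_cancel_iff) auto
      also have "\<dots> = 2 * ln \<Lambda>" using La by (simp add: ln_realpow)
      also have "\<dots> \<le> 2 * \<Lambda>" using La ln_le_minus_one[of \<Lambda>] by simp
      finally have "ln \<nu> \<le> 8 * \<Lambda>" using False La by simp
      then have "N * ln \<nu> + C \<le> N * (8 * \<Lambda>) + C * \<Lambda>"
        using N C La by (intro add_mono mult_left_mono) (auto simp: mult_le_cancel_left1)
      also have "\<dots> = (8 * N + C) * \<Lambda>" by (simp add: algebra_simps)
      also have "\<dots> \<le> Z * \<Lambda>" using Z La by (intro mult_right_mono) auto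
      also have "\<dots> \<le> K * \<psi> z" by (rule Kpsi)
      also have "\<dots> \<le> K * (ln (\<nu> * s / K) - B)" using low K0 by (intro mult_left_mono) auto
      finally show ?thesis .
    qed
    moreover have "K \<le> \<kappa> * \<omega> (2 * s)"
    proof -
      have "K \<le> \<kappa> * \<omega> (z / 2)"
        using Kle(1) mult_mono[of k \<kappa> "\<omega> z" "\<omega> (z / 2)"] k oz kap by linarith
      then show ?thesis by (simp add: s_def)
    qed
    moreover have "\<nu> \<le> \<omega> (2 * s) * exp (\<psi> (2 * s)) / (2 * s)"
      using j y(3)[of i] by (simp add: i g_def s_def z_def)
    ultimately show "\<exists>s K. 0 < s \<and> 2 * s \<le> \<delta> \<and> 2 * s \<le> T0 \<and> 1 \<le> K \<and> K \<le> \<kappa> * \<omega> (2 * s) \<and>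
        \<nu> \<le> \<omega> (2 * s) * exp (\<psi> (2 * s)) / (2 * s) \<and>
        N * ln \<nu> + C \<le> K * (ln (\<nu> * s / K) - B)"
      using z K0 by (intro exI[of _ s] exI[of _ K]) (auto simp: s_def)
  qed
qed

section \<open>A twice differentiable cut-off\<close>

text \<open>Powers of the positive part are the source of smoothness for the cut-off: the exponent \<open>3\<close> gives
  a continuous second derivative.\<close>

lemma has_derivative_pos_part_power:
  fixes y :: real
  assumes n: "n > 0"
  shows "((\<lambda>y. max 0 y ^ Suc n) has_real_derivative real (Suc n) * max 0 y ^ n) (at y)"
proof (rule linorder_cases[of y 0])
  assume y: "y < 0"
  have "((\<lambda>y. 0) has_real_derivative real (Suc n) * max 0 y ^ n) (at y)"
    using y n by (auto intro!: derivative_eq_intros simp: max_def)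
  then show ?thesis
    by (rule has_field_derivative_transform_within_open[of _ _ _ "{..<0}"]) (use y in \<open>auto simp: max_def\<close>)
next
  assume y: "0 < y"
  have "((\<lambda>y. y ^ Suc n) has_real_derivative real (Suc n) * max 0 y ^ n) (at y)"
    using y DERIV_pow[of "Suc n" y UNIV] by (simp add: max_def)
  then show ?thesis
    by (rule has_field_derivative_transform_within_open[of _ _ _ "{0<..}"]) (use y in \<open>auto simp: max_def\<close>)
next
  assume y: "y = 0"
  have "((\<lambda>h::real. max 0 h ^ n) \<longlongrightarrow> max 0 0 ^ n) (at 0)" by (intro tendsto_intros)
  moreover have "max 0 0 ^ n = (0::real)" using n by simp
  ultimately have "((\<lambda>h::real. max 0 h ^ n) \<longlongrightarrow> 0) (at 0)" by (simp only:)
  then have "((\<lambda>h. (max 0 (0 + h) ^ Suc n - max 0 0 ^ Suc n) / h) \<longlongrightarrow> (0::real)) (at 0)"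
    by (rule Lim_transform_eventually)
      (use n in \<open>auto simp: eventually_at_filter max_def intro!: always_eventually\<close>)
  moreover have "real (Suc n) * max 0 0 ^ n = 0" using n by simp
  ultimately show ?thesis unfolding DERIV_def y by (simp only:)
qed

text \<open>The two cubes never vanish together, so the quotient inherits their two continuous derivatives.\<close>

definition cutoff :: "real \<Rightarrow> real" where
  "cutoff x = max 0 (2 - x) ^ 3 / (max 0 (2 - x) ^ 3 + max 0 (x - 1) ^ 3)"

definition cutoff' :: "real \<Rightarrow> real" where
  "cutoff' x = (let n = max 0 (2 - x); p = max 0 (x - 1)
    in - 3 * (n\<^sup>2 * p ^ 3 + n ^ 3 * p\<^sup>2) / (n ^ 3 + p ^ 3)\<^sup>2)"

definition cutoff'' :: "real \<Rightarrow> real" where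
  "cutoff'' x = (let n = max 0 (2 - x); p = max 0 (x - 1)
    in (6 * n * p ^ 3 - 6 * n ^ 3 * p) / (n ^ 3 + p ^ 3)\<^sup>2
       + 18 * (n\<^sup>2 * p ^ 3 + n ^ 3 * p\<^sup>2) * (p\<^sup>2 - n\<^sup>2) / (n ^ 3 + p ^ 3) ^ 3)"

lemma cutoff_denominator_pos: "max 0 (2 - x) ^ 3 + max 0 (x - 1) ^ 3 > (0::real)"
  by (cases "x < 2") (auto intro: add_pos_nonneg add_nonneg_pos)

lemma cutoff_derivs:
  shows "(cutoff has_real_derivative cutoff' x) (at x)"
    and "(cutoff' has_real_derivative cutoff'' x) (at x)"
proof -
  define n where "n = max 0 (2 - x)"
  define p where "p = max 0 (x - 1)"
  have pos: "n ^ 3 + p ^ 3 > 0" unfolding n_def p_def by (rule cutoff_denominator_pos)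
  have pp: "((\<lambda>y. max 0 y ^ 3) has_real_derivative 3 * (max 0 y)\<^sup>2) (at y)"
    "((\<lambda>y. (max 0 y)\<^sup>2) has_real_derivative 2 * max 0 y) (at y)" for y :: real
    using has_derivative_pos_part_power[of 2 y] has_derivative_pos_part_power[of 1 y]
    by (simp_all add: numeral_eq_Suc)
  have dn: "((\<lambda>x. 2 - x) has_real_derivative - 1) (at x)"
    by (rule DERIV_cong[OF DERIV_diff[OF DERIV_const DERIV_ident]]) simp
  have dp: "((\<lambda>x. x - 1) has_real_derivative 1) (at x)"
    by (rule DERIV_cong[OF DERIV_diff[OF DERIV_ident DERIV_const]]) simp
  have n: "((\<lambda>x. max 0 (2 - x) ^ 3) has_real_derivative - 3 * n\<^sup>2) (at x)"
    "((\<lambda>x. (max 0 (2 - x))\<^sup>2) has_real_derivative - 2 * n) (at x)"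
    using DERIV_chain2[OF pp(1)[of "2 - x"] dn] DERIV_chain2[OF pp(2)[of "2 - x"] dn]
    by (simp_all add: n_def)
  have p: "((\<lambda>x. max 0 (x - 1) ^ 3) has_real_derivative 3 * p\<^sup>2) (at x)"
    "((\<lambda>x. (max 0 (x - 1))\<^sup>2) has_real_derivative 2 * p) (at x)"
    using DERIV_chain2[OF pp(1)[of "x - 1"] dp] DERIV_chain2[OF pp(2)[of "x - 1"] dp]
    by (simp_all add: p_def)
  have s: "((\<lambda>x. max 0 (2 - x) ^ 3 + max 0 (x - 1) ^ 3) has_real_derivative - 3 * n\<^sup>2 + 3 * p\<^sup>2) (at x)"
    by (rule DERIV_add[OF n(1) p(1)])
  show "(cutoff has_real_derivative cutoff' x) (at x)"
    unfolding cutoff_def[abs_def] cutoff'_def Let_def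
    by (rule DERIV_cong[OF DERIV_divide[OF n(1) s]], unfold n_def[symmetric] p_def[symmetric])
      (use pos in simp, rule arg_cong2[of _ _ _ _ "(/)"], simp_all add: power2_eq_square power3_eq_cube algebra_simps)
  define u where "u = n\<^sup>2 * p ^ 3 + n ^ 3 * p\<^sup>2"
  have du: "((\<lambda>x. (max 0 (2 - x))\<^sup>2 * max 0 (x - 1) ^ 3 + max 0 (2 - x) ^ 3 * (max 0 (x - 1))\<^sup>2)
      has_real_derivative - 2 * n * p ^ 3 + 2 * n ^ 3 * p) (at x)"
    by (rule DERIV_cong[OF DERIV_add[OF DERIV_mult[OF n(2) p(1)] DERIV_mult[OF n(1) p(2)]]])
      (simp add: n_def[symmetric] p_def[symmetric] algebra_simps)
  have dd: "((\<lambda>x. (max 0 (2 - x) ^ 3 + max 0 (x - 1) ^ 3)\<^sup>2) has_real_derivative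
      2 * (n ^ 3 + p ^ 3) * (- 3 * n\<^sup>2 + 3 * p\<^sup>2)) (at x)"
    by (rule DERIV_cong[OF DERIV_power[OF s, of 2]])
      (simp add: n_def[symmetric] p_def[symmetric] algebra_simps)
  have key: "(- 3 * (- 2 * A) * d\<^sup>2 - - 3 * w * (2 * d * (3 * v))) / (d\<^sup>2 * d\<^sup>2)
      = 6 * A / d\<^sup>2 + 18 * w * v / d ^ 3" if "d > 0" for A v w d :: real
    using that by (simp add: field_simps power2_eq_square power3_eq_cube)
  show "(cutoff' has_real_derivative cutoff'' x) (at x)"
    unfolding cutoff'_def[abs_def] cutoff''_def Let_def
  proof (rule DERIV_cong[OF DERIV_divide[OF DERIV_cmult[OF du, of "- 3"] dd]],
      unfold n_def[symmetric] p_def[symmetric] u_def[symmetric])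
    show "(n ^ 3 + p ^ 3)\<^sup>2 \<noteq> 0" using pos by simp
    have 1: "- 2 * n * p ^ 3 + 2 * n ^ 3 * p = - 2 * (n * p ^ 3 - n ^ 3 * p)"
      and 2: "- 3 * n\<^sup>2 + 3 * p\<^sup>2 = 3 * (p\<^sup>2 - n\<^sup>2)"
      and 3: "6 * n * p ^ 3 - 6 * n ^ 3 * p = 6 * (n * p ^ 3 - n ^ 3 * p)" by simp_all
    show "(- 3 * (- 2 * n * p ^ 3 + 2 * n ^ 3 * p) * (n ^ 3 + p ^ 3)\<^sup>2
        - - 3 * u * (2 * (n ^ 3 + p ^ 3) * (- 3 * n\<^sup>2 + 3 * p\<^sup>2))) / ((n ^ 3 + p ^ 3)\<^sup>2 * (n ^ 3 + p ^ 3)\<^sup>2)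
      = (6 * n * p ^ 3 - 6 * n ^ 3 * p) / (n ^ 3 + p ^ 3)\<^sup>2 + 18 * u * (p\<^sup>2 - n\<^sup>2) / (n ^ 3 + p ^ 3) ^ 3"
      unfolding 1 2 3 by (rule key[OF pos])
  qed
qed

lemma cutoff''_continuous_on: "continuous_on S cutoff''"
  unfolding cutoff''_def[abs_def] Let_def
  by (intro continuous_intros) (use cutoff_denominator_pos in \<open>auto simp: less_imp_neq[symmetric]\<close>)

lemma cutoff_range: "0 \<le> cutoff x" "cutoff x \<le> 1"
  using cutoff_denominator_pos[of x] by (auto simp: cutoff_def divide_simps)

lemma cutoff_left:
  assumes "x \<le> 1"
  shows "cutoff x = 1" "cutoff' x = 0" "cutoff'' x = 0"
  using assms by (auto simp: cutoff_def cutoff'_def cutoff''_def Let_def max_def)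

lemma cutoff_right:
  assumes "x \<ge> 2"
  shows "cutoff x = 0" "cutoff' x = 0" "cutoff'' x = 0"
  using assms by (auto simp: cutoff_def cutoff'_def cutoff''_def Let_def max_def)

text \<open>The derivatives live on \<open>[1,2]\<close>, so after rescaling by \<open>s\<close> they cost one factor \<open>1/t\<close>
  each, uniformly in \<open>s\<close>.\<close>

lemma cutoff_scale_invariant_bounds:
  "\<exists>C\<ge>1. \<forall>s>0. \<forall>t>0. \<bar>cutoff' (t / s) / s\<bar> \<le> C / t \<and> \<bar>cutoff'' (t / s) / s\<^sup>2\<bar> \<le> C / t\<^sup>2"
proof -
  have "continuous_on {1..2} cutoff'"
    by (rule DERIV_continuous_on[OF has_field_derivative_at_within[OF cutoff_derivs(2)]])
  then have "bounded (cutoff' ` {1..2})"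
    by (rule compact_imp_bounded[OF compact_continuous_image]) simp
  moreover have "bounded (cutoff'' ` {1..2})"
    by (rule compact_imp_bounded[OF compact_continuous_image[OF cutoff''_continuous_on]]) simp
  ultimately obtain C1 C2 where "\<forall>x\<in>{1..2}. \<bar>cutoff' x\<bar> \<le> C1" and "\<forall>x\<in>{1..2}. \<bar>cutoff'' x\<bar> \<le> C2"
    unfolding bounded_iff by auto
  then have "\<bar>cutoff' x\<bar> \<le> max C1 0 \<and> \<bar>cutoff'' x\<bar> \<le> max C2 0" for x
    using cutoff_left(2,3)[of x] cutoff_right(2,3)[of x]
    by (cases "x \<le> 1"; cases "x \<ge> 2"; simp add: le_max_iff_disj)
  then have b: "\<bar>cutoff' x\<bar> \<le> max C1 0" "\<bar>cutoff'' x\<bar> \<le> max C2 0" for x by auto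
  have c: "\<bar>x * cutoff' x\<bar> \<le> 2 * max C1 0" "\<bar>x\<^sup>2 * cutoff'' x\<bar> \<le> 4 * max C2 0" if "x > 0" for x
  proof -
    show "\<bar>x * cutoff' x\<bar> \<le> 2 * max C1 0"
    proof (cases "x \<le> 2")
      case True then show ?thesis unfolding abs_mult using that b(1)[of x] by (intro mult_mono) auto
    qed (simp add: cutoff_right)
    show "\<bar>x\<^sup>2 * cutoff'' x\<bar> \<le> 4 * max C2 0"
    proof (cases "x \<le> 2")
      case True
      then have "x\<^sup>2 \<le> 2\<^sup>2" using that by (intro power_mono) auto
      then show ?thesis unfolding abs_mult using that b(2)[of x] by (intro mult_mono) auto
    qed (simp add: cutoff_right)
  qed
  define C where "C = Max {1, 2 * max C1 0, 4 * max C2 0}"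
  have C: "1 \<le> C" "2 * max C1 0 \<le> C" "4 * max C2 0 \<le> C" by (auto simp: C_def)
  show ?thesis
  proof (intro exI[of _ C] conjI allI impI)
    fix s t :: real assume st: "0 < s" "0 < t"
    then have "t / s > 0" by simp
    note c' = c[OF this]
    have "\<bar>cutoff' (t / s) / s\<bar> = \<bar>t / s * cutoff' (t / s)\<bar> / t"
      using st by (simp add: abs_mult abs_divide)
    also have "\<dots> \<le> C / t" using c'(1) C st by (intro divide_right_mono) auto
    finally show "\<bar>cutoff' (t / s) / s\<bar> \<le> C / t" .
    have "\<bar>cutoff'' (t / s) / s\<^sup>2\<bar> = \<bar>(t / s)\<^sup>2 * cutoff'' (t / s)\<bar> / t\<^sup>2"
      using st by (simp add: abs_mult abs_divide power_divide)
    also have "\<dots> \<le> C / t\<^sup>2" using c'(2) C st by (intro divide_right_mono) auto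
    finally show "\<bar>cutoff'' (t / s) / s\<^sup>2\<bar> \<le> C / t\<^sup>2" .
  qed (rule C)
qed

section \<open>Derivatives and distances of propagation speeds\<close>

text \<open>Derivatives on \<open>(0,T]\<close>, one-sided at \<open>T\<close>, carried as explicit functions, since the bounds on
  a constructed speed have to be read off from formulas.\<close>

definition C2_derivs :: "real \<Rightarrow> (real \<Rightarrow> real) \<Rightarrow> (real \<Rightarrow> real) \<Rightarrow> (real \<Rightarrow> real) \<Rightarrow> bool" where
  "C2_derivs T f f' f'' \<longleftrightarrow>
     (\<forall>t\<in>{0<..T}. (f has_real_derivative f' t) (at t within {0<..T}) \<and>
                  (f' has_real_derivative f'' t) (at t within {0<..T})) \<and>
     continuous_on {0<..T} f''"

lemma C2_derivsI:
  assumes "\<And>t. t \<in> {0<..T} \<Longrightarrow> (f has_real_derivative f' t) (at t)"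
    and "\<And>t. t \<in> {0<..T} \<Longrightarrow> (f' has_real_derivative f'' t) (at t)"
    and "continuous_on {0<..T} f''"
  shows "C2_derivs T f f' f''"
  using assms unfolding C2_derivs_def by (auto intro: has_field_derivative_at_within)

lemma C2_derivs_continuous_on:
  assumes "C2_derivs T f f' f''"
  shows "continuous_on {0<..T} f" "continuous_on {0<..T} f'" "continuous_on {0<..T} f''"
  using assms unfolding C2_derivs_def by (auto intro!: DERIV_continuous_on)

lemma C2_derivs_interior:
  assumes "C2_derivs T f f' f''" "t \<in> {0<..<T}"
  shows "(f has_real_derivative f' t) (at t)"
proof -
  have "at t within {0<..T} = at t"
    using assms(2) by (rule at_within_open_subset) auto
  moreover have "t \<in> {0<..T}" using assms(2) by auto
  ultimately show ?thesis using assms(1) unfolding C2_derivs_def by metis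
qed

lemma C2_derivs_const: "C2_derivs T (\<lambda>t. k) (\<lambda>t. 0) (\<lambda>t. 0)"
  by (simp add: C2_derivs_def)

lemma C2_derivs_add:
  assumes "C2_derivs T f f' f''" "C2_derivs T g g' g''"
  shows "C2_derivs T (\<lambda>t. f t + g t) (\<lambda>t. f' t + g' t) (\<lambda>t. f'' t + g'' t)"
  using assms unfolding C2_derivs_def by (auto intro!: derivative_intros continuous_intros)

lemma C2_derivs_mult:
  assumes "C2_derivs T f f' f''" "C2_derivs T g g' g''"
  shows "C2_derivs T (\<lambda>t. f t * g t) (\<lambda>t. f' t * g t + f t * g' t)
    (\<lambda>t. f'' t * g t + 2 * (f' t * g' t) + f t * g'' t)"
proof -
  note c = C2_derivs_continuous_on[OF assms(1)] C2_derivs_continuous_on[OF assms(2)]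
  show ?thesis
    unfolding C2_derivs_def
  proof (intro conjI ballI)
    fix t assume t: "t \<in> {0<..T}"
    note d = assms[unfolded C2_derivs_def, THEN conjunct1, rule_format, OF t]
    show "((\<lambda>t. f t * g t) has_real_derivative f' t * g t + f t * g' t) (at t within {0<..T})"
      by (rule DERIV_cong[OF DERIV_mult[OF d(1)[THEN conjunct1] d(2)[THEN conjunct1]]]) simp
    show "((\<lambda>t. f' t * g t + f t * g' t) has_real_derivative
        f'' t * g t + 2 * (f' t * g' t) + f t * g'' t) (at t within {0<..T})"
      by (rule DERIV_cong[OF DERIV_add[OF DERIV_mult[OF d(1)[THEN conjunct2] d(2)[THEN conjunct1]]
            DERIV_mult[OF d(1)[THEN conjunct1] d(2)[THEN conjunct2]]]]) simp
  qed (intro continuous_intros c)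
qed

lemma C2_derivs_cong:
  assumes "C2_derivs T f f' f''" "\<And>t. t \<in> {0<..T} \<Longrightarrow> g t = f t"
    "\<And>t. t \<in> {0<..T} \<Longrightarrow> g' t = f' t" "\<And>t. t \<in> {0<..T} \<Longrightarrow> g'' t = f'' t"
  shows "C2_derivs T g g' g''"
proof -
  have "(g has_real_derivative g' t) (at t within {0<..T})"
    "(g' has_real_derivative g'' t) (at t within {0<..T})" if "t \<in> {0<..T}" for t
    using assms that unfolding C2_derivs_def
    by (metis has_field_derivative_transform_within zero_less_one)+
  moreover have "continuous_on {0<..T} g''"
    using assms continuous_on_cong[of "{0<..T}" "{0<..T}" g'' f''] by (auto simp: C2_derivs_def)
  ultimately show ?thesis by (simp add: C2_derivs_def)
qed

lemma C2_derivs_cutoff: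
  assumes "s > 0"
  shows "C2_derivs T (\<lambda>t. cutoff (t / s)) (\<lambda>t. cutoff' (t / s) / s) (\<lambda>t. cutoff'' (t / s) / s\<^sup>2)"
proof (rule C2_derivsI)
  fix t
  have d: "((\<lambda>t. t / s) has_real_derivative 1 / s) (at t)"
    by (rule DERIV_cdivide[OF DERIV_ident])
  show "((\<lambda>t. cutoff (t / s)) has_real_derivative cutoff' (t / s) / s) (at t)"
    using DERIV_chain2[OF cutoff_derivs(1) d] by simp
  show "((\<lambda>t. cutoff' (t / s) / s) has_real_derivative cutoff'' (t / s) / s\<^sup>2) (at t)"
    using DERIV_cdivide[OF DERIV_chain2[OF cutoff_derivs(2) d], of s] by (simp add: power2_eq_square)
  show "continuous_on {0<..T} (\<lambda>t. cutoff'' (t / s) / s\<^sup>2)"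
    using assms by (intro continuous_intros continuous_on_compose2[OF cutoff''_continuous_on[of UNIV]]) auto
qed

lemma D1_eqI:
  assumes "(f has_real_derivative d) (at t within {0<..T})" "t \<in> {0<..T}"
  shows "D1 T f t = d"
  unfolding D1_def
proof (rule vector_derivative_within)
  have "t / 2 \<in> {0<..T}" "t / 2 \<noteq> t" using assms(2) by auto
  then have "{0<..T} \<noteq> {a}" for a using assms(2) by (metis singletonD)
  then have "t islimpt {0<..T}" using assms(2) by (intro connected_imp_perfect) auto
  then show "at t within {0<..T} \<noteq> bot" by (simp add: trivial_limit_within)
qed (use assms in \<open>simp add: has_real_derivative_iff_has_vector_derivative\<close>)

text \<open>The bridge from explicit derivatives to the vector derivatives \<open>D1\<close> and \<open>D2\<close> that define
  the space of speeds.\<close>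

lemma C2_derivs_D1_D2:
  assumes "C2_derivs T f f' f''" "t \<in> {0<..T}"
  shows "D1 T f t = f' t" "D2 T f t = f'' t"
proof -
  have 1: "D1 T f s = f' s" if "s \<in> {0<..T}" for s
    using assms that by (intro D1_eqI) (auto simp: C2_derivs_def)
  then show "D1 T f t = f' t" using assms by simp
  have "(D1 T f has_real_derivative f'' t) (at t within {0<..T})"
    using assms 1 unfolding C2_derivs_def by (metis has_field_derivative_transform_within zero_less_one)
  then show "D2 T f t = f'' t" unfolding D2_def using assms(2) by (rule D1_eqI)
qed

lemma PS2_C2_derivs:
  assumes "c \<in> PS2 T \<mu>1 \<mu>2 \<omega> \<psi>"
  shows "C2_derivs T c (D1 T c) (D2 T c)"
proof -
  have diff: "(f has_real_derivative D1 T f t) (at t within {0<..T})"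
    if f: "f differentiable_on {0<..T}" and t: "t \<in> {0<..T}" for f t
  proof -
    obtain d where "(f has_real_derivative d) (at t within {0<..T})"
      using f t unfolding differentiable_on_def real_differentiable_def by blast
    then show ?thesis using D1_eqI t by metis
  qed
  then show ?thesis using assms
    unfolding C2_derivs_def PS2_def C2_Ioc_def D2_def by auto
qed

lemma PS2I:
  assumes c: "continuous_on {0..T} c" and d: "C2_derivs T c c' c''"
    and "\<And>t. t \<in> {0<..<T} \<Longrightarrow> \<mu>1 \<le> c t \<and> c t \<le> \<mu>2"
    and "\<And>t. t \<in> {0<..T} \<Longrightarrow> \<bar>c' t\<bar> \<le> \<omega> t / t"
    and "\<And>t. t \<in> {0<..T} \<Longrightarrow> \<bar>c'' t\<bar> \<le> (\<omega> t)\<^sup>2 / t\<^sup>2 * exp (\<psi> t)"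
  shows "restrict c {0..T} \<in> PS2 T \<mu>1 \<mu>2 \<omega> \<psi>"
    and "\<And>t. t \<in> {0<..T} \<Longrightarrow> D1 T (restrict c {0..T}) t = c' t"
    and "\<And>t. t \<in> {0<..T} \<Longrightarrow> D2 T (restrict c {0..T}) t = c'' t"
proof -
  let ?c = "restrict c {0..T}"
  have d': "C2_derivs T ?c c' c''" by (rule C2_derivs_cong[OF d]) auto
  note D = C2_derivs_D1_D2[OF d']
  then show "\<And>t. t \<in> {0<..T} \<Longrightarrow> D1 T ?c t = c' t" "\<And>t. t \<in> {0<..T} \<Longrightarrow> D2 T ?c t = c'' t" by auto
  have "C2_derivs T ?c (D1 T ?c) (D2 T ?c)" by (rule C2_derivs_cong[OF d']) (auto simp: D)
  then have "C2_Ioc T ?c"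
    unfolding C2_Ioc_def C2_derivs_def differentiable_on_def real_differentiable_def by blast
  moreover have "continuous_on {0..T} ?c"
    using c continuous_on_cong[of "{0..T}" "{0..T}" ?c c] by auto
  ultimately show "?c \<in> PS2 T \<mu>1 \<mu>2 \<omega> \<psi>"
    using assms(3-5) by (auto simp: PS2_def D)
qed

text \<open>The bounds are imposed on the open interval and extend to the end points by continuity.\<close>

lemma PS2_range:
  assumes "c \<in> PS2 T \<mu>1 \<mu>2 \<omega> \<psi>" "T > 0" "t \<in> {0..T}"
  shows "\<mu>1 \<le> c t \<and> c t \<le> \<mu>2"
proof -
  have cl: "closure {0<..<T} = {0..T}" using assms(2) by simp
  have "continuous_on (closure {0<..<T}) c" using assms(1) by (simp add: cl PS2_def)
  then show ?thesis
    using assms(1,3) continuous_le_on_closure[of "{0<..<T}" c t \<mu>2]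
      continuous_ge_on_closure[of "{0<..<T}" c t \<mu>1]
    by (auto simp: cl PS2_def)
qed

lemma dist_PS2_le:
  assumes T: "T > 0" and c: "c1 \<in> PS2 T \<mu>1 \<mu>2 \<omega> \<psi>" "c2 \<in> PS2 T \<mu>1 \<mu>2 \<omega> \<psi>"
    and "\<And>t. t \<in> {0<..<T} \<Longrightarrow> \<bar>c1 t - c2 t\<bar> \<le> e"
    and "\<And>t. t \<in> {0<..<T} \<Longrightarrow> t\<^sup>2 / \<omega> t * \<bar>D1 T c1 t - D1 T c2 t\<bar> \<le> e"
    and "\<And>t. t \<in> {0<..<T} \<Longrightarrow> t ^ 3 * exp (- \<psi> t) / (\<omega> t)\<^sup>2 * \<bar>D2 T c1 t - D2 T c2 t\<bar> \<le> e"
  shows "dist_PS2 T \<mu>1 \<mu>2 \<omega> \<psi> c1 c2 \<le> 3 * e"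
proof -
  have ne: "{0<..<T} \<noteq> {}" using T by simp
  have "(SUP t\<in>{0<..<T}. \<bar>c1 t - c2 t\<bar>) \<le> e"
    "(SUP t\<in>{0<..<T}. t\<^sup>2 / \<omega> t * \<bar>D1 T c1 t - D1 T c2 t\<bar>) \<le> e"
    "(SUP t\<in>{0<..<T}. t ^ 3 * exp (- \<psi> t) / (\<omega> t)\<^sup>2 * \<bar>D2 T c1 t - D2 T c2 t\<bar>) \<le> e"
    using assms by (auto intro!: cSUP_least[OF ne])
  then show ?thesis using c by (simp add: dist_PS2_def)
qed

lemma abs_diff_le_dist_PS2:
  assumes T: "T > 0" and om: "\<And>t. t \<in> {0<..T} \<Longrightarrow> \<omega> t > 0"
    and c: "c1 \<in> PS2 T \<mu>1 \<mu>2 \<omega> \<psi>" "c2 \<in> PS2 T \<mu>1 \<mu>2 \<omega> \<psi>" and t: "t \<in> {0<..<T}"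
  shows "\<bar>c1 t - c2 t\<bar> \<le> dist_PS2 T \<mu>1 \<mu>2 \<omega> \<psi> c1 c2"
proof -
  define f where "f t = \<bar>c1 t - c2 t\<bar>" for t
  define g where "g t = t\<^sup>2 / \<omega> t * \<bar>D1 T c1 t - D1 T c2 t\<bar>" for t
  define h where "h t = t ^ 3 * exp (- \<psi> t) / (\<omega> t)\<^sup>2 * \<bar>D2 T c1 t - D2 T c2 t\<bar>" for t
  have bdd: "bdd_above (f ` {0<..<T})" "bdd_above (g ` {0<..<T})" "bdd_above (h ` {0<..<T})"
    subgoal unfolding f_def by (rule bdd_aboveI2, rule PS2_bounds(1)[OF T _ c]) (use om in auto)
    subgoal unfolding g_def by (rule bdd_aboveI2, rule PS2_bounds(2)[OF T _ c]) (use om in auto)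
    subgoal unfolding h_def by (rule bdd_aboveI2, rule PS2_bounds(3)[OF T _ c]) (use om in auto)
    done
  have pos: "g t \<ge> 0" "h t \<ge> 0"
    using t om[of t] by (auto simp: g_def h_def)
  have "f t \<le> (SUP t\<in>{0<..<T}. f t)" by (rule cSUP_upper[OF t bdd(1)])
  moreover have "0 \<le> (SUP t\<in>{0<..<T}. g t)" by (rule cSUP_upper2[OF bdd(2) t pos(1)])
  moreover have "0 \<le> (SUP t\<in>{0<..<T}. h t)" by (rule cSUP_upper2[OF bdd(3) t pos(2)])
  ultimately show ?thesis using c by (simp add: dist_PS2_def f_def g_def h_def)
qed

text \<open>This and the next estimate say that the derivative parts of the distance see nothing near the
  origin: two admissible derivatives at time \<open>t\<close> are always within \<open>2t\<close>. A speed may therefore be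
  changed at will on a short initial interval if the change is uniformly small.\<close>

lemma weighted_deriv_diff_le:
  fixes t b x y :: real
  assumes "t > 0" "b > 0" "\<bar>x\<bar> \<le> b / t" "\<bar>y\<bar> \<le> b / t"
  shows "t\<^sup>2 / b * \<bar>x - y\<bar> \<le> 2 * t"
proof -
  have "t\<^sup>2 / b * \<bar>x - y\<bar> \<le> t\<^sup>2 / b * (2 * (b / t))"
    using assms by (intro mult_left_mono) auto
  also have "\<dots> = 2 * t" using assms by (simp add: power2_eq_square)
  finally show ?thesis .
qed

lemma weighted_deriv2_diff_le:
  fixes t b p x y :: real
  assumes "t > 0" "b > 0" "\<bar>x\<bar> \<le> b\<^sup>2 / t\<^sup>2 * exp p" "\<bar>y\<bar> \<le> b\<^sup>2 / t\<^sup>2 * exp p"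
  shows "t ^ 3 * exp (- p) / b\<^sup>2 * \<bar>x - y\<bar> \<le> 2 * t"
proof -
  have "t ^ 3 * exp (- p) / b\<^sup>2 * \<bar>x - y\<bar> \<le> t ^ 3 * exp (- p) / b\<^sup>2 * (2 * (b\<^sup>2 / t\<^sup>2 * exp p))"
    using assms by (intro mult_left_mono) auto
  also have "\<dots> = 2 * t"
    using assms by (simp add: field_simps power2_eq_square power3_eq_cube exp_minus)
  finally show ?thesis .
qed

section \<open>Growth along a resonant speed\<close>

text \<open>Speeding up time by the factor \<open>\<nu>\<close> multiplies the coefficient by \<open>\<nu>\<^sup>2\<close>; the position is
  divided by \<open>\<nu>\<close> so that the velocity keeps its size.\<close>

lemma oscillator_rescale:
  assumes o: "oscillator X q w v" and nu: "\<nu> > 0"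
  shows "oscillator (X / \<nu>) (\<lambda>t. \<nu>\<^sup>2 * q (\<nu> * t)) (\<lambda>t. w (\<nu> * t) / \<nu>) (\<lambda>t. v (\<nu> * t))"
  unfolding oscillator_def
proof (intro ballI conjI)
  fix t assume t: "t \<in> {0..X / \<nu>}"
  have img: "(\<lambda>t. \<nu> * t) ` {0..X / \<nu>} \<subseteq> {0..X}"
    using nu by (auto simp: pos_le_divide_eq mult.commute)
  then have "\<nu> * t \<in> {0..X}" using t by blast
  then have d: "(w has_real_derivative v (\<nu> * t)) (at (\<nu> * t) within {0..X})"
    "(v has_real_derivative - (q (\<nu> * t) * w (\<nu> * t))) (at (\<nu> * t) within {0..X})"
    using o unfolding oscillator_def by auto
  have s: "((\<lambda>t. \<nu> * t) has_real_derivative \<nu>) (at t within {0..X / \<nu>})"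
    by (auto intro!: derivative_eq_intros)
  note c = DERIV_image_chain[OF DERIV_subset[OF d(1) img] s] DERIV_image_chain[OF DERIV_subset[OF d(2) img] s]
  show "((\<lambda>t. w (\<nu> * t) / \<nu>) has_real_derivative v (\<nu> * t)) (at t within {0..X / \<nu>})"
    using DERIV_cdivide[OF c(1), of \<nu>] nu by (simp add: o_def)
  show "((\<lambda>t. v (\<nu> * t)) has_real_derivative - (\<nu>\<^sup>2 * q (\<nu> * t) * (w (\<nu> * t) / \<nu>))) (at t within {0..X / \<nu>})"
    using c(2) nu by (simp add: o_def power2_eq_square mult_ac)
qed

text \<open>On \<open>[0,s]\<close> the speed is the resonant profile and the solution is known explicitly. On
  \<open>[s,2s]\<close>, where the modulation is switched off, the energy estimate loses at most \<open>exp (- A K/\<mu>\<^sub>1)\<close>,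
  which the gain \<open>(\<nu>s/(KB))\<^sup>K\<close> can pay for because both are exponential in \<open>K\<close>; on \<open>[2s,T]\<close> it loses
  a factor independent of \<open>\<nu>\<close>. The remaining constants in the hypothesis come from passing between the
  energy, the norm of \<open>(w, v)\<close>, and powers of \<open>\<nu>\<close> and \<open>1 + l\<close>.\<close>

lemma resonant_growth:
  fixes k :: nat
  assumes K: "K \<ge> 1" and B: "B \<ge> 2" and nu: "\<nu> \<ge> 1" and l: "\<nu>\<^sup>2 = l * c0"
    and mu: "0 < \<mu>1" and c0: "\<mu>1 \<le> c0" "c0 \<le> \<mu>2" and s: "0 < s" "2 * s \<le> T"
    and cont: "continuous_on {0..T} c"
    and deriv: "\<And>t. t \<in> {0<..<T} \<Longrightarrow> (c has_real_derivative c' t) (at t)"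
    and range: "\<And>t. t \<in> {0..T} \<Longrightarrow> \<mu>1 \<le> c t \<and> c t \<le> \<mu>2"
    and resonant: "\<And>t. t \<in> {0..s} \<Longrightarrow> c t = c0 * (1 - profile K B (\<nu> * t))"
    and near: "\<And>t. t \<in> {s<..<2 * s} \<Longrightarrow> \<bar>c' t\<bar> \<le> A * K / s"
    and far: "\<And>t. t \<in> {2 * s<..<T} \<Longrightarrow> \<bar>c' t\<bar> \<le> P" and P: "P \<ge> 0"
    and gain: "(4 * real k + 2) * ln \<nu> +
        (2 * real k * ln (1 + 1 / \<mu>1) + ln (1 + \<mu>2 / \<mu>1) + 1 / 2 + ln 2 + ln (\<mu>2 / \<mu>1) + P * T / \<mu>1)
      \<le> K * (ln (\<nu> * s / K) - (ln B + A / \<mu>1))"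
    and osc: "oscillator T (\<lambda>t. l * c t) w v" "w 0 = 0" "v 0 = 1"
    and t: "t \<in> {2 * s..T}"
  shows "(1 + l) ^ k < norm (w t, v t)"
proof -
  have mu2: "\<mu>2 > 0" using mu c0 by linarith
  have c0p: "c0 > 0" using mu c0 by linarith
  have leq: "l = \<nu>\<^sup>2 / c0" using l c0p by (simp add: field_simps)
  have lp: "l > 0" unfolding leq using nu c0p by simp
  define E where "E t = (v t)\<^sup>2 + l * c t * (w t)\<^sup>2" for t
  define G where "G = (1 + \<nu> * s / (K * B)) powr K * exp (- 1 / 2) / 2"
  have KB: "K * B > 0" using K B by simp
  have "G * (\<mu>1 / \<mu>2) \<le> E s"
  proof -
    have "\<nu> * s > 0" using nu s by simp
    from parametric_resonance[OF K B this] obtain W V where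
      o: "oscillator (\<nu> * s) (\<lambda>x. 1 - profile K B x) W V" and init: "W 0 = 0" "V 0 = 1"
      and big: "G \<le> (W (\<nu> * s))\<^sup>2 + (V (\<nu> * s))\<^sup>2" unfolding G_def by blast
    have "oscillator s (\<lambda>t. \<nu>\<^sup>2 * (1 - profile K B (\<nu> * t))) (\<lambda>t. W (\<nu> * t) / \<nu>) (\<lambda>t. V (\<nu> * t))"
      using oscillator_rescale[OF o, of \<nu>] nu by simp
    then have o': "oscillator s (\<lambda>t. l * c t) (\<lambda>t. W (\<nu> * t) / \<nu>) (\<lambda>t. V (\<nu> * t))"
    proof (rule oscillator_cong)
      fix t assume "t \<in> {0..s}"
      then show "\<nu>\<^sup>2 * (1 - profile K B (\<nu> * t)) = l * c t"
        using resonant[of t] by (simp only: l mult.assoc)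
    qed
    have "\<bar>l * c t\<bar> \<le> l * \<mu>2" if "t \<in> {0<..<s}" for t
    proof -
      have "0 \<le> c t" "c t \<le> \<mu>2" using range[of t] that s mu by auto
      then show ?thesis using lp by (simp add: abs_mult)
    qed
    moreover have "w 0 = W (\<nu> * 0) / \<nu>" "v 0 = V (\<nu> * 0)" using osc(2,3) init by simp_all
    moreover have "oscillator s (\<lambda>t. l * c t) w v" by (rule oscillator_subinterval[OF osc(1)]) (use s in simp)
    ultimately have ws: "w s = W (\<nu> * s) / \<nu>" "v s = V (\<nu> * s)"
      using oscillator_unique[OF _ o', of w v "l * \<mu>2" s] s by (simp_all only: atLeastAtMost_iff) auto
    have "G * (\<mu>1 / \<mu>2) \<le> ((W (\<nu> * s))\<^sup>2 + (V (\<nu> * s))\<^sup>2) * (\<mu>1 / \<mu>2)"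
      using big mu mu2 by (intro mult_right_mono) auto
    also have "\<dots> \<le> (\<mu>1 / c0) * (W (\<nu> * s))\<^sup>2 + (V (\<nu> * s))\<^sup>2"
    proof -
      have "\<mu>1 / \<mu>2 \<le> \<mu>1 / c0" "\<mu>1 / \<mu>2 \<le> 1" using mu mu2 c0 c0p by (auto intro: divide_left_mono)
      then have "(\<mu>1 / \<mu>2) * (W (\<nu> * s))\<^sup>2 + (\<mu>1 / \<mu>2) * (V (\<nu> * s))\<^sup>2
          \<le> (\<mu>1 / c0) * (W (\<nu> * s))\<^sup>2 + 1 * (V (\<nu> * s))\<^sup>2"
        by (intro add_mono mult_right_mono) auto
      then show ?thesis by (simp add: distrib_left distrib_right mult.commute)
    qed
    also have "(\<mu>1 / c0) * (W (\<nu> * s))\<^sup>2 = l * \<mu>1 * (w s)\<^sup>2"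
      using nu c0p by (simp add: ws leq power_divide)
    also have "l * \<mu>1 * (w s)\<^sup>2 + (V (\<nu> * s))\<^sup>2 \<le> E s"
      using range[of s] s lp unfolding E_def ws(2)[symmetric]
      by (simp add: mult_right_mono)
    finally show ?thesis .
  qed
  moreover have "E s * exp (- (A * K / \<mu>1)) \<le> E (2 * s)"
  proof -
    have "E s * exp (- (A * K / s * (2 * s - s) / \<mu>1)) \<le> E (2 * s)"
      unfolding E_def
      by (rule oscillator_energy_lower_bound[OF osc(1) _ mu deriv cont near])
        (use lp s range in auto)
    then show ?thesis using s by simp
  qed
  moreover have "E (2 * s) * exp (- (P * T / \<mu>1)) \<le> E t"
  proof -
    have "E (2 * s) * exp (- (P * (t - 2 * s) / \<mu>1)) \<le> E t"
      unfolding E_def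
      by (rule oscillator_energy_lower_bound[OF osc(1) _ mu deriv cont far])
        (use lp s t range in auto)
    moreover have "P * (t - 2 * s) / \<mu>1 \<le> P * T / \<mu>1"
      using P mu t s by (intro divide_right_mono mult_left_mono) auto
    moreover have "E (2 * s) \<ge> 0" using range[of "2 * s"] s lp mu by (auto simp: E_def)
    ultimately show ?thesis
      by (smt (verit) exp_le_cancel_iff mult_left_mono)
  qed
  ultimately have Et: "G * (\<mu>1 / \<mu>2) * exp (- (A * K / \<mu>1)) * exp (- (P * T / \<mu>1)) \<le> E t"
    by (smt (verit) exp_gt_zero mult_right_mono)
  have "E t \<le> (1 + l * \<mu>2) * ((w t)\<^sup>2 + (v t)\<^sup>2)"
  proof -
    have "l * c t * (w t)\<^sup>2 \<le> l * \<mu>2 * (w t)\<^sup>2"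
      using range[of t] t s lp by (intro mult_right_mono mult_left_mono) auto
    moreover have "0 \<le> l * \<mu>2 * (v t)\<^sup>2" using lp mu2 by simp
    moreover have "(1 + l * \<mu>2) * ((w t)\<^sup>2 + (v t)\<^sup>2) = (w t)\<^sup>2 + (v t)\<^sup>2 + l * \<mu>2 * (w t)\<^sup>2 + l * \<mu>2 * (v t)\<^sup>2"
      by (simp add: algebra_simps)
    ultimately show ?thesis unfolding E_def using zero_le_power2[of "w t"] by linarith
  qed
  moreover have "((1 + l) ^ k)\<^sup>2 * (1 + l * \<mu>2) < E t"
  proof -
    define Z where "Z = 2 * real k * ln (1 + 1 / \<mu>1) + ln (1 + \<mu>2 / \<mu>1) + 1 / 2 + ln 2 + ln (\<mu>2 / \<mu>1) + P * T / \<mu>1"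
    have nu2: "\<nu>\<^sup>2 \<ge> 1" using nu by simp
    have "l \<le> \<nu>\<^sup>2 / \<mu>1" unfolding leq using mu c0 c0p by (intro divide_left_mono) auto
    then have "1 + l \<le> \<nu>\<^sup>2 * (1 + 1 / \<mu>1)" "l * \<mu>2 \<le> \<nu>\<^sup>2 / \<mu>1 * \<mu>2"
      using nu2 mu2 mult_right_mono[of l "\<nu>\<^sup>2 / \<mu>1" \<mu>2] by (auto simp: distrib_left)
    then have l1: "1 + l \<le> \<nu>\<^sup>2 * (1 + 1 / \<mu>1)" "1 + l * \<mu>2 \<le> \<nu>\<^sup>2 * (1 + \<mu>2 / \<mu>1)"
      using nu2 by (auto simp: distrib_left)
    have pos: "1 + 1 / \<mu>1 > 0" "1 + \<mu>2 / \<mu>1 > 0" "\<nu> > 0" "\<mu>2 / \<mu>1 > 0"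
      using mu mu2 nu by (auto intro!: add_pos_pos)
    have "((1 + l) ^ k)\<^sup>2 * (1 + l * \<mu>2) \<le> ((\<nu>\<^sup>2 * (1 + 1 / \<mu>1)) ^ k)\<^sup>2 * (\<nu>\<^sup>2 * (1 + \<mu>2 / \<mu>1))"
      using l1 lp mu2 by (intro mult_mono power_mono) auto
    also have "\<dots> = exp (ln (((\<nu>\<^sup>2 * (1 + 1 / \<mu>1)) ^ k)\<^sup>2 * (\<nu>\<^sup>2 * (1 + \<mu>2 / \<mu>1))))"
      using pos by (subst exp_ln) auto
    also have "ln (((\<nu>\<^sup>2 * (1 + 1 / \<mu>1)) ^ k)\<^sup>2 * (\<nu>\<^sup>2 * (1 + \<mu>2 / \<mu>1)))
        = (4 * real k + 2) * ln \<nu> + 2 * real k * ln (1 + 1 / \<mu>1) + ln (1 + \<mu>2 / \<mu>1)"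
    proof -
      have "ln (((\<nu>\<^sup>2 * x) ^ k)\<^sup>2 * (\<nu>\<^sup>2 * y)) = 2 * (real k * (2 * ln \<nu> + ln x)) + (2 * ln \<nu> + ln y)"
        if "x > 0" "y > 0" for x y
        using that pos(3) by (simp add: ln_mult_pos ln_realpow)
      from this[OF pos(1,2)] show ?thesis by (simp add: algebra_simps)
    qed
    also have "\<dots> = (4 * real k + 2) * ln \<nu> + Z - (1 / 2 + ln 2 + ln (\<mu>2 / \<mu>1) + P * T / \<mu>1)"
      by (simp add: Z_def)
    also have "exp \<dots> \<le> exp (K * (ln (\<nu> * s / K) - (ln B + A / \<mu>1)) - (1 / 2 + ln 2 + ln (\<mu>2 / \<mu>1) + P * T / \<mu>1))"
      using gain by (simp add: Z_def)
    also have "K * (ln (\<nu> * s / K) - (ln B + A / \<mu>1)) - (1 / 2 + ln 2 + ln (\<mu>2 / \<mu>1) + P * T / \<mu>1)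
        = K * ln (\<nu> * s / (K * B)) + - 1 / 2 + - ln 2 + - ln (\<mu>2 / \<mu>1) + - (A * K / \<mu>1) + - (P * T / \<mu>1)"
      using nu s K B by (simp add: ln_div ln_mult_pos algebra_simps)
    also have "exp \<dots> = (\<nu> * s / (K * B)) powr K * exp (- 1 / 2) / 2 * (\<mu>1 / \<mu>2) * exp (- (A * K / \<mu>1)) * exp (- (P * T / \<mu>1))"
    proof -
      have 1: "\<nu> * s / (K * B) \<noteq> 0" using nu s KB by auto
      have 2: "exp (- ln (\<mu>2 / \<mu>1)) = \<mu>1 / \<mu>2" "exp (- ln 2) = 1 / (2::real)"
        using pos(4) by (simp_all add: exp_minus)
      show ?thesis unfolding exp_add powr_def 2 using 1 by simp
    qed
    also have "\<dots> < G * (\<mu>1 / \<mu>2) * exp (- (A * K / \<mu>1)) * exp (- (P * T / \<mu>1))"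
    proof -
      have "(\<nu> * s / (K * B)) powr K < (1 + \<nu> * s / (K * B)) powr K"
        using nu s KB K by (intro powr_less_mono2) auto
      then show ?thesis unfolding G_def
        using mu mu2 by (intro mult_strict_right_mono divide_strict_right_mono) auto
    qed
    finally show ?thesis using Et by linarith
  qed
  ultimately have "((1 + l) ^ k)\<^sup>2 * (1 + l * \<mu>2) < ((w t)\<^sup>2 + (v t)\<^sup>2) * (1 + l * \<mu>2)"
    by (simp add: mult.commute)
  then have "((1 + l) ^ k)\<^sup>2 < (w t)\<^sup>2 + (v t)\<^sup>2"
    using lp mu2 by (simp add: add_pos_pos)
  then show ?thesis using lp by (simp add: norm_Pair real_less_rsqrt)
qed

section \<open>Speeds that are constant near the origin\<close>

locale propagation_speeds =
  fixes T0 \<mu>1 \<mu>2 :: real and \<omega> \<psi> :: "real \<Rightarrow> real"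
  assumes T0: "T0 > 0" and mu1: "\<mu>1 > 0" and mu12: "\<mu>2 > \<mu>1"
    and omega_pos: "\<forall>t\<in>{0<..T0}. \<omega> t > 0" and psi_pos: "\<forall>t\<in>{0<..T0}. \<psi> t > 0"
    and omega_mono: "antimono_on {0<..T0} \<omega>" and psi_mono: "antimono_on {0<..T0} \<psi>"
    and omega_lim: "filterlim \<omega> at_top (at_right 0)"
    and omega_psi_lim: "filterlim (\<lambda>t. \<omega> t * \<psi> t / \<bar>ln t\<bar>) at_top (at_right 0)"
begin

abbreviation "\<P> \<equiv> PS2 T0 \<mu>1 \<mu>2 \<omega> \<psi>"

lemma omega_antimono: "0 < s \<Longrightarrow> s \<le> t \<Longrightarrow> t \<le> T0 \<Longrightarrow> \<omega> t \<le> \<omega> s"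
  using monotone_onD[OF omega_mono, of s t] by auto

lemma psi_antimono: "0 < s \<Longrightarrow> s \<le> t \<Longrightarrow> t \<le> T0 \<Longrightarrow> \<psi> t \<le> \<psi> s"
  using monotone_onD[OF psi_mono, of s t] by auto

text \<open>The speed \<open>c\<close> is contracted by a factor \<open>1 - e\<close> towards the midpoint \<open>m\<close> of \<open>[\<mu>\<^sub>1,\<mu>\<^sub>2]\<close>, which frees a
  fraction of every bound, and its deviation from \<open>c(0)\<close> is cut off near the origin. A derivative that
  falls on the cut-off costs a factor \<open>C/t\<close>, whereas the bounds allow \<open>\<omega>/t\<close>; as \<open>\<omega> \<rightarrow> \<infinity>\<close>, the freed
  fraction pays for it when \<open>\<tau>\<close> is small.\<close>

lemma flatten_near_origin:
  assumes c: "c \<in> \<P>" and eps: "\<epsilon> > 0"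
  obtains \<eta> h \<tau> b b' b'' c0 where
    "0 < \<eta>" "0 < h" "0 < \<tau>" "\<tau> \<le> T0" "2 * \<tau> \<le> \<epsilon>"
    "continuous_on {0..T0} b" "C2_derivs T0 b b' b''"
    "\<And>t. t \<in> {0..T0} \<Longrightarrow> \<mu>1 + h \<le> b t \<and> b t \<le> \<mu>2 - h"
    "\<And>t. t \<in> {0<..T0} \<Longrightarrow> \<bar>b' t\<bar> \<le> (1 - \<eta>) * (\<omega> t / t)"
    "\<And>t. t \<in> {0<..T0} \<Longrightarrow> \<bar>b'' t\<bar> \<le> (1 - \<eta>) * ((\<omega> t)\<^sup>2 / t\<^sup>2 * exp (\<psi> t))"
    "\<And>t. t \<in> {0..\<tau>} \<Longrightarrow> b t = c0" "\<And>t. t \<in> {0<..\<tau>} \<Longrightarrow> b' t = 0 \<and> b'' t = 0"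
    "\<And>t. t \<in> {0..T0} \<Longrightarrow> \<bar>b t - c t\<bar> \<le> \<epsilon>"
    "\<And>t. t \<in> {0<..T0} \<Longrightarrow> t\<^sup>2 / \<omega> t * \<bar>b' t - D1 T0 c t\<bar> \<le> \<epsilon>"
    "\<And>t. t \<in> {0<..T0} \<Longrightarrow> t ^ 3 * exp (- \<psi> t) / (\<omega> t)\<^sup>2 * \<bar>b'' t - D2 T0 c t\<bar> \<le> \<epsilon>"
proof -
  obtain C where C: "C \<ge> 1" "\<And>s t. s > 0 \<Longrightarrow> t > 0 \<Longrightarrow> \<bar>cutoff' (t / s) / s\<bar> \<le> C / t"
    "\<And>s t. s > 0 \<Longrightarrow> t > 0 \<Longrightarrow> \<bar>cutoff'' (t / s) / s\<^sup>2\<bar> \<le> C / t\<^sup>2"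
    using cutoff_scale_invariant_bounds by blast
  define \<Delta> where "\<Delta> = \<mu>2 - \<mu>1"
  have \<Delta>: "\<Delta> > 0" using mu12 by (simp add: \<Delta>_def)
  define m where "m = (\<mu>1 + \<mu>2) / 2"
  define e where "e = Min {1 / 2, \<epsilon> / (2 * \<Delta>), \<epsilon> / T0}"
  have e: "0 < e" "e \<le> 1 / 2" "e \<le> \<epsilon> / (2 * \<Delta>)" "e \<le> \<epsilon> / T0"
    subgoal using eps \<Delta> T0 by (simp add: e_def)
    by (unfold e_def, (rule Min_le; simp)+)
  have eD: "e * \<Delta> \<le> \<epsilon> / 2" "e * T0 \<le> \<epsilon>" using e \<Delta> T0 by (auto simp: field_simps)
  have cc: "continuous_on {0..T0} c" using c by (simp add: PS2_def)
  have cd: "C2_derivs T0 c (D1 T0 c) (D2 T0 c)" by (rule PS2_C2_derivs[OF c])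
  have cr: "\<mu>1 \<le> c t \<and> c t \<le> \<mu>2" if "t \<in> {0..T0}" for t by (rule PS2_range[OF c T0 that])
  have c1: "\<bar>D1 T0 c t\<bar> \<le> \<omega> t / t" "\<bar>D2 T0 c t\<bar> \<le> (\<omega> t)\<^sup>2 / t\<^sup>2 * exp (\<psi> t)"
    if "t \<in> {0<..T0}" for t using c that by (auto simp: PS2_def)
  define \<Omega> where "\<Omega> = max 1 (2 * C * (2 + \<Delta>) / e)"
  obtain d1 where d1: "d1 > 0" "\<And>t. t \<in> {0..T0} \<Longrightarrow> t < d1 \<Longrightarrow> \<bar>c t - c 0\<bar> < \<epsilon> / 2"
  proof -
    have "\<exists>d>0. \<forall>t\<in>{0..T0}. dist t 0 < d \<longrightarrow> dist (c t) (c 0) < \<epsilon> / 2"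
      using cc[unfolded continuous_on_iff, rule_format, of 0 "\<epsilon> / 2"] T0 eps by auto
    then show ?thesis using that by (auto simp: dist_real_def)
  qed
  obtain d2 where d2: "d2 > 0" "\<And>t. 0 < t \<Longrightarrow> t < d2 \<Longrightarrow> \<Omega> \<le> \<omega> t"
    using omega_lim unfolding filterlim_at_top eventually_at_right_field by metis
  define \<tau> where "\<tau> = Min {T0 / 4, \<epsilon> / 4, d1 / 4, d2 / 4}"
  have tau: "0 < \<tau>" "4 * \<tau> \<le> T0" "4 * \<tau> \<le> \<epsilon>" "4 * \<tau> \<le> d1" "4 * \<tau> \<le> d2"
  proof -
    show "0 < \<tau>" using T0 eps d1 d2 by (simp add: \<tau>_def)
    have "\<tau> \<le> T0 / 4" "\<tau> \<le> \<epsilon> / 4" "\<tau> \<le> d1 / 4" "\<tau> \<le> d2 / 4" unfolding \<tau>_def by (rule Min_le; simp)+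
    then show "4 * \<tau> \<le> T0" "4 * \<tau> \<le> \<epsilon>" "4 * \<tau> \<le> d1" "4 * \<tau> \<le> d2" by auto
  qed
  define X where "X t = cutoff (t / \<tau>)" for t
  define X' where "X' t = cutoff' (t / \<tau>) / \<tau>" for t
  define X'' where "X'' t = cutoff'' (t / \<tau>) / \<tau>\<^sup>2" for t
  have X: "0 \<le> X t" "X t \<le> 1" for t by (auto simp: X_def cutoff_range)
  have Xl: "X t = 1" "X' t = 0" "X'' t = 0" if "t \<le> \<tau>" for t
    using that tau cutoff_left[of "t / \<tau>"] by (auto simp: X_def X'_def X''_def)
  have Xr: "X t = 0" "X' t = 0" "X'' t = 0" if "2 * \<tau> \<le> t" for t
    using that tau cutoff_right[of "t / \<tau>"] by (auto simp: X_def X'_def X''_def pos_le_divide_eq)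
  have Xb: "\<bar>X' t\<bar> \<le> C / t" "\<bar>X'' t\<bar> \<le> C / t\<^sup>2" if "t > 0" for t
    using C(2,3)[OF tau(1) that] by (auto simp: X'_def X''_def)
  define f where "f t = c t + - c 0" for t
  have fb: "\<bar>f t\<bar> \<le> \<Delta>" if "t \<in> {0..T0}" for t
    using cr[OF that] cr[of 0] T0 by (auto simp: f_def \<Delta>_def)
  define c0 where "c0 = c 0 + e * (m - c 0)"
  define b where "b t = c0 + (1 - e) * ((1 + (- 1) * X t) * f t)" for t
  define b' where "b' t = (1 - e) * ((1 - X t) * D1 T0 c t - X' t * f t)" for t
  define b'' where "b'' t = (1 - e) * ((1 - X t) * D2 T0 c t - 2 * X' t * D1 T0 c t - X'' t * f t)" for t
  have b_alt: "b t = (1 - e) * ((1 - X t) * c t + X t * c 0) + e * m" for t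
    by (simp add: b_def c0_def f_def algebra_simps)
  have "C2_derivs T0 X X' X''"
    unfolding X_def[abs_def] X'_def[abs_def] X''_def[abs_def] by (rule C2_derivs_cutoff[OF tau(1)])
  note rules = C2_derivs_mult[OF C2_derivs_const[of T0 "1 - e"]
      C2_derivs_mult[OF C2_derivs_add[OF C2_derivs_const[of T0 1] C2_derivs_mult[OF C2_derivs_const[of T0 "- 1"] this]]
        C2_derivs_add[OF cd C2_derivs_const[of T0 "- c 0"]]]]
  have bd: "C2_derivs T0 b b' b''"
    by (rule C2_derivs_cong[OF C2_derivs_add[OF C2_derivs_const[of T0 c0] rules]])
      (simp_all add: b_def b'_def b''_def f_def algebra_simps)
  have om1: "\<omega> t > 0" if "t \<in> {0<..T0}" for t using omega_pos that by blast
  have om: "\<Omega> \<le> \<omega> t" if "0 < t" "t < 2 * \<tau>" for t using d2(2)[of t] that tau by auto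
  \<comment> \<open>the terms with a derivative of the cut-off cost at most the margin gained by shrinking\<close>
  have cross: "C * \<Delta> \<le> e / 2 * \<omega> t" "2 * C * \<omega> t + C * \<Delta> \<le> e / 2 * ((\<omega> t)\<^sup>2 * exp (\<psi> t))"
    if t: "0 < t" "t < 2 * \<tau>" for t
  proof -
    have tT: "t \<in> {0<..T0}" using t tau by auto
    have o1: "1 \<le> \<omega> t" "2 * C * (2 + \<Delta>) / e \<le> \<omega> t" using om[OF t] by (auto simp: \<Omega>_def)
    then have "2 * C * (2 + \<Delta>) \<le> e * \<omega> t" using e by (simp add: pos_divide_le_eq mult.commute)
    then have A: "C * (2 + \<Delta>) \<le> e / 2 * \<omega> t" by simp
    then show "C * \<Delta> \<le> e / 2 * \<omega> t" using C(1) by (simp add: distrib_left)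
    have "2 * C * \<omega> t + C * \<Delta> * 1 \<le> 2 * C * \<omega> t + C * \<Delta> * \<omega> t"
      using C(1) \<Delta> o1 by (intro add_left_mono mult_left_mono) auto
    also have "\<dots> = C * (2 + \<Delta>) * \<omega> t" by (simp add: algebra_simps)
    also have "\<dots> \<le> e / 2 * \<omega> t * \<omega> t" using A o1 by (intro mult_right_mono) auto
    also have "\<dots> = e / 2 * ((\<omega> t)\<^sup>2 * 1)" by (simp add: power2_eq_square)
    also have "\<dots> \<le> e / 2 * ((\<omega> t)\<^sup>2 * exp (\<psi> t))"
      using e psi_pos tT by (intro mult_left_mono) (auto intro: less_imp_le)
    finally show "2 * C * \<omega> t + C * \<Delta> \<le> e / 2 * ((\<omega> t)\<^sup>2 * exp (\<psi> t))" by simp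
  qed
  have split: "(1 - e) * x + e / 2 * x = (1 - e / 2) * x" for x by (simp add: algebra_simps)
  have b'_le: "\<bar>b' t\<bar> \<le> (1 - e / 2) * (\<omega> t / t)" if t: "t \<in> {0<..T0}" for t
  proof -
    have tp: "t > 0" using t by simp
    have 1: "(1 - e) * \<bar>(1 - X t) * D1 T0 c t\<bar> \<le> (1 - e) * (\<omega> t / t)"
    proof -
      have "\<bar>(1 - X t) * D1 T0 c t\<bar> \<le> 1 * (\<omega> t / t)"
        unfolding abs_mult using X[of t] c1(1)[OF t] by (intro mult_mono) auto
      then show ?thesis using e by (intro mult_left_mono) auto
    qed
    have 2: "(1 - e) * \<bar>X' t * f t\<bar> \<le> e / 2 * (\<omega> t / t)"
    proof (cases "t < 2 * \<tau>")
      case True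
      have "\<bar>X' t * f t\<bar> \<le> C / t * \<Delta>"
        unfolding abs_mult using Xb(1)[OF tp] fb[of t] t C by (intro mult_mono) auto
      then have "(1 - e) * \<bar>X' t * f t\<bar> \<le> 1 * (C / t * \<Delta>)" using e by (intro mult_mono) auto
      also have "\<dots> = C * \<Delta> / t" by simp
      also have "\<dots> \<le> e / 2 * \<omega> t / t" using cross(1)[OF tp True] tp by (intro divide_right_mono) auto
      finally show ?thesis by simp
    next
      case False then show ?thesis using Xr(2)[of t] e om1[OF t] tp by simp
    qed
    have "\<bar>b' t\<bar> = (1 - e) * \<bar>(1 - X t) * D1 T0 c t - X' t * f t\<bar>"
      using e by (simp add: b'_def abs_mult)
    also have "\<dots> \<le> (1 - e) * (\<bar>(1 - X t) * D1 T0 c t\<bar> + \<bar>X' t * f t\<bar>)"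
      using e by (intro mult_left_mono abs_triangle_ineq4) auto
    also have "\<dots> \<le> (1 - e) * (\<omega> t / t) + e / 2 * (\<omega> t / t)"
      using 1 2 unfolding distrib_left by linarith
    also have "\<dots> = (1 - e / 2) * (\<omega> t / t)" by (rule split)
    finally show ?thesis .
  qed
  have b''_le: "\<bar>b'' t\<bar> \<le> (1 - e / 2) * ((\<omega> t)\<^sup>2 / t\<^sup>2 * exp (\<psi> t))" if t: "t \<in> {0<..T0}" for t
  proof -
    have tp: "t > 0" using t by simp
    have 1: "(1 - e) * \<bar>(1 - X t) * D2 T0 c t\<bar> \<le> (1 - e) * ((\<omega> t)\<^sup>2 / t\<^sup>2 * exp (\<psi> t))"
    proof -
      have "\<bar>(1 - X t) * D2 T0 c t\<bar> \<le> 1 * ((\<omega> t)\<^sup>2 / t\<^sup>2 * exp (\<psi> t))"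
        unfolding abs_mult using X[of t] c1(2)[OF t] by (intro mult_mono) auto
      then show ?thesis using e by (intro mult_left_mono) auto
    qed
    have 2: "(1 - e) * (\<bar>2 * X' t * D1 T0 c t\<bar> + \<bar>X'' t * f t\<bar>) \<le> e / 2 * ((\<omega> t)\<^sup>2 / t\<^sup>2 * exp (\<psi> t))"
    proof (cases "t < 2 * \<tau>")
      case True
      have "\<bar>X'' t * f t\<bar> \<le> C / t\<^sup>2 * \<Delta>"
        unfolding abs_mult using Xb(2)[OF tp] fb[of t] t C by (intro mult_mono) auto
      moreover have "\<bar>2 * X' t * D1 T0 c t\<bar> \<le> 2 * (C / t) * (\<omega> t / t)"
        unfolding abs_mult using Xb(1)[OF tp] c1(1)[OF t] t C by (intro mult_mono) auto
      ultimately have "(1 - e) * (\<bar>2 * X' t * D1 T0 c t\<bar> + \<bar>X'' t * f t\<bar>)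
          \<le> 1 * (2 * (C / t) * (\<omega> t / t) + C / t\<^sup>2 * \<Delta>)" using e by (intro mult_mono) auto
      also have "\<dots> = (2 * C * \<omega> t + C * \<Delta>) / t\<^sup>2"
        using tp by (simp add: power2_eq_square add_divide_distrib)
      also have "\<dots> \<le> e / 2 * ((\<omega> t)\<^sup>2 * exp (\<psi> t)) / t\<^sup>2"
        using cross(2)[OF tp True] tp by (intro divide_right_mono) auto
      finally show ?thesis by simp
    next
      case False then show ?thesis using Xr(2,3)[of t] e by simp
    qed
    have "\<bar>b'' t\<bar> = (1 - e) * \<bar>(1 - X t) * D2 T0 c t - 2 * X' t * D1 T0 c t - X'' t * f t\<bar>"
      using e by (simp add: b''_def abs_mult)
    also have "\<dots> \<le> (1 - e) * (\<bar>(1 - X t) * D2 T0 c t\<bar> + (\<bar>2 * X' t * D1 T0 c t\<bar> + \<bar>X'' t * f t\<bar>))"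
      using e by (intro mult_left_mono) auto
    also have "\<dots> \<le> (1 - e) * ((\<omega> t)\<^sup>2 / t\<^sup>2 * exp (\<psi> t)) + e / 2 * ((\<omega> t)\<^sup>2 / t\<^sup>2 * exp (\<psi> t))"
      using 1 2 unfolding distrib_left[of "1 - e" "\<bar>(1 - X t) * D2 T0 c t\<bar>"] by linarith
    also have "\<dots> = (1 - e / 2) * ((\<omega> t)\<^sup>2 / t\<^sup>2 * exp (\<psi> t))" by (rule split)
    finally show ?thesis .
  qed
  have half: "(1 - e / 2) * x \<le> x" if "x \<ge> 0" for x using mult_right_mono[of "1 - e / 2" 1 x] that e by simp
  show ?thesis
  proof (rule that[of "e / 2" "e * \<Delta> / 2" \<tau> b b' b'' c0])
    show "0 < e / 2" "0 < e * \<Delta> / 2" using e(1) \<Delta> by simp_all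
    show "0 < \<tau>" "\<tau> \<le> T0" "2 * \<tau> \<le> \<epsilon>" using tau(1-3) by linarith+
    show "continuous_on {0..T0} b"
    proof -
      have "continuous_on UNIV cutoff" by (rule DERIV_continuous_on[OF cutoff_derivs(1)])
      moreover have "continuous_on {0..T0} (\<lambda>t. t / \<tau>)" using tau(1) by (intro continuous_intros) simp
      ultimately have "continuous_on {0..T0} X"
        unfolding X_def[abs_def] by (rule continuous_on_compose2) simp
      then show ?thesis unfolding b_alt[abs_def] using cc by (intro continuous_intros)
    qed
    show "C2_derivs T0 b b' b''" by (rule bd)
    show "\<mu>1 + e * \<Delta> / 2 \<le> b t \<and> b t \<le> \<mu>2 - e * \<Delta> / 2" if t: "t \<in> {0..T0}" for t
    proof -
      have "(1 - X t) * \<mu>1 + X t * \<mu>1 \<le> (1 - X t) * c t + X t * c 0"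
        "(1 - X t) * c t + X t * c 0 \<le> (1 - X t) * \<mu>2 + X t * \<mu>2"
        using cr[OF t] cr[of 0] T0 X[of t] by (auto intro!: add_mono mult_left_mono)
      then have "\<mu>1 \<le> (1 - X t) * c t + X t * c 0" "(1 - X t) * c t + X t * c 0 \<le> \<mu>2"
        by (simp_all add: algebra_simps)
      then have "(1 - e) * \<mu>1 + e * m \<le> b t" "b t \<le> (1 - e) * \<mu>2 + e * m"
        unfolding b_alt using e by (auto intro!: mult_left_mono)
      then show ?thesis by (simp add: m_def \<Delta>_def field_simps)
    qed
    show "\<bar>b' t\<bar> \<le> (1 - e / 2) * (\<omega> t / t)"
      "\<bar>b'' t\<bar> \<le> (1 - e / 2) * ((\<omega> t)\<^sup>2 / t\<^sup>2 * exp (\<psi> t))" if "t \<in> {0<..T0}" for t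
      using b'_le b''_le that by auto
    show "b t = c0" if "t \<in> {0..\<tau>}" for t using that Xl(1)[of t] by (simp add: b_def)
    show "b' t = 0 \<and> b'' t = 0" if "t \<in> {0<..\<tau>}" for t
      using that Xl[of t] by (simp add: b'_def b''_def)
    show "\<bar>b t - c t\<bar> \<le> \<epsilon>" if t: "t \<in> {0..T0}" for t
    proof -
      have "b t - c t = e * (m - c t) - (1 - e) * (X t * f t)"
        by (simp add: b_alt f_def algebra_simps)
      moreover have "\<bar>e * (m - c t)\<bar> \<le> \<epsilon> / 2"
      proof -
        have "\<bar>m - c t\<bar> \<le> \<Delta>" using cr[OF t] \<Delta> by (auto simp: m_def \<Delta>_def abs_le_iff field_simps)
        then have "e * \<bar>m - c t\<bar> \<le> e * \<Delta>" using e by (intro mult_left_mono) auto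
        moreover have "\<bar>e * (m - c t)\<bar> = e * \<bar>m - c t\<bar>" using e(1) by (simp add: abs_mult)
        ultimately show ?thesis using eD(1) by linarith
      qed
      moreover have "\<bar>(1 - e) * (X t * f t)\<bar> \<le> \<epsilon> / 2"
      proof (cases "t < 2 * \<tau>")
        case True
        have "\<bar>f t\<bar> \<le> \<epsilon> / 2" using d1(2)[OF t] True tau by (simp add: f_def)
        then have "\<bar>(1 - e) * (X t * f t)\<bar> \<le> 1 * (1 * (\<epsilon> / 2))"
          unfolding abs_mult using e X[of t] by (intro mult_mono) auto
        then show ?thesis by simp
      next
        case False then show ?thesis using Xr(1)[of t] eps by simp
      qed
      ultimately show ?thesis by linarith
    qed
    fix t assume t: "t \<in> {0<..T0}"
    then have tp: "t > 0" "t \<le> T0" by auto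
    have opos: "0 \<le> \<omega> t / t" "0 \<le> (\<omega> t)\<^sup>2 / t\<^sup>2 * exp (\<psi> t)" using om1[OF t] tp by auto
    show "t\<^sup>2 / \<omega> t * \<bar>b' t - D1 T0 c t\<bar> \<le> \<epsilon>"
    proof (cases "t < 2 * \<tau>")
      case True
      have "t\<^sup>2 / \<omega> t * \<bar>b' t - D1 T0 c t\<bar> \<le> 2 * t"
        by (rule weighted_deriv_diff_le[OF tp(1) om1[OF t] order_trans[OF b'_le[OF t] half[OF opos(1)]] c1(1)[OF t]])
      then show ?thesis using True tau by linarith
    next
      case False
      then have "\<bar>b' t - D1 T0 c t\<bar> = e * \<bar>D1 T0 c t\<bar>"
        using Xr[of t] e by (simp add: b'_def algebra_simps abs_mult)
      then have "t\<^sup>2 / \<omega> t * \<bar>b' t - D1 T0 c t\<bar> \<le> t\<^sup>2 / \<omega> t * (e * (\<omega> t / t))"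
        using c1(1)[OF t] e(1) om1[OF t] by (simp only:) (intro mult_left_mono; simp)
      also have "\<dots> = e * t" using om1[OF t] tp by (simp add: power2_eq_square)
      also have "\<dots> \<le> e * T0" using e tp by simp
      finally show ?thesis using eD by linarith
    qed
    show "t ^ 3 * exp (- \<psi> t) / (\<omega> t)\<^sup>2 * \<bar>b'' t - D2 T0 c t\<bar> \<le> \<epsilon>"
    proof (cases "t < 2 * \<tau>")
      case True
      have "t ^ 3 * exp (- \<psi> t) / (\<omega> t)\<^sup>2 * \<bar>b'' t - D2 T0 c t\<bar> \<le> 2 * t"
        by (rule weighted_deriv2_diff_le[OF tp(1) om1[OF t] order_trans[OF b''_le[OF t] half[OF opos(2)]] c1(2)[OF t]])
      then show ?thesis using True tau by linarith
    next
      case False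
      then have "\<bar>b'' t - D2 T0 c t\<bar> = e * \<bar>D2 T0 c t\<bar>"
        using Xr[of t] e by (simp add: b''_def algebra_simps abs_mult)
      then have "t ^ 3 * exp (- \<psi> t) / (\<omega> t)\<^sup>2 * \<bar>b'' t - D2 T0 c t\<bar>
          \<le> t ^ 3 * exp (- \<psi> t) / (\<omega> t)\<^sup>2 * (e * ((\<omega> t)\<^sup>2 / t\<^sup>2 * exp (\<psi> t)))"
        using c1(2)[OF t] e(1) om1[OF t] tp(1) by (simp only:) (intro mult_left_mono; simp)
      also have "\<dots> = e * t"
        using om1[OF t] tp by (simp add: field_simps power2_eq_square power3_eq_cube exp_minus)
      also have "\<dots> \<le> e * T0" using e tp by simp
      finally show ?thesis using eD by linarith
    qed
  qed
qed

end

section \<open>Density of amplifying speeds\<close>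

context propagation_speeds
begin

text \<open>The resonant modulation, scaled to frequency \<open>\<nu> = sqrt (l c0)\<close> and cut off after time \<open>s\<close>, is added
  to a flattened speed. The conditions of \<open>resonance_window\<close> are those under which the modulation fits into the margin
  \<open>\<eta>\<close> left by the flattening. The threshold for \<open>l\<close> depends on \<open>c\<close>, \<open>\<epsilon>\<close>, \<open>\<delta>\<close> and \<open>k\<close> only, so
  \<open>l\<close> can be taken from any unbounded sequence.\<close>

lemma amplifying_speeds_dense:
  fixes k :: nat
  assumes c: "c \<in> \<P>" and eps: "\<epsilon> > 0" and del: "\<delta> > 0"
  shows "\<exists>l0. \<forall>l\<ge>l0. \<exists>d\<in>\<P>. dist_PS2 T0 \<mu>1 \<mu>2 \<omega> \<psi> c d \<le> 6 * \<epsilon> \<and>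
    (\<exists>w v. oscillator T0 (\<lambda>t. l * d t) w v \<and> w 0 = 0 \<and> v 0 = 1 \<and>
       (\<forall>t\<in>{\<delta>..T0}. (1 + l) ^ k < norm (w t, v t)))"
proof -
  obtain \<eta> h \<tau> b b' b'' c0 where flat:
    "0 < \<eta>" "0 < h" "0 < \<tau>" "\<tau> \<le> T0" "2 * \<tau> \<le> \<epsilon>"
    and b: "continuous_on {0..T0} b" "C2_derivs T0 b b' b''"
    and br: "\<And>t. t \<in> {0..T0} \<Longrightarrow> \<mu>1 + h \<le> b t \<and> b t \<le> \<mu>2 - h"
    and b'_le: "\<And>t. t \<in> {0<..T0} \<Longrightarrow> \<bar>b' t\<bar> \<le> (1 - \<eta>) * (\<omega> t / t)"
    and b''_le: "\<And>t. t \<in> {0<..T0} \<Longrightarrow> \<bar>b'' t\<bar> \<le> (1 - \<eta>) * ((\<omega> t)\<^sup>2 / t\<^sup>2 * exp (\<psi> t))"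
    and b_const: "\<And>t. t \<in> {0..\<tau>} \<Longrightarrow> b t = c0" "\<And>t. t \<in> {0<..\<tau>} \<Longrightarrow> b' t = 0 \<and> b'' t = 0"
    and b_close: "\<And>t. t \<in> {0..T0} \<Longrightarrow> \<bar>b t - c t\<bar> \<le> \<epsilon>"
      "\<And>t. t \<in> {0<..T0} \<Longrightarrow> t\<^sup>2 / \<omega> t * \<bar>b' t - D1 T0 c t\<bar> \<le> \<epsilon>"
      "\<And>t. t \<in> {0<..T0} \<Longrightarrow> t ^ 3 * exp (- \<psi> t) / (\<omega> t)\<^sup>2 * \<bar>b'' t - D2 T0 c t\<bar> \<le> \<epsilon>"
    by (rule flatten_near_origin[OF c eps], rule that, assumption+)
  obtain C where C: "C \<ge> 1" "\<And>s t. s > 0 \<Longrightarrow> t > 0 \<Longrightarrow> \<bar>cutoff' (t / s) / s\<bar> \<le> C / t"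
    "\<And>s t. s > 0 \<Longrightarrow> t > 0 \<Longrightarrow> \<bar>cutoff'' (t / s) / s\<^sup>2\<bar> \<le> C / t\<^sup>2"
    using cutoff_scale_invariant_bounds by blast
  have c0: "\<mu>1 + h \<le> c0" "c0 \<le> \<mu>2 - h" using br[of 0] b_const(1)[of 0] flat T0 by auto
  have c0p: "0 < c0" "\<mu>1 \<le> c0" "c0 \<le> \<mu>2" using c0 flat mu1 by auto
  have mu2: "\<mu>2 > 0" using mu1 mu12 by simp
  \<comment> \<open>\<open>B\<close> bounds the size of the modulation by the margin \<open>h\<close> of the range and by \<open>\<epsilon>\<close>; \<open>A\<close> collects
    the constants in the bounds on its derivatives, and \<open>\<kappa>\<close> fits these into the margin \<open>\<eta>\<close>\<close>
  define B where "B = max 2 (3 * \<mu>2 / min h \<epsilon>)"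
  have B: "B \<ge> 2" by (simp add: B_def)
  have B_small: "3 * \<mu>2 / B \<le> min h \<epsilon>"
  proof -
    have swap: "x / y \<le> g" if "x / g \<le> y" "g > 0" "y > 0" for x y g :: real
      using that by (simp add: field_simps)
    show ?thesis by (rule swap) (use flat(2) eps B in \<open>simp_all add: B_def\<close>)
  qed
  define A where "A = 68 * \<mu>2 * C"
  have A: "A > 0" using mu2 C(1) by (simp add: A_def)
  define \<kappa> where "\<kappa> = min 1 (\<eta> / (2 * A))"
  have kap: "\<kappa> > 0" "\<kappa> \<le> 1" "A * \<kappa> \<le> \<eta> / 2"
  proof -
    show "\<kappa> > 0" "\<kappa> \<le> 1" using flat A by (auto simp: \<kappa>_def)
    have "A * \<kappa> \<le> A * (\<eta> / (2 * A))" unfolding \<kappa>_def using A by (intro mult_left_mono) auto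
    then show "A * \<kappa> \<le> \<eta> / 2" using A by simp
  qed
  \<comment> \<open>a bound for \<open>b'\<close> on all of \<open>(0,T0]\<close>, because \<open>b\<close> is constant up to \<open>\<tau>\<close>; it does not involve \<open>l\<close>\<close>
  define P where "P = \<omega> \<tau> / \<tau>"
  have om: "\<omega> t > 0" if "t \<in> {0<..T0}" for t using omega_pos that by blast
  have P: "P \<ge> 0" using om[of \<tau>] flat by (simp add: P_def)
  have b'P: "\<bar>b' t\<bar> \<le> P" if t: "t \<in> {0<..T0}" for t
  proof (cases "t \<le> \<tau>")
    case True then show ?thesis using b_const(2)[of t] t P by simp
  next
    case False
    have "\<bar>b' t\<bar> \<le> 1 * (\<omega> t / t)"
      using b'_le[OF t] mult_right_mono[of "1 - \<eta>" 1 "\<omega> t / t"] flat om[OF t] t by auto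
    also have "\<dots> \<le> P"
      using False t flat om[OF t] omega_antimono[of \<tau> t] unfolding P_def mult_1
      by (intro frac_le) auto
    finally show ?thesis .
  qed
  define Z where "Z = 2 * real k * ln (1 + 1 / \<mu>1) + ln (1 + \<mu>2 / \<mu>1) + 1 / 2 + ln 2 + ln (\<mu>2 / \<mu>1) + P * T0 / \<mu>1"
  have Z: "Z \<ge> 0"
    unfolding Z_def using mu1 mu2 mu12 P T0 by (intro add_nonneg_nonneg mult_nonneg_nonneg) auto
  obtain \<nu>0 where nu0: "\<And>\<nu>. \<nu> \<ge> \<nu>0 \<Longrightarrow> \<exists>s K. 0 < s \<and> 2 * s \<le> min \<tau> \<delta> \<and> 2 * s \<le> T0 \<and> 1 \<le> K \<and>
      K \<le> \<kappa> * \<omega> (2 * s) \<and> \<nu> \<le> \<omega> (2 * s) * exp (\<psi> (2 * s)) / (2 * s) \<and>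
      (4 * real k + 2) * ln \<nu> + Z \<le> K * (ln (\<nu> * s / K) - (ln B + A / \<mu>1))"
    using resonance_window[OF T0 omega_pos psi_pos omega_mono psi_mono omega_lim omega_psi_lim kap(1),
        of "min \<tau> \<delta>" "4 * real k + 2" Z "ln B + A / \<mu>1"] flat del Z by auto
  show ?thesis
  proof (rule exI[of _ "(max \<nu>0 1)\<^sup>2 / \<mu>1"], intro allI impI)
    fix l assume l: "(max \<nu>0 1)\<^sup>2 / \<mu>1 \<le> l"
    define \<nu> where "\<nu> = sqrt (l * c0)"
    have "(max \<nu>0 1)\<^sup>2 \<le> l * \<mu>1" using l mu1 by (simp add: pos_divide_le_eq)
    moreover have "1\<^sup>2 \<le> (max \<nu>0 1)\<^sup>2" by (intro power_mono) auto
    ultimately have lp: "l > 0" using mu1 by (smt (verit) mult_nonpos_nonneg one_power2)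
    have "(max \<nu>0 1)\<^sup>2 \<le> l * c0"
      using \<open>(max \<nu>0 1)\<^sup>2 \<le> l * \<mu>1\<close> mult_left_mono[OF c0p(2), of l] lp by linarith
    then have "max \<nu>0 1 \<le> \<nu>" unfolding \<nu>_def by (rule real_le_rsqrt)
    then have nu: "\<nu> \<ge> \<nu>0" "\<nu> \<ge> 1" by auto
    have nu_l: "\<nu>\<^sup>2 = l * c0" using lp c0p by (simp add: \<nu>_def)
    obtain s K where s: "0 < s" "2 * s \<le> \<tau>" "2 * s \<le> \<delta>" "2 * s \<le> T0" and K: "1 \<le> K" "K \<le> \<kappa> * \<omega> (2 * s)"
      and window: "\<nu> \<le> \<omega> (2 * s) * exp (\<psi> (2 * s)) / (2 * s)"
      and gain: "(4 * real k + 2) * ln \<nu> + Z \<le> K * (ln (\<nu> * s / K) - (ln B + A / \<mu>1))"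
      using nu0[OF nu(1)] by auto
    define X where "X t = cutoff (t / s)" for t
    define X' where "X' t = cutoff' (t / s) / s" for t
    define X'' where "X'' t = cutoff'' (t / s) / s\<^sup>2" for t
    have X: "0 \<le> X t" "X t \<le> 1" for t by (auto simp: X_def cutoff_range)
    have Xl: "X t = 1" if "t \<le> s" for t
      using that s cutoff_left[of "t / s"] by (auto simp: X_def)
    have Xr: "X t = 0" "X' t = 0" "X'' t = 0" if "2 * s \<le> t" for t
      using that s cutoff_right[of "t / s"] by (auto simp: X_def X'_def X''_def pos_le_divide_eq)
    have Xb: "\<bar>X' t\<bar> \<le> C / t" "\<bar>X'' t\<bar> \<le> C / t\<^sup>2" if "t > 0" for t
      using C(2,3)[OF s(1) that] by (auto simp: X'_def X''_def)
    have Xd: "C2_derivs T0 X X' X''"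
      unfolding X_def[abs_def] X'_def[abs_def] X''_def[abs_def] by (rule C2_derivs_cutoff[OF s(1)])
    \<comment> \<open>up to time \<open>s\<close> the speed will be \<open>c0 (1 - profile)\<close>; the factor \<open>c0\<close> turns \<open>l\<close> into \<open>\<nu>\<^sup>2\<close>\<close>
    define q where "q t = - c0 * profile K B (\<nu> * t)" for t
    define q' where "q' t = - c0 * (profile' K B (\<nu> * t) * \<nu>)" for t
    define q'' where "q'' t = - c0 * (profile'' K B (\<nu> * t) * \<nu> * \<nu>)" for t
    have qd: "C2_derivs T0 q q' q''"
    proof (rule C2_derivsI)
      fix t assume "t \<in> {0<..T0}"
      then have x: "\<nu> * t \<ge> 0" using nu by simp
      have d: "((\<lambda>t. \<nu> * t) has_real_derivative \<nu>) (at t)" by (auto intro!: derivative_eq_intros)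
      show "(q has_real_derivative q' t) (at t)"
        unfolding q_def[abs_def] q'_def
        by (rule DERIV_cmult[OF DERIV_chain2[OF profile_deriv[OF K(1) B x] d]])
      show "(q' has_real_derivative q'' t) (at t)"
        unfolding q'_def[abs_def] q''_def
        by (rule DERIV_cmult[OF DERIV_cmult_right[OF DERIV_chain2[OF profile'_deriv[OF K(1) B x] d]]])
    next
      have "continuous_on {0<..T0} (\<lambda>t. profile'' K B (\<nu> * t))"
        by (rule continuous_on_compose2[OF profile''_continuous_on[OF K(1) B]])
          (use nu in \<open>auto intro!: continuous_intros\<close>)
      then show "continuous_on {0<..T0} q''"
        unfolding q''_def[abs_def] by (intro continuous_intros)
    qed
    have q0: "\<bar>q t\<bar> \<le> min h \<epsilon>" "\<bar>q t\<bar> \<le> 2 * \<mu>2" if "t \<ge> 0" for t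
    proof -
      have x: "\<nu> * t \<ge> 0" using that nu by simp
      have "\<bar>q t\<bar> = c0 * \<bar>profile K B (\<nu> * t)\<bar>" using c0p by (simp add: q_def abs_mult)
      also have "\<dots> \<le> \<mu>2 * (3 * (1 / B))"
        using profile_bounds(1)[OF K(1) B x] gain_rate_le[OF K(1) B x] c0p mu2
        by (intro mult_mono) auto
      finally have 1: "\<bar>q t\<bar> \<le> 3 * \<mu>2 / B" by (simp add: mult.commute)
      then show "\<bar>q t\<bar> \<le> min h \<epsilon>" using B_small by linarith
      have "3 * \<mu>2 / B \<le> 3 * \<mu>2 / 2" using B mu2 by (intro divide_left_mono) auto
      then show "\<bar>q t\<bar> \<le> 2 * \<mu>2" using 1 mu2 by linarith
    qed
    have q1: "\<bar>q' t\<bar> \<le> 14 * \<mu>2 * K / t" "\<bar>q'' t\<bar> \<le> 68 * \<mu>2 * K * \<nu> / t" if t: "t > 0" for t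
    proof -
      have x: "\<nu> * t > 0" using t nu by simp
      then have x0: "\<nu> * t \<ge> 0" by simp
      note d = gain_rate_le_divide[OF K(1) B x]
      have "\<bar>q' t\<bar> = c0 * (\<bar>profile' K B (\<nu> * t)\<bar> * \<nu>)" using c0p nu by (simp add: q'_def abs_mult)
      also have "\<dots> \<le> \<mu>2 * ((14 * (K / (\<nu> * t))) * \<nu>)"
        using profile_bounds(2)[OF K(1) B x0] d c0p mu2 nu K t
        by (intro mult_mono mult_nonneg_nonneg) auto
      also have "\<dots> = 14 * \<mu>2 * K / t" using nu by simp
      finally show "\<bar>q' t\<bar> \<le> 14 * \<mu>2 * K / t" .
      have "\<bar>q'' t\<bar> = c0 * (\<bar>profile'' K B (\<nu> * t)\<bar> * \<nu> * \<nu>)" using c0p nu by (simp add: q''_def abs_mult)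
      also have "\<dots> \<le> \<mu>2 * ((68 * (K / (\<nu> * t))) * \<nu> * \<nu>)"
        using profile_bounds(3)[OF K(1) B x0] d c0p mu2 nu K t
        by (intro mult_mono mult_nonneg_nonneg) auto
      also have "\<dots> = 68 * \<mu>2 * K * \<nu> / t" using nu by simp
      finally show "\<bar>q'' t\<bar> \<le> 68 * \<mu>2 * K * \<nu> / t" .
    qed
    define p' where "p' t = X' t * q t + X t * q' t" for t
    define p'' where "p'' t = X'' t * q t + 2 * (X' t * q' t) + X t * q'' t" for t
    define f where "f t = b t + X t * q t" for t
    define f' where "f' t = b' t + p' t" for t
    define f'' where "f'' t = b'' t + p'' t" for t
    have fd: "C2_derivs T0 f f' f''"
      unfolding f_def[abs_def] f'_def[abs_def] f''_def[abs_def] p'_def p''_def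
      by (rule C2_derivs_add[OF b(2) C2_derivs_mult[OF Xd qd]])
    have p'_le: "\<bar>p' t\<bar> \<le> A * K / t" if t: "t > 0" for t
    proof -
      have "\<bar>X' t * q t\<bar> \<le> C / t * (2 * \<mu>2)"
        unfolding abs_mult using Xb(1)[OF t] q0(2)[of t] t C by (intro mult_mono) auto
      moreover have "\<bar>X t * q' t\<bar> \<le> 1 * (14 * \<mu>2 * K / t)"
        unfolding abs_mult using X[of t] q1(1)[OF t] by (intro mult_mono) auto
      ultimately have "\<bar>p' t\<bar> \<le> C / t * (2 * \<mu>2) + 14 * \<mu>2 * K / t"
        unfolding p'_def by linarith
      also have "\<dots> = (2 * (C * 1) + 14 * (1 * K)) * (\<mu>2 / t)"
        by (simp add: algebra_simps add_divide_distrib)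
      also have "\<dots> \<le> (2 * (C * K) + 14 * (C * K)) * (\<mu>2 / t)"
        using C(1) K(1) mu2 t by (intro mult_right_mono add_mono mult_left_mono mult_mono) auto
      also have "\<dots> \<le> 68 * (C * K) * (\<mu>2 / t)"
        using C(1) K(1) mu2 t by (intro mult_right_mono) auto
      also have "\<dots> = A * K / t" by (simp add: A_def)
      finally show ?thesis .
    qed
    have p''_le: "\<bar>p'' t\<bar> \<le> A * K / t\<^sup>2 + A * K * \<nu> / t" if t: "t > 0" for t
    proof -
      have "\<bar>X'' t * q t\<bar> \<le> C / t\<^sup>2 * (2 * \<mu>2)"
        unfolding abs_mult using Xb(2)[OF t] q0(2)[of t] t C by (intro mult_mono) auto
      moreover have "\<bar>X' t * q' t\<bar> \<le> C / t * (14 * \<mu>2 * K / t)"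
        unfolding abs_mult using Xb(1)[OF t] q1(1)[OF t] t C by (intro mult_mono) auto
      moreover have "\<bar>X t * q'' t\<bar> \<le> 1 * (68 * \<mu>2 * K * \<nu> / t)"
        unfolding abs_mult using X[of t] q1(2)[OF t] by (intro mult_mono) auto
      ultimately have "\<bar>p'' t\<bar> \<le> C / t\<^sup>2 * (2 * \<mu>2) + 2 * (C / t * (14 * \<mu>2 * K / t)) + 68 * \<mu>2 * K * \<nu> / t"
        unfolding p''_def by linarith
      also have "\<dots> = (2 * (C * 1) + 28 * (C * K)) * (\<mu>2 / t\<^sup>2) + 68 * \<mu>2 * 1 * (K * \<nu> / t)"
        by (simp add: algebra_simps power2_eq_square add_divide_distrib)
      also have "\<dots> \<le> (68 * (C * K)) * (\<mu>2 / t\<^sup>2) + 68 * \<mu>2 * C * (K * \<nu> / t)"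
      proof (intro add_mono mult_right_mono)
        have "C * 1 \<le> C * K" using C(1) K(1) by (intro mult_left_mono) auto
        moreover have "0 \<le> C * K" using C(1) K(1) by simp
        ultimately show "2 * (C * 1) + 28 * (C * K) \<le> 68 * (C * K)" by linarith
        show "68 * \<mu>2 * 1 \<le> 68 * \<mu>2 * C" using C(1) mu2 by (intro mult_left_mono) auto
      qed (use K nu t mu2 in auto)
      also have "\<dots> = A * K / t\<^sup>2 + A * K * \<nu> / t" by (simp add: A_def mult_ac)
      finally show ?thesis .
    qed
    have AK: "A * K \<le> \<eta> / 2 * \<omega> t" "1 \<le> \<omega> t" "\<nu> \<le> \<omega> t * exp (\<psi> t) / t" if t: "0 < t" "t \<le> 2 * s" for t
    proof -
      have mon: "\<omega> (2 * s) \<le> \<omega> t" "\<psi> (2 * s) \<le> \<psi> t"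
        using omega_antimono[of t "2 * s"] psi_antimono[of t "2 * s"] t s by auto
      have os: "0 < \<omega> (2 * s)" "0 < \<omega> t" using om s t by auto
      have "A * K \<le> A * (\<kappa> * \<omega> (2 * s))" using K A by (intro mult_left_mono) auto
      also have "\<dots> = (A * \<kappa>) * \<omega> (2 * s)" by simp
      also have "\<dots> \<le> \<eta> / 2 * \<omega> t" using kap mon os flat by (intro mult_mono) auto
      finally show "A * K \<le> \<eta> / 2 * \<omega> t" .
      have "1 \<le> \<kappa> * \<omega> (2 * s)" using K by linarith
      also have "\<dots> \<le> 1 * \<omega> t" using kap mon os by (intro mult_mono) auto
      finally show "1 \<le> \<omega> t" by simp
      have "\<omega> (2 * s) * exp (\<psi> (2 * s)) / (2 * s) \<le> \<omega> t * exp (\<psi> t) / t"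
        using mon os t by (intro frac_le mult_mono) auto
      then show "\<nu> \<le> \<omega> t * exp (\<psi> t) / t" using window by linarith
    qed
    have p'_margin: "\<bar>p' t\<bar> \<le> \<eta> * (\<omega> t / t)" if t: "t \<in> {0<..T0}" for t
    proof (cases "t \<le> 2 * s")
      case True
      have "\<bar>p' t\<bar> \<le> A * K / t" using p'_le t by simp
      also have "\<dots> \<le> \<eta> * \<omega> t / t"
      proof (rule divide_right_mono)
        have "0 \<le> \<eta> / 2 * \<omega> t" using flat om[OF t] by simp
        then show "A * K \<le> \<eta> * \<omega> t" using AK(1)[of t] t True by simp
      qed (use t in auto)
      finally show ?thesis by simp
    next
      case False then show ?thesis using Xr[of t] flat om[OF t] t by (simp add: p'_def)
    qed
    have p''_margin: "\<bar>p'' t\<bar> \<le> \<eta> * ((\<omega> t)\<^sup>2 / t\<^sup>2 * exp (\<psi> t))" if t: "t \<in> {0<..T0}" for t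
    proof (cases "t \<le> 2 * s")
      case True
      have tp: "t > 0" using t by simp
      note ak = AK[OF tp True]
      have psi: "1 \<le> exp (\<psi> t)" using psi_pos t by (auto intro: less_imp_le)
      have combine: "x / t\<^sup>2 + x * \<nu> / t \<le> g * y / t\<^sup>2 + g * z / t"
        if "0 \<le> x" "x \<le> g" "1 \<le> y" "\<nu> \<le> z" for x g y z
      proof -
        have "x * 1 \<le> g * y" "x * \<nu> \<le> g * z" using that nu by (intro mult_mono; simp)+
        then show ?thesis using tp by (intro add_mono divide_right_mono) auto
      qed
      have "1 \<le> \<omega> t * exp (\<psi> t)" using mult_mono[OF ak(2) psi] ak(2) by simp
      then have "A * K / t\<^sup>2 + A * K * \<nu> / t \<le> (\<eta> / 2 * \<omega> t) * (\<omega> t * exp (\<psi> t)) / t\<^sup>2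
          + (\<eta> / 2 * \<omega> t) * (\<omega> t * exp (\<psi> t) / t) / t"
        using A K by (intro combine ak) auto
      also have "\<dots> = \<eta> * ((\<omega> t)\<^sup>2 / t\<^sup>2 * exp (\<psi> t))"
        using tp by (simp add: power2_eq_square)
      finally show ?thesis using p''_le[OF tp] by linarith
    next
      case False then show ?thesis using Xr[of t] flat om[OF t] t by (simp add: p''_def)
    qed
    have whole: "(1 - \<eta>) * x + \<eta> * x = x" for x :: real by (simp add: algebra_simps)
    have f'_le: "\<bar>f' t\<bar> \<le> \<omega> t / t" if "t \<in> {0<..T0}" for t
      using b'_le[OF that] p'_margin[OF that] whole[of "\<omega> t / t"] unfolding f'_def by linarith
    have f''_le: "\<bar>f'' t\<bar> \<le> (\<omega> t)\<^sup>2 / t\<^sup>2 * exp (\<psi> t)" if "t \<in> {0<..T0}" for t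
      using b''_le[OF that] p''_margin[OF that] whole[of "(\<omega> t)\<^sup>2 / t\<^sup>2 * exp (\<psi> t)"]
      unfolding f''_def by linarith
    have Xq: "\<bar>X t * q t\<bar> \<le> min h \<epsilon>" if "t \<in> {0..T0}" for t
    proof -
      have "\<bar>X t * q t\<bar> \<le> 1 * min h \<epsilon>"
        unfolding abs_mult using X[of t] q0(1)[of t] that by (intro mult_mono) auto
      then show ?thesis by simp
    qed
    have fr: "\<mu>1 \<le> f t \<and> f t \<le> \<mu>2" if "t \<in> {0..T0}" for t
      using br[OF that] Xq[OF that] unfolding f_def by linarith
    have fc: "continuous_on {0..T0} f"
    proof -
      have 1: "continuous_on UNIV cutoff" by (rule DERIV_continuous_on[OF cutoff_derivs(1)])
      have "continuous_on {0..T0} (\<lambda>t. t / s)" using s by (intro continuous_intros) simp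
      with 1 have "continuous_on {0..T0} X"
        unfolding X_def[abs_def] by (rule continuous_on_compose2) simp
      moreover have 2: "continuous_on {0..} (profile K B)"
        by (rule DERIV_continuous_on[OF has_field_derivative_at_within[OF profile_deriv[OF K(1) B]]]) simp
      have "continuous_on {0..T0} (\<lambda>t. profile K B (\<nu> * t))"
        by (rule continuous_on_compose2[OF 2]) (use nu in \<open>auto intro!: continuous_intros\<close>)
      ultimately show ?thesis unfolding f_def[abs_def] q_def using b(1) by (intro continuous_intros)
    qed
    define d where "d = restrict f {0..T0}"
    have "\<mu>1 \<le> f t \<and> f t \<le> \<mu>2" if "t \<in> {0<..<T0}" for t by (rule fr) (use that in simp)
    note speed = PS2I[OF fc fd this f'_le f''_le]
    have d_in: "d \<in> \<P>" and d1: "\<And>t. t \<in> {0<..T0} \<Longrightarrow> D1 T0 d t = f' t"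
      and d2: "\<And>t. t \<in> {0<..T0} \<Longrightarrow> D2 T0 d t = f'' t"
      unfolding d_def using speed by simp_all
    have far: "f' t = b' t" "f'' t = b'' t" if "2 * s \<le> t" for t
      using Xr[OF that] by (simp_all add: f'_def f''_def p'_def p''_def)
    have cD: "\<bar>D1 T0 c t\<bar> \<le> \<omega> t / t" "\<bar>D2 T0 c t\<bar> \<le> (\<omega> t)\<^sup>2 / t\<^sup>2 * exp (\<psi> t)"
      if "t \<in> {0<..T0}" for t using c that by (auto simp: PS2_def)
    have "dist_PS2 T0 \<mu>1 \<mu>2 \<omega> \<psi> c d \<le> 3 * (2 * \<epsilon>)"
    proof (rule dist_PS2_le[OF T0 c d_in])
      fix t assume "t \<in> {0<..<T0}"
      then have t: "t \<in> {0<..T0}" "t \<in> {0..T0}" "t > 0" by auto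
      have "\<bar>c t - d t\<bar> = \<bar>(b t - c t) + X t * q t\<bar>" using t by (simp add: d_def f_def)
      then show "\<bar>c t - d t\<bar> \<le> 2 * \<epsilon>" using b_close(1)[OF t(2)] Xq[OF t(2)] by linarith
      show "t\<^sup>2 / \<omega> t * \<bar>D1 T0 c t - D1 T0 d t\<bar> \<le> 2 * \<epsilon>"
      proof (cases "t \<le> 2 * s")
        \<comment> \<open>here \<open>2 t \<le> 2 \<tau> \<le> \<epsilon>\<close>, so admissibility alone is enough\<close>
        case True
        have "t\<^sup>2 / \<omega> t * \<bar>D1 T0 c t - f' t\<bar> \<le> 2 * t"
          by (rule weighted_deriv_diff_le[OF t(3) om[OF t(1)] cD(1)[OF t(1)] f'_le[OF t(1)]])
        then show ?thesis using True s flat eps d1[OF t(1)] by simp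
      next
        case False
        then show ?thesis using b_close(2)[OF t(1)] d1[OF t(1)] far[of t] eps
          by (simp add: abs_minus_commute)
      qed
      show "t ^ 3 * exp (- \<psi> t) / (\<omega> t)\<^sup>2 * \<bar>D2 T0 c t - D2 T0 d t\<bar> \<le> 2 * \<epsilon>"
      proof (cases "t \<le> 2 * s")
        case True
        have "t ^ 3 * exp (- \<psi> t) / (\<omega> t)\<^sup>2 * \<bar>D2 T0 c t - f'' t\<bar> \<le> 2 * t"
          by (rule weighted_deriv2_diff_le[OF t(3) om[OF t(1)] cD(2)[OF t(1)] f''_le[OF t(1)]])
        then show ?thesis using True s flat eps d2[OF t(1)] by simp
      next
        case False
        then show ?thesis using b_close(3)[OF t(1)] d2[OF t(1)] far[of t] eps
          by (simp add: abs_minus_commute)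
      qed
    qed
    moreover
    have "continuous_on {0..T0} (\<lambda>t. l * f t)" using fc by (intro continuous_intros)
    then obtain w v where wv: "oscillator T0 (\<lambda>t. l * f t) w v" "w 0 = 0" "v 0 = 1"
      using oscillator_exists T0 by (metis less_imp_le)
    have "(1 + l) ^ k < norm (w t, v t)" if t: "t \<in> {\<delta>..T0}" for t
    proof (rule resonant_growth[OF K(1) B nu(2) nu_l mu1 c0p(2,3) s(1,4) fc C2_derivs_interior[OF fd] fr _ _ _ P
            gain[unfolded Z_def] wv])
      fix t assume "t \<in> {0..s}"
      then show "f t = c0 * (1 - profile K B (\<nu> * t))"
        using Xl[of t] b_const(1)[of t] s by (simp add: f_def q_def algebra_simps)
    next
      fix t assume t: "t \<in> {s<..<2 * s}"
      then have "\<bar>f' t\<bar> \<le> A * K / t" using p'_le[of t] b_const(2)[of t] s by (simp add: f'_def)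
      also have "\<dots> \<le> A * K / s" using t s A K by (intro divide_left_mono) auto
      finally show "\<bar>f' t\<bar> \<le> A * K / s" .
    next
      fix t assume "t \<in> {2 * s<..<T0}"
      then show "\<bar>f' t\<bar> \<le> P" using far[of t] b'P[of t] s by simp
    qed (use t s in auto)
    moreover have "oscillator T0 (\<lambda>t. l * d t) w v"
      by (rule oscillator_cong[OF wv(1)]) (simp add: d_def)
    ultimately show "\<exists>d\<in>\<P>. dist_PS2 T0 \<mu>1 \<mu>2 \<omega> \<psi> c d \<le> 6 * \<epsilon> \<and>
        (\<exists>w v. oscillator T0 (\<lambda>t. l * d t) w v \<and> w 0 = 0 \<and> v 0 = 1 \<and>
          (\<forall>t\<in>{\<delta>..T0}. (1 + l) ^ k < norm (w t, v t)))"
      using d_in wv by (intro bexI[of _ d] conjI exI[of _ w] exI[of _ v]) auto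
  qed
qed

end

section \<open>Openness and residual sets\<close>

definition amplifies :: "real \<Rightarrow> real \<Rightarrow> real \<Rightarrow> real \<Rightarrow> (real \<Rightarrow> real) \<Rightarrow> bool" where
  "amplifies T \<delta> R l c \<longleftrightarrow> (\<exists>w v. oscillator T (\<lambda>t. l * c t) w v \<and> w 0 = 0 \<and> v 0 = 1 \<and>
     (\<forall>t\<in>{\<delta>..T}. R < norm (w t, v t)))"

lemma amplifies_mono:
  assumes "amplifies T \<delta> R l c" "\<delta> \<le> \<delta>'" "R' \<le> R"
  shows "amplifies T \<delta>' R' l c"
proof -
  obtain w v where "oscillator T (\<lambda>t. l * c t) w v" "w 0 = 0" "v 0 = 1"
    and "\<forall>t\<in>{\<delta>..T}. R < norm (w t, v t)"
    using assms(1) unfolding amplifies_def by blast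
  moreover have "R' < norm (w t, v t)" if "t \<in> {\<delta>'..T}" for t
    using calculation(4) that assms(2,3) by (intro le_less_trans[OF assms(3)]) auto
  ultimately show ?thesis unfolding amplifies_def by blast
qed

text \<open>On the compact interval \<open>[\<delta>,T]\<close> the solution exceeds \<open>R\<close> by a positive amount \<open>\<rho>\<close>, and the distance
  of speeds dominates the uniform distance, which controls the solutions.\<close>

lemma amplifies_open:
  assumes T: "T > 0" and om: "\<And>t. t \<in> {0<..T} \<Longrightarrow> \<omega> t > 0" and mu1: "\<mu>1 > 0"
    and c: "c \<in> PS2 T \<mu>1 \<mu>2 \<omega> \<psi>" and l: "l \<ge> 0" and del: "\<delta> \<ge> 0" and amp: "amplifies T \<delta> R l c"
  shows "\<exists>r>0. \<forall>d\<in>PS2 T \<mu>1 \<mu>2 \<omega> \<psi>. dist_PS2 T \<mu>1 \<mu>2 \<omega> \<psi> c d < r \<longrightarrow> amplifies T \<delta> R l d"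
proof -
  obtain w v where o: "oscillator T (\<lambda>t. l * c t) w v" and init: "w 0 = 0" "v 0 = 1"
    and big: "\<forall>t\<in>{\<delta>..T}. R < norm (w t, v t)"
    using amp unfolding amplifies_def by blast
  have "bounded (w ` {0..T})"
    by (rule compact_imp_bounded[OF compact_continuous_image[OF oscillator_continuous_on(1)[OF o]]]) simp
  then obtain W0 where W0: "\<And>t. t \<in> {0..T} \<Longrightarrow> \<bar>w t\<bar> \<le> W0"
    unfolding bounded_iff by (metis image_eqI real_norm_def)
  define W where "W = max W0 0"
  have W: "W \<ge> 0" "\<And>t. t \<in> {0..T} \<Longrightarrow> \<bar>w t\<bar> \<le> W" using W0 by (force simp: W_def)+
  obtain \<rho> where rho: "\<rho> > 0" "\<And>t. t \<in> {\<delta>..T} \<Longrightarrow> R + \<rho> \<le> norm (w t, v t)"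
  proof (cases "\<delta> \<le> T")
    case True
    have "continuous_on {0..T} (\<lambda>t. norm (w t, v t))"
      by (intro continuous_intros oscillator_continuous_on[OF o])
    then have "continuous_on {\<delta>..T} (\<lambda>t. norm (w t, v t))"
      by (rule continuous_on_subset) (use del in auto)
    then obtain t0 where "t0 \<in> {\<delta>..T}" "\<forall>t\<in>{\<delta>..T}. norm (w t0, v t0) \<le> norm (w t, v t)"
      using continuous_attains_inf[of "{\<delta>..T}" "\<lambda>t. norm (w t, v t)"] True by auto
    then show ?thesis using big that[of "norm (w t0, v t0) - R"] by auto
  next
    case False then show ?thesis using that[of 1] by auto
  qed
  define X where "X = exp ((2 + l * \<mu>2) * T)"
  define r where "r = \<rho> / ((1 + l * W) * (1 + X))"
  have Xp: "X > 0" by (simp add: X_def)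
  have lW: "l * W \<ge> 0" using l W by simp
  have r: "r > 0" using rho lW Xp by (simp add: r_def)
  have small: "(l * r * W)\<^sup>2 * X < \<rho>\<^sup>2"
  proof -
    have "(l * r * W)\<^sup>2 * X \<le> (l * r * W)\<^sup>2 * (1 + X)\<^sup>2"
    proof (rule mult_left_mono)
      have "(1 + X)\<^sup>2 = X + (1 + X + X\<^sup>2)" by (simp add: power2_sum)
      moreover have "0 \<le> X\<^sup>2" by simp
      ultimately show "X \<le> (1 + X)\<^sup>2" using Xp by linarith
    qed simp
    also have "\<dots> = (l * W * (r * (1 + X)))\<^sup>2" by (simp add: power_mult_distrib)
    also have "r * (1 + X) = \<rho> / (1 + l * W)" using lW Xp by (simp add: r_def)
    also have "(l * W * (\<rho> / (1 + l * W)))\<^sup>2 < \<rho>\<^sup>2"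
    proof (rule power_strict_mono)
      have "l * W * \<rho> < (1 + l * W) * \<rho>" using rho by (intro mult_strict_right_mono) auto
      then show "l * W * (\<rho> / (1 + l * W)) < \<rho>" using lW by (simp add: pos_divide_less_eq mult.commute)
    qed (use lW rho in auto)
    finally show ?thesis .
  qed
  show ?thesis
  proof (intro exI[of _ r] conjI ballI impI)
    fix d assume d: "d \<in> PS2 T \<mu>1 \<mu>2 \<omega> \<psi>" and dist: "dist_PS2 T \<mu>1 \<mu>2 \<omega> \<psi> c d < r"
    have "continuous_on {0..T} d" using d by (simp add: PS2_def)
    then have "continuous_on {0..T} (\<lambda>t. l * d t)" by (intro continuous_intros)
    then obtain w' v' where o': "oscillator T (\<lambda>t. l * d t) w' v'" and init': "w' 0 = 0" "v' 0 = 1"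
      using oscillator_exists T by (metis less_imp_le)
    have "R < norm (w' t, v' t)" if t: "t \<in> {\<delta>..T}" for t
    proof -
      have t0: "t \<in> {0..T}" using t del by auto
      have "(w' t - w t)\<^sup>2 + (v' t - v t)\<^sup>2 \<le> (l * r * W)\<^sup>2 * exp ((2 + l * \<mu>2) * t)"
      proof (rule oscillator_dependence[OF o o' _ _ _ _ _ t0])
        fix s assume s: "s \<in> {0<..<T}"
        then have s0: "s \<in> {0..T}" by auto
        have ds: "0 \<le> d s" "d s \<le> \<mu>2" using PS2_range[OF d T s0] mu1 by auto
        show "\<bar>l * d s\<bar> \<le> l * \<mu>2" using ds l by (simp add: abs_mult mult_left_mono)
        have "\<bar>c s - d s\<bar> \<le> r"
          using abs_diff_le_dist_PS2[OF T om c d s] dist by auto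
        then show "\<bar>l * c s - l * d s\<bar> \<le> l * r"
          using l by (simp add: right_diff_distrib[symmetric] abs_mult mult_left_mono)
        show "\<bar>w s\<bar> \<le> W" by (rule W(2)[OF s0])
      qed (use init init' in auto)
      also have "\<dots> \<le> (l * r * W)\<^sup>2 * X"
      proof -
        have "\<mu>1 \<le> \<mu>2" using PS2_range[OF c T t0] by linarith
        then have "(2 + l * \<mu>2) * t \<le> (2 + l * \<mu>2) * T" using l t mu1 by (intro mult_left_mono) auto
        then show ?thesis unfolding X_def by (intro mult_left_mono) auto
      qed
      also note small
      finally have "norm (w' t - w t, v' t - v t) < \<rho>"
        using rho by (simp add: norm_Pair real_less_lsqrt)
      moreover have "norm (w t, v t) \<le> norm (w' t, v' t) + norm (w' t - w t, v' t - v t)"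
        using norm_triangle_ineq4[of "(w' t, v' t)" "(w' t - w t, v' t - v t)"] by simp
      ultimately show ?thesis using rho(2)[OF t] by linarith
    qed
    then show "amplifies T \<delta> R l d" unfolding amplifies_def using o' init' by blast
  qed (rule r)
qed

lemma (in Metric_space) residual_in_of_dense_open:
  fixes G :: "nat \<Rightarrow> 'a set"
  assumes open_G: "\<And>k. openin mtopology (G k)"
    and dense: "\<And>k x r. x \<in> M \<Longrightarrow> r > 0 \<Longrightarrow> \<exists>y\<in>G k. d x y < r"
    and sub: "(\<Inter>k. G k) \<subseteq> S" "S \<subseteq> M"
  shows "residual_in mtopology S"
  unfolding residual_in_def
proof (intro conjI exI[of _ "range (\<lambda>k. M - G k)"] ballI)
  show "S \<subseteq> topspace mtopology" using sub by simp
  show "countable (range (\<lambda>k. M - G k))" by simp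
  show "topspace mtopology - S \<subseteq> \<Union> (range (\<lambda>k. M - G k))" using sub by auto
  fix F assume "F \<in> range (\<lambda>k. M - G k)"
  then obtain k where F: "F = M - G k" by blast
  show "closedin mtopology F"
    unfolding F using open_G[of k] by (simp add: closedin_def openin_subset[OF open_G, simplified] double_diff)
  have "G k \<subseteq> M" using openin_subset[OF open_G[of k]] by simp
  show "mtopology interior_of F = {}"
  proof (rule ccontr)
    assume "mtopology interior_of F \<noteq> {}"
    then obtain x r where "x \<in> M" "r > 0" "mball x r \<subseteq> F" unfolding metric_interior_of by blast
    moreover obtain y where "y \<in> G k" "d x y < r" using dense \<open>x \<in> M\<close> \<open>r > 0\<close> by blast
    moreover have "y \<in> mball x r" using calculation \<open>G k \<subseteq> M\<close> by (simp add: subset_eq)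
    ultimately show False by (auto simp: F)
  qed
qed

section \<open>From amplification to infinite derivative loss\<close>

text \<open>In the spectral representation an eigenvector lives on the level set of \<open>a\<close> at its eigenvalue.
  In particular this level set is not a null set.\<close>

lemma spectral_eigenfunction:
  assumes rep: "spectral_representation D A M a U"
    and e: "inner e e = 1" "e \<in> D" "A e = l *\<^sub>R e"
  shows "U e \<in> borel_measurable M"
    and "AE x in M. a x \<noteq> l \<longrightarrow> U e x = 0"
    and "integrable M (\<lambda>x. (U e x)\<^sup>2)" and "(LINT x|M. (U e x)\<^sup>2) = 1"
proof -
  have un: "unitary_L2 M U" and eq: "\<forall>v\<in>D. AE x in M. U (A v) x = a x * U v x"
    using rep by (auto simp: spectral_representation_def)
  have "U e \<in> L2 M" using un by (auto simp: unitary_L2_def)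
  then show "U e \<in> borel_measurable M" "integrable M (\<lambda>x. (U e x)\<^sup>2)" by (auto simp: L2_def)
  have "inner e e = (LINT x|M. U e x * U e x)" using un by (simp add: unitary_L2_def)
  then show "(LINT x|M. (U e x)\<^sup>2) = 1" using e by (simp add: power2_eq_square)
  have "AE x in M. U (A e) x = a x * U e x" using eq e by blast
  moreover have "AE x in M. U (l *\<^sub>R e) x = l * U e x" using un by (simp add: unitary_L2_def)
  ultimately show "AE x in M. a x \<noteq> l \<longrightarrow> U e x = 0" unfolding e(3) by eventually_elim auto
qed

text \<open>The level sets of distinct eigenvalues are disjoint, so a series of eigenfunctions with arbitrary
  coefficients has at each point at most one nonzero term: it converges without any assumption on the
  coefficients, and solutions can be superposed pointwise.\<close>

locale eigenfunction_series =
  fixes M :: "'x measure" and a :: "'x \<Rightarrow> real" and L :: "nat \<Rightarrow> real" and \<phi> :: "nat \<Rightarrow> 'x \<Rightarrow> real"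
  assumes a_meas [measurable]: "a \<in> borel_measurable M" and a_nonneg: "\<And>x. x \<in> space M \<Longrightarrow> a x \<ge> 0"
    and inj_L: "inj L" and L_ge: "\<And>k. L k \<ge> 1"
    and phi_meas [measurable]: "\<And>k. \<phi> k \<in> borel_measurable M"
    and phi_support: "\<And>k. AE x in M. a x \<noteq> L k \<longrightarrow> \<phi> k x = 0"
    and phi_int: "\<And>k. integrable M (\<lambda>x. (\<phi> k x)\<^sup>2)"
    and phi_norm: "\<And>k. (LINT x|M. (\<phi> k x)\<^sup>2) = 1"
begin

definition level :: "nat \<Rightarrow> 'x set" where
  "level k = {x \<in> space M. a x = L k}"

definition combination :: "(nat \<Rightarrow> real) \<Rightarrow> 'x \<Rightarrow> real" where
  "combination g x = (\<Sum>k. indicator (level k) x * (g k * \<phi> k x))"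

lemma level_sets [measurable]: "level k \<in> sets M"
  unfolding level_def by measurable

lemma indicator_level:
  assumes "x \<in> level k"
  shows "indicator (level j) x = (if j = k then 1 else 0 :: real)"
  using assms inj_L by (auto simp: level_def inj_eq)

lemma suminf_level:
  fixes h :: "nat \<Rightarrow> real"
  assumes "x \<in> level k"
  shows "(\<Sum>j. indicator (level j) x * h j) = h k"
proof -
  have "(\<Sum>j. indicator (level j) x * h j) = (\<Sum>j\<in>{k}. indicator (level j) x * h j)"
    by (rule suminf_finite) (auto simp: indicator_level[OF assms])
  then show ?thesis using assms by simp
qed

lemma combination_level: "x \<in> level k \<Longrightarrow> combination g x = g k * \<phi> k x"
  unfolding combination_def by (rule suminf_level)

lemma combination_outside: "(\<And>k. x \<notin> level k) \<Longrightarrow> combination g x = 0"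
  by (simp add: combination_def)

lemma combination_measurable [measurable]: "combination g \<in> borel_measurable M"
  unfolding combination_def[abs_def] by measurable

lemma integral_level:
  shows "integrable M (\<lambda>x. indicator (level k) x * (b * (\<phi> k x)\<^sup>2))"
    and "(LINT x|M. indicator (level k) x * (b * (\<phi> k x)\<^sup>2)) = b"
proof -
  have ae: "AE x in M. indicator (level k) x * (b * (\<phi> k x)\<^sup>2) = b * (\<phi> k x)\<^sup>2"
    using phi_support[of k] AE_space by eventually_elim (auto simp: level_def indicator_def)
  have i: "integrable M (\<lambda>x. b * (\<phi> k x)\<^sup>2)" using phi_int by simp
  show "integrable M (\<lambda>x. indicator (level k) x * (b * (\<phi> k x)\<^sup>2))"
    by (rule integrable_cong_AE_imp[OF i]) (use ae in \<open>auto elim: AE_mp\<close>)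
  have "(LINT x|M. indicator (level k) x * (b * (\<phi> k x)\<^sup>2)) = (LINT x|M. b * (\<phi> k x)\<^sup>2)"
    by (rule integral_cong_AE) (use ae in auto)
  then show "(LINT x|M. indicator (level k) x * (b * (\<phi> k x)\<^sup>2)) = b"
    using phi_norm by simp
qed

text \<open>On the \<open>k\<close>-th level the weight \<open>(1 + a)\<^sup>\<beta>\<close> is the constant \<open>(1 + L k)\<^sup>\<beta>\<close>, so the square of the weighted
  norm is the series in the hypothesis.\<close>

lemma combination_in_power_dom:
  assumes "summable (\<lambda>k. (1 + L k) powr (2 * \<beta>) * (g k)\<^sup>2)"
  shows "combination g \<in> power_dom M a \<beta>"
proof -
  define b where "b k = (1 + L k) powr (2 * \<beta>) * (g k)\<^sup>2" for k
  have b0: "b k \<ge> 0" for k by (simp add: b_def)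
  have sq: "((1 + a x) powr \<beta> * combination g x)\<^sup>2 = (\<Sum>k. indicator (level k) x * (b k * (\<phi> k x)\<^sup>2))"
    if "x \<in> space M" for x
  proof (cases "\<exists>k. x \<in> level k")
    case True
    then obtain k where k: "x \<in> level k" by blast
    then have "a x = L k" by (simp add: level_def)
    moreover have "((1 + L k) powr \<beta>)\<^sup>2 = (1 + L k) powr (2 * \<beta>)"
      using L_ge[of k] by (simp add: powr_power mult.commute)
    ultimately show ?thesis
      unfolding suminf_level[OF k] combination_level[OF k] by (simp add: b_def power_mult_distrib)
  next
    case False then show ?thesis by (simp add: combination_outside)
  qed
  have "integrable M (\<lambda>x. \<Sum>k. indicator (level k) x * (b k * (\<phi> k x)\<^sup>2))"
  proof (rule integrable_suminf)
    show "integrable M (\<lambda>x. indicator (level k) x * (b k * (\<phi> k x)\<^sup>2))" for k by (rule integral_level)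
    show "AE x in M. summable (\<lambda>k. norm (indicator (level k) x * (b k * (\<phi> k x)\<^sup>2)))"
    proof (rule AE_I2)
      fix x
      show "summable (\<lambda>k. norm (indicator (level k) x * (b k * (\<phi> k x)\<^sup>2)))"
      proof (cases "\<exists>k. x \<in> level k")
        case True
        then obtain k where "x \<in> level k" by blast
        then show ?thesis
          by (intro summable_finite[of "{k}"]) (auto simp: indicator_level)
      qed simp
    qed
    have "(LINT x|M. norm (indicator (level k) x * (b k * (\<phi> k x)\<^sup>2))) = b k" for k
      using integral_level(2)[of k "b k"] b0[of k] by (simp add: abs_mult)
    then show "summable (\<lambda>k. LINT x|M. norm (indicator (level k) x * (b k * (\<phi> k x)\<^sup>2)))"
      using assms by (simp add: b_def)
  qed
  then have "integrable M (\<lambda>x. ((1 + a x) powr \<beta> * combination g x)\<^sup>2)"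
    using sq by (subst Bochner_Integration.integrable_cong[OF refl sq]) auto
  then show ?thesis
    unfolding power_dom_def L2_def by (auto intro!: bexI[of _ "combination g"])
qed

text \<open>A single term of that series is the integral over one level set, hence bounded by the whole
  integral. Non-membership will be read off from this.\<close>

lemma power_dom_imp_bounded:
  assumes "combination g \<in> power_dom M a \<gamma>"
  shows "\<exists>C. \<forall>k. (1 + L k) powr (2 * \<gamma>) * (g k)\<^sup>2 \<le> C"
proof -
  obtain w where w: "w \<in> borel_measurable M" "AE x in M. combination g x = w x"
    and L2: "(\<lambda>x. (1 + a x) powr \<gamma> * w x) \<in> L2 M"
    using assms unfolding power_dom_def by blast
  have "(1 + L k) powr (2 * \<gamma>) * (g k)\<^sup>2 \<le> (LINT x|M. ((1 + a x) powr \<gamma> * w x)\<^sup>2)" for k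
  proof -
    define b where "b = (1 + L k) powr (2 * \<gamma>) * (g k)\<^sup>2"
    have "(LINT x|M. indicator (level k) x * (b * (\<phi> k x)\<^sup>2)) \<le> (LINT x|M. ((1 + a x) powr \<gamma> * w x)\<^sup>2)"
    proof (rule integral_mono_AE)
      show "integrable M (\<lambda>x. indicator (level k) x * (b * (\<phi> k x)\<^sup>2))" by (rule integral_level)
      show "integrable M (\<lambda>x. ((1 + a x) powr \<gamma> * w x)\<^sup>2)" using L2 by (simp add: L2_def)
      show "AE x in M. indicator (level k) x * (b * (\<phi> k x)\<^sup>2) \<le> ((1 + a x) powr \<gamma> * w x)\<^sup>2"
        using w(2)
      proof eventually_elim
        fix x assume wx: "combination g x = w x"
        show "indicator (level k) x * (b * (\<phi> k x)\<^sup>2) \<le> ((1 + a x) powr \<gamma> * w x)\<^sup>2"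
        proof (cases "x \<in> level k")
          case True
          then have "a x = L k" by (simp add: level_def)
          moreover have "((1 + L k) powr \<gamma>)\<^sup>2 = (1 + L k) powr (2 * \<gamma>)"
            using L_ge[of k] by (simp add: powr_power mult.commute)
          ultimately show ?thesis
            using True wx[symmetric] by (simp add: combination_level[OF True] b_def power_mult_distrib)
        qed simp
      qed
    qed
    then show ?thesis unfolding integral_level(2) b_def .
  qed
  then show ?thesis by blast
qed

text \<open>With the weights \<open>(1 + L k)\<^bsup>-k\<^esup>\<close> the initial velocities decay faster than any power of \<open>L k\<close>, while
  at a fixed positive time the amplification \<open>(1 + L k)\<^bsup>2k\<^esup>\<close>, available for all large \<open>k\<close>, leaves a
  growth like \<open>(1 + L k)\<^bsup>k\<^esup>\<close>, faster than any power.\<close>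

lemma infinite_derivative_loss_of_amplified:
  assumes T0: "T0 > 0"
    and osc: "\<And>k. oscillator T0 (\<lambda>t. L k * c t) (w k) (v k)" "\<And>k. w k 0 = 0" "\<And>k. v k 0 = 1"
    and big: "\<And>k t. t \<in> {1 / Suc k..T0} \<Longrightarrow> (1 + L k) ^ (2 * k) < norm (w k t, v k t)"
  shows "infinite_derivative_loss T0 M a c"
proof -
  define \<epsilon> where "\<epsilon> k = (1 + L k) powr - real k" for k
  have L1: "1 + L k \<ge> 2" for k using L_ge[of k] by simp
  define u where "u t = combination (\<lambda>k. \<epsilon> k * w k t)" for t
  define u' where "u' t = combination (\<lambda>k. \<epsilon> k * v k t)" for t
  have sol: "is_solution T0 M a c (u 0) (u' 0) u u'"
    unfolding is_solution_def
  proof (intro conjI)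
    show "u 0 \<in> borel_measurable M" "u' 0 \<in> borel_measurable M"
      unfolding u_def u'_def by measurable
    show "AE x in M. u 0 x = u 0 x \<and> u' 0 x = u' 0 x \<and>
        (\<forall>t\<in>{0..T0}. ((\<lambda>s. u s x) has_real_derivative u' t x) (at t within {0..T0}) \<and>
           ((\<lambda>s. u' s x) has_real_derivative - (c t * a x * u t x)) (at t within {0..T0}))"
    proof (rule AE_I2, intro conjI refl ballI)
      fix x t assume x: "x \<in> space M" and t: "t \<in> {0..T0}"
      show "((\<lambda>s. u s x) has_real_derivative u' t x) (at t within {0..T0})"
        "((\<lambda>s. u' s x) has_real_derivative - (c t * a x * u t x)) (at t within {0..T0})"
      proof (atomize (full), cases "\<exists>k. x \<in> level k")
        case True
        then obtain k where k: "x \<in> level k" by blast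
        then have a: "a x = L k" by (simp add: level_def)
        have e: "u s x = \<epsilon> k * \<phi> k x * w k s" "u' s x = \<epsilon> k * \<phi> k x * v k s" for s
          unfolding u_def u'_def combination_level[OF k] by simp_all
        have "oscillator T0 (\<lambda>t. L k * c t) (\<lambda>s. \<epsilon> k * \<phi> k x * w k s) (\<lambda>s. \<epsilon> k * \<phi> k x * v k s)"
          by (rule oscillator_scale[OF osc(1)])
        then show "((\<lambda>s. u s x) has_real_derivative u' t x) (at t within {0..T0}) \<and>
            ((\<lambda>s. u' s x) has_real_derivative - (c t * a x * u t x)) (at t within {0..T0})"
          unfolding e a oscillator_def using t by (simp add: mult_ac)
      next
        case False
        then show "((\<lambda>s. u s x) has_real_derivative u' t x) (at t within {0..T0}) \<and>
            ((\<lambda>s. u' s x) has_real_derivative - (c t * a x * u t x)) (at t within {0..T0})"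
          by (simp add: u_def u'_def combination_outside)
      qed
    qed
  qed
  have regular: "(u 0, u' 0) \<in> power_dom M a (\<beta> + 1 / 2) \<times> power_dom M a \<beta>" if "\<beta> > 0" for \<beta>
  proof -
    have "u 0 \<in> power_dom M a (\<beta> + 1 / 2)"
      unfolding u_def by (rule combination_in_power_dom) (simp add: osc)
    moreover have "u' 0 \<in> power_dom M a \<beta>"
      unfolding u'_def
    proof (rule combination_in_power_dom)
      have b: "norm ((1 + L k) powr (2 * \<beta>) * (\<epsilon> k * v k 0)\<^sup>2) \<le> 2 powr (2 * \<beta>) * (1 / 4) ^ k"
        if "k \<ge> nat \<lceil>\<beta>\<rceil>" for k
      proof -
        have "\<beta> \<le> real k" using that by linarith
        have "(1 + L k) powr (2 * \<beta>) * (\<epsilon> k * v k 0)\<^sup>2 = (1 + L k) powr (2 * \<beta> - 2 * real k)"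
          using L1[of k] by (simp add: osc \<epsilon>_def powr_power powr_add[symmetric])
        also have "\<dots> \<le> 2 powr (2 * \<beta> - 2 * real k)"
          using L1[of k] \<open>\<beta> \<le> real k\<close> by (intro powr_mono2') auto
        also have "\<dots> = 2 powr (2 * \<beta>) * (1 / 4) ^ k"
        proof -
          have "2 powr (2 * real k) = (4::real) ^ k"
            using powr_realpow[of "2::real" "2 * k"] by (simp add: power_mult)
          then show ?thesis by (simp add: powr_diff power_one_over)
        qed
        finally show ?thesis by simp
      qed
      show "summable (\<lambda>k. (1 + L k) powr (2 * \<beta>) * (\<epsilon> k * v k 0)\<^sup>2)"
        by (rule summable_comparison_test'[OF _ b]) (intro summable_mult summable_geometric, simp)
    qed
    ultimately show ?thesis by simp
  qed
  have irregular: "(u t, u' t) \<notin> power_dom M a (- \<beta> + 1 / 2) \<times> power_dom M a (- \<beta>)"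
    if beta: "\<beta> > 0" and t: "t \<in> {0<..T0}" for \<beta> t
  proof
    assume "(u t, u' t) \<in> power_dom M a (- \<beta> + 1 / 2) \<times> power_dom M a (- \<beta>)"
    then obtain C1 C2 where C: "\<And>k. (1 + L k) powr (2 * (- \<beta> + 1 / 2)) * (\<epsilon> k * w k t)\<^sup>2 \<le> C1"
      "\<And>k. (1 + L k) powr (2 * - \<beta>) * (\<epsilon> k * v k t)\<^sup>2 \<le> C2"
      using power_dom_imp_bounded[of "\<lambda>k. \<epsilon> k * w k t"] power_dom_imp_bounded[of "\<lambda>k. \<epsilon> k * v k t"]
      unfolding u_def u'_def by blast
    \<comment> \<open>membership would bound \<open>4\<^sup>k\<close>, as \<open>1 + L k \<ge> 2\<close>\<close>
    obtain n :: nat where n: "(C1 + C2) * 2 powr (2 * \<beta>) < 4 ^ n" using real_arch_pow[of 4] by auto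
    obtain j :: nat where j: "inverse (real (Suc j)) < t" using reals_Archimedean[of t] t by auto
    define k where "k = max n (max j (nat \<lceil>\<beta>\<rceil>))"
    have k: "n \<le> k" "j \<le> k" "\<beta> \<le> real k" unfolding k_def by linarith+
    have "1 / real (Suc k) \<le> 1 / real (Suc j)" using k by (intro divide_left_mono) auto
    then have "t \<in> {1 / Suc k..T0}" using j t by (simp add: inverse_eq_divide)
    from big[OF this] have "((1 + L k) ^ (2 * k))\<^sup>2 \<le> (norm (w k t, v k t))\<^sup>2"
      using L1[of k] by (intro power_mono) auto
    then have g: "(1 + L k) powr (4 * real k) \<le> (w k t)\<^sup>2 + (v k t)\<^sup>2"
      using L1[of k] powr_realpow[of "1 + L k" "4 * k"]
      by (simp add: norm_Pair power_mult[symmetric] mult.commute)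
    have "4 ^ n \<le> (4::real) ^ k" using k by (intro power_increasing) auto
    also have "(4::real) ^ k = 2 powr (2 * real k - 2 * \<beta>) * 2 powr (2 * \<beta>)"
      using powr_realpow[of "2::real" "2 * k"] by (simp add: powr_add[symmetric] power_mult)
    also have "\<dots> \<le> (1 + L k) powr (2 * real k - 2 * \<beta>) * 2 powr (2 * \<beta>)"
      using L1[of k] k by (intro mult_right_mono powr_mono2) auto
    also have "(1 + L k) powr (2 * real k - 2 * \<beta>)
        = (1 + L k) powr (- 2 * \<beta>) * (\<epsilon> k)\<^sup>2 * (1 + L k) powr (4 * real k)"
      using L1[of k] by (simp add: \<epsilon>_def powr_power powr_add[symmetric])
    also have "\<dots> \<le> (1 + L k) powr (- 2 * \<beta>) * (\<epsilon> k)\<^sup>2 * ((w k t)\<^sup>2 + (v k t)\<^sup>2)"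
      using g by (intro mult_left_mono) auto
    also have "\<dots> = (1 + L k) powr (- 2 * \<beta>) * (\<epsilon> k * w k t)\<^sup>2 + (1 + L k) powr (2 * - \<beta>) * (\<epsilon> k * v k t)\<^sup>2"
      by (simp add: algebra_simps power_mult_distrib)
    also have "\<dots> \<le> (1 + L k) powr (2 * (- \<beta> + 1 / 2)) * (\<epsilon> k * w k t)\<^sup>2 + (1 + L k) powr (2 * - \<beta>) * (\<epsilon> k * v k t)\<^sup>2"
      using L1[of k] by (intro add_right_mono mult_right_mono powr_mono) auto
    also have "\<dots> \<le> C1 + C2" using C[of k] by (rule add_mono)
    finally have "4 ^ n \<le> (C1 + C2) * 2 powr (2 * \<beta>)" by simp
    then show False using n by linarith
  qed
  show ?thesis unfolding infinite_derivative_loss_def using sol regular irregular by blast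
qed

end

text \<open>From the amplified eigenvalues, one for each \<open>k\<close>, a sequence with strictly increasing eigenvalues
  is extracted, as different \<open>k\<close> need not come with different eigenvalues.\<close>

lemma infinite_derivative_loss_if_amplifies:
  assumes rep: "spectral_representation D A M a U" and T0: "T0 > 0"
    and e: "\<And>n. inner (e n) (e n) = 1" "\<And>n. e n \<in> D" "\<And>n. A (e n) = l n *\<^sub>R e n"
    and amp: "\<And>k. \<exists>n. real (Suc k) < l n \<and> amplifies T0 (1 / Suc k) ((1 + l n) ^ (2 * k)) (l n) c"
  shows "infinite_derivative_loss T0 M a c"
proof -
  define P where "P k n \<longleftrightarrow> real (Suc k) < l n \<and> amplifies T0 (1 / Suc k) ((1 + l n) ^ (2 * k)) (l n) c"
    for k n
  have antimono: "P j n" if "P k n" "j \<le> k" for j k n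
  proof -
    have "(1 + l n) ^ (2 * j) \<le> (1 + l n) ^ (2 * k)"
      using that by (intro power_increasing) (auto simp: P_def)
    moreover have "1 / real (Suc k) \<le> 1 / real (Suc j)" using that by (intro divide_left_mono) auto
    ultimately show ?thesis using that amplifies_mono unfolding P_def by fastforce
  qed
  have "\<exists>f. \<forall>k. P k (f k) \<and> l (f k) < l (f (Suc k))"
  proof (rule dependent_nat_choice)
    show "\<exists>n. P 0 n" using amp unfolding P_def by blast
    fix x k
    obtain K :: nat where K: "l x < real K" using reals_Archimedean2 by blast
    obtain n where n: "P (max K (Suc k)) n" using amp unfolding P_def by blast
    then have "P (Suc k) n" by (rule antimono) simp
    moreover have "l x < l n" using n K unfolding P_def by linarith
    ultimately show "\<exists>y. P (Suc k) y \<and> l x < l y" by blast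
  qed
  then obtain f where f: "\<And>k. P k (f k)" "\<And>k. l (f k) < l (f (Suc k))" by blast
  define L where "L k = l (f k)" for k
  have "strict_mono L" unfolding L_def by (rule strict_mono_Suc_iff[THEN iffD2]) (simp add: f)
  then have "inj L" by (rule strict_mono_imp_inj_on)
  note ef = spectral_eigenfunction[OF rep e]
  interpret eigenfunction_series M a L "\<lambda>k. U (e (f k))"
  proof
    show "a \<in> borel_measurable M" "\<And>x. x \<in> space M \<Longrightarrow> 0 \<le> a x"
      using rep by (auto simp: spectral_representation_def)
    show "1 \<le> L k" for k using f(1)[of k] by (simp add: L_def P_def)
    show "AE x in M. a x \<noteq> L k \<longrightarrow> U (e (f k)) x = 0" for k unfolding L_def by (rule ef)
  qed (use \<open>inj L\<close> ef in auto)
  have "\<exists>w v. oscillator T0 (\<lambda>t. L k * c t) w v \<and> w 0 = 0 \<and> v 0 = 1 \<and>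
      (\<forall>t\<in>{1 / Suc k..T0}. (1 + L k) ^ (2 * k) < norm (w t, v t))" for k
    using f(1)[of k] unfolding P_def amplifies_def L_def by blast
  then obtain w v where "\<And>k. oscillator T0 (\<lambda>t. L k * c t) (w k) (v k)" "\<And>k. w k 0 = 0" "\<And>k. v k 0 = 1"
    "\<And>k t. t \<in> {1 / Suc k..T0} \<Longrightarrow> (1 + L k) ^ (2 * k) < norm (w k t, v k t)"
    by metis
  then show ?thesis by (rule infinite_derivative_loss_of_amplified[OF T0])
qed

section \<open>Infinite derivative loss is generic\<close>

theorem theorem2p10:
  fixes D :: "'h::{real_inner, complete_space} set" and A :: "'h \<Rightarrow> 'h"
    and M :: "'x measure" and a :: "'x \<Rightarrow> real" and U :: "'h \<Rightarrow> 'x \<Rightarrow> real"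
    and T0 \<mu>1 \<mu>2 :: real and \<omega> \<psi> :: "real \<Rightarrow> real"
  assumes "self_adjoint_op D A" and "nonneg_op D A" and "unbounded_pos_mult_op D A"
    and "spectral_representation D A M a U"
    and "T0 > 0" and "\<mu>1 > 0" and "\<mu>2 > \<mu>1"
    and "\<forall>t\<in>{0<..T0}. \<omega> t > 0" and "\<forall>t\<in>{0<..T0}. \<psi> t > 0"
    and "antimono_on {0<..T0} \<omega>" and "antimono_on {0<..T0} \<psi>"
    and "filterlim \<omega> at_top (at_right 0)"
    and "filterlim (\<lambda>t. \<omega> t * \<psi> t / \<bar>ln t\<bar>) at_top (at_right 0)"
  shows "residual_in (Metric_space.mtopology (PS2 T0 \<mu>1 \<mu>2 \<omega> \<psi>) (dist_PS2 T0 \<mu>1 \<mu>2 \<omega> \<psi>))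
           {c \<in> PS2 T0 \<mu>1 \<mu>2 \<omega> \<psi>. infinite_derivative_loss T0 M a c}"
proof -
  interpret propagation_speeds T0 \<mu>1 \<mu>2 \<omega> \<psi> by unfold_locales (use assms in auto)
  obtain e :: "nat \<Rightarrow> 'h" and l :: "nat \<Rightarrow> real"
    where "\<forall>m n. inner (e m) (e n) = (if m = n then 1 else 0)"
    "\<forall>n. l n > 0" and unbounded: "\<not> bdd_above (range l)" and "\<forall>n. e n \<in> D \<and> A (e n) = l n *\<^sub>R e n"
    using assms(3) unfolding unbounded_pos_mult_op_def by - (elim exE conjE, rule that)
  then have e: "\<And>n. inner (e n) (e n) = 1" "\<And>n. e n \<in> D" "\<And>n. A (e n) = l n *\<^sub>R e n"
    and l: "\<And>n. l n > 0" by simp_all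
  define G where
    "G k = {c \<in> \<P>. \<exists>n. real (Suc k) < l n \<and> amplifies T0 (1 / Suc k) ((1 + l n) ^ (2 * k)) (l n) c}" for k
  have om: "\<omega> t > 0" if "t \<in> {0<..T0}" for t using omega_pos that by blast
  have ms: "Metric_space \<P> (dist_PS2 T0 \<mu>1 \<mu>2 \<omega> \<psi>)" using om by (rule Metric_space_PS2[OF T0])
  show ?thesis
  proof (rule Metric_space.residual_in_of_dense_open[OF ms, of G])
    show "openin (Metric_space.mtopology \<P> (dist_PS2 T0 \<mu>1 \<mu>2 \<omega> \<psi>)) (G k)" for k
      unfolding Metric_space.openin_mtopology[OF ms]
    proof (intro conjI allI impI)
      fix c assume "c \<in> G k"
      then obtain n where c: "c \<in> \<P>" and n: "real (Suc k) < l n"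
        "amplifies T0 (1 / Suc k) ((1 + l n) ^ (2 * k)) (l n) c" unfolding G_def by blast
      obtain r where "r > 0" and "\<forall>d\<in>\<P>. dist_PS2 T0 \<mu>1 \<mu>2 \<omega> \<psi> c d < r \<longrightarrow>
          amplifies T0 (1 / Suc k) ((1 + l n) ^ (2 * k)) (l n) d"
        using amplifies_open[OF T0 om mu1 c less_imp_le[OF l] _ n(2)] by auto
      then show "\<exists>r>0. Metric_space.mball \<P> (dist_PS2 T0 \<mu>1 \<mu>2 \<omega> \<psi>) c r \<subseteq> G k"
        using n by (intro exI[of _ r]) (auto simp: G_def Metric_space.in_mball[OF ms])
    qed (auto simp: G_def)
    show "\<exists>d\<in>G k. dist_PS2 T0 \<mu>1 \<mu>2 \<omega> \<psi> c d < r" if c: "c \<in> \<P>" and r: "r > 0" for k c r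
    proof -
      have "r / 7 > 0" "1 / real (Suc k) > 0" using r by auto
      from amplifying_speeds_dense[OF c this, of "2 * k"] obtain l0 where
        l0: "\<And>l. l \<ge> l0 \<Longrightarrow> \<exists>d\<in>\<P>. dist_PS2 T0 \<mu>1 \<mu>2 \<omega> \<psi> c d \<le> 6 * (r / 7) \<and>
          amplifies T0 (1 / Suc k) ((1 + l) ^ (2 * k)) l d"
        unfolding amplifies_def by blast
      have "\<forall>b. \<exists>n. b < l n" using unbounded unfolding bdd_above_def by (auto simp: not_le)
      then obtain n where n: "max l0 (real (Suc k)) < l n" by blast
      then obtain d where "d \<in> \<P>" "dist_PS2 T0 \<mu>1 \<mu>2 \<omega> \<psi> c d \<le> 6 * (r / 7)"
        "amplifies T0 (1 / Suc k) ((1 + l n) ^ (2 * k)) (l n) d" using l0[of "l n"] by auto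
      then show ?thesis using n r by (intro bexI[of _ d]) (auto simp: G_def)
    qed
    show "(\<Inter>k. G k) \<subseteq> {c \<in> \<P>. infinite_derivative_loss T0 M a c}"
    proof
      fix c assume "c \<in> (\<Inter>k. G k)"
      then have "c \<in> \<P>" and amp: "\<And>k. \<exists>n. real (Suc k) < l n \<and>
          amplifies T0 (1 / Suc k) ((1 + l n) ^ (2 * k)) (l n) c" unfolding G_def by blast+
      moreover have "infinite_derivative_loss T0 M a c"
        by (rule infinite_derivative_loss_if_amplifies[where e = e and l = l, OF assms(4) T0 e amp])
      ultimately show "c \<in> {c \<in> \<P>. infinite_derivative_loss T0 M a c}" by blast
    qed
  qed auto
qed

end
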